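(* Let $0<p<q\leq1$. No infinite-dimensional $q$-Banach space has the $p$-Lipschitz lifting property.
   Context: All vector spaces are real. For $0<s\le 1$, an $s$-Banach space is a complete quasi-normed space $X$ with $\|x+y\|^s\le\|x\|^s+\|y\|^s$ for all $x,y\in X$; a $q$-Banach space is also a $p$-Banach space when $p\le q$. An $s$-metric $d$ is a function such that $d^s$ is a metric. Pointed maps send base point to base point (the base point of a vector space being $0$). For a pointed $p$-metric space $(M,d,0)$, the Lipschitz-free $p$-space $\mathcal F_p(M)$ is the (unique up to linear isometry) $p$-Banach space equipped with an isometric pointed map $\delta_M\colon M\to\mathcal F_p(M)$ whose linear span is dense, such that every pointed Lipschitz map $f\colon M\to Y$ into a $p$-Banach space $Y$ has a unique bounded linear extension $\widehat f\colon\mathcal F_p(M)\to Y$ with $\widehat f\,\delta_M=f$, and $\|\widehat f\|=\operatorname{Lip}(f)$. A $p$-Banach space $X$ is regarded as a pointed $p$-metric space with distance $\|x-y\|$ and base point $0$. The barycenter map $\beta_X\colon\mathcal F_p(X)\to X$ is the linearization of $\mathrm{Id}_X$, so $\beta_X\delta_X(x)=x$. A $p$-Banach space $X$ has the $p$-Lipschitz lifting property (of Albiac and Kalton) if, in the equivalent form used here, there is a bounded linear map $S\colon X\to\mathcal F_p(X)$ with $\beta_XS=\mathrm{Id}_X$. *)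

theory Defs
  imports "HOL-Analysis.Analysis" "HOL-Analysis.Finite_Function_Topology"
begin

text \<open>A space is a linear subspace \<open>V\<close> of a real vector space type together with a function \<open>N\<close>
  of which only the values on \<open>V\<close> matter.\<close>

definition quasi_norm_on :: "'v::real_vector set \<Rightarrow> ('v \<Rightarrow> real) \<Rightarrow> bool" where
  "quasi_norm_on V N \<longleftrightarrow> subspace V
     \<and> (\<forall>x\<in>V. 0 \<le> N x) \<and> (\<forall>x\<in>V. N x = 0 \<longleftrightarrow> x = 0)
     \<and> (\<forall>a. \<forall>x\<in>V. N (a *\<^sub>R x) = \<bar>a\<bar> * N x)
     \<and> (\<exists>\<kappa>. \<forall>x\<in>V. \<forall>y\<in>V. N (x + y) \<le> \<kappa> * (N x + N y))"

definition complete_on :: "'v::real_vector set \<Rightarrow> ('v \<Rightarrow> real) \<Rightarrow> bool" where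
  "complete_on V N \<longleftrightarrow>
     (\<forall>s. (\<forall>n::nat. s n \<in> V) \<longrightarrow> (\<forall>e>0. \<exists>K. \<forall>m\<ge>K. \<forall>n\<ge>K. N (s m - s n) < e)
        \<longrightarrow> (\<exists>x\<in>V. (\<lambda>n. N (s n - x)) \<longlonglongrightarrow> 0))"

definition s_banach :: "real \<Rightarrow> 'v::real_vector set \<Rightarrow> ('v \<Rightarrow> real) \<Rightarrow> bool" where
  "s_banach s V N \<longleftrightarrow> quasi_norm_on V N
     \<and> (\<forall>x\<in>V. \<forall>y\<in>V. N (x + y) powr s \<le> N x powr s + N y powr s)
     \<and> complete_on V N"

definition bounded_linear_on ::
  "'v::real_vector set \<Rightarrow> ('v \<Rightarrow> real) \<Rightarrow> 'w::real_vector set \<Rightarrow> ('w \<Rightarrow> real) \<Rightarrow> ('v \<Rightarrow> 'w) \<Rightarrow> bool" where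
  "bounded_linear_on V N W N' T \<longleftrightarrow> T ` V \<subseteq> W
     \<and> (\<forall>x\<in>V. \<forall>y\<in>V. T (x + y) = T x + T y)
     \<and> (\<forall>a. \<forall>x\<in>V. T (a *\<^sub>R x) = a *\<^sub>R T x)
     \<and> (\<exists>C. \<forall>x\<in>V. N' (T x) \<le> C * N x)"

definition op_norm :: "'v set \<Rightarrow> ('v \<Rightarrow> real) \<Rightarrow> ('w \<Rightarrow> real) \<Rightarrow> ('v \<Rightarrow> 'w) \<Rightarrow> real" where
  "op_norm V N N' T = Inf {C. 0 \<le> C \<and> (\<forall>x\<in>V. N' (T x) \<le> C * N x)}"

definition p_metric_on :: "real \<Rightarrow> 'a set \<Rightarrow> ('a \<Rightarrow> 'a \<Rightarrow> real) \<Rightarrow> bool" where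
  "p_metric_on p M d \<longleftrightarrow>
     (\<forall>x\<in>M. \<forall>y\<in>M. 0 \<le> d x y \<and> (d x y = 0 \<longleftrightarrow> x = y) \<and> d x y = d y x)
     \<and> (\<forall>x\<in>M. \<forall>y\<in>M. \<forall>z\<in>M. d x z powr p \<le> d x y powr p + d y z powr p)"

definition pointed_lipschitz ::
  "'a set \<Rightarrow> ('a \<Rightarrow> 'a \<Rightarrow> real) \<Rightarrow> 'a \<Rightarrow> 'w::real_vector set \<Rightarrow> ('w \<Rightarrow> real) \<Rightarrow> ('a \<Rightarrow> 'w) \<Rightarrow> bool" where
  "pointed_lipschitz M d z Y N f \<longleftrightarrow> f ` M \<subseteq> Y \<and> f z = 0
     \<and> (\<exists>C. \<forall>x\<in>M. \<forall>y\<in>M. N (f x - f y) \<le> C * d x y)"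

definition lip_const ::
  "'a set \<Rightarrow> ('a \<Rightarrow> 'a \<Rightarrow> real) \<Rightarrow> ('w::real_vector \<Rightarrow> real) \<Rightarrow> ('a \<Rightarrow> 'w) \<Rightarrow> real" where
  "lip_const M d N f = Inf {C. 0 \<le> C \<and> (\<forall>x\<in>M. \<forall>y\<in>M. N (f x - f y) \<le> C * d x y)}"

definition extends_lipschitz ::
  "'a set \<Rightarrow> ('a \<Rightarrow> 'a \<Rightarrow> real) \<Rightarrow> 'a \<Rightarrow> 'v::real_vector set \<Rightarrow> ('v \<Rightarrow> real) \<Rightarrow> ('a \<Rightarrow> 'v)
     \<Rightarrow> 'w::real_vector set \<Rightarrow> ('w \<Rightarrow> real) \<Rightarrow> bool" where
  "extends_lipschitz M d z F N \<delta> Y NY \<longleftrightarrow>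
     (\<forall>f. pointed_lipschitz M d z Y NY f \<longrightarrow>
        (\<exists>T. bounded_linear_on F N Y NY T \<and> (\<forall>x\<in>M. T (\<delta> x) = f x)
           \<and> op_norm F N NY T = lip_const M d NY f
           \<and> (\<forall>T'. bounded_linear_on F N Y NY T' \<and> (\<forall>x\<in>M. T' (\<delta> x) = f x)
                \<longrightarrow> (\<forall>u\<in>F. T' u = T u))))"

text \<open>HOL cannot quantify over types inside a formula, so the free space and the target spaces \<open>Y\<close>
  of its universal property are taken among the subspaces of one large vector space: the free
  real vector space on the sequences of finitely supported functions on the points.
  No generality is lost: \<open>lipschitz_free_exists\<close> below shows that the free space can
  always be found there, and \<open>lipschitz_free_universal\<close> that it then has the universal property
  for targets in every type.\<close>

type_synonym 'a big = "(nat \<Rightarrow> ('a, real) poly_mapping, real) poly_mapping"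

definition lipschitz_free ::
  "real \<Rightarrow> 'a set \<Rightarrow> ('a \<Rightarrow> 'a \<Rightarrow> real) \<Rightarrow> 'a \<Rightarrow> 'a big set \<Rightarrow> ('a big \<Rightarrow> real) \<Rightarrow> ('a \<Rightarrow> 'a big) \<Rightarrow> bool" where
  "lipschitz_free p M d z F N \<delta> \<longleftrightarrow>
     p_metric_on p M d \<and> z \<in> M \<and> s_banach p F N
     \<and> \<delta> ` M \<subseteq> F \<and> \<delta> z = 0 \<and> (\<forall>x\<in>M. \<forall>y\<in>M. N (\<delta> x - \<delta> y) = d x y)
     \<and> (\<forall>u\<in>F. \<forall>e>0. \<exists>v\<in>span (\<delta> ` M). N (u - v) < e)
     \<and> (\<forall>(Y :: 'a big set) NY. s_banach p Y NY \<longrightarrow> extends_lipschitz M d z F N \<delta> Y NY)"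

definition barycenter ::
  "'a::real_vector set \<Rightarrow> ('a \<Rightarrow> real) \<Rightarrow> 'a big set \<Rightarrow> ('a big \<Rightarrow> real) \<Rightarrow> ('a \<Rightarrow> 'a big)
     \<Rightarrow> ('a big \<Rightarrow> 'a) \<Rightarrow> bool" where
  "barycenter V N F NF \<delta> \<beta> \<longleftrightarrow> bounded_linear_on F NF V N \<beta> \<and> (\<forall>x\<in>V. \<beta> (\<delta> x) = x)"

definition lipschitz_lifting_property :: "real \<Rightarrow> 'a::real_vector set \<Rightarrow> ('a \<Rightarrow> real) \<Rightarrow> bool" where
  "lipschitz_lifting_property p V N \<longleftrightarrow>
     (\<exists>F NF \<delta> \<beta> S. lipschitz_free p V (\<lambda>x y. N (x - y)) 0 F NF \<delta>
        \<and> barycenter V N F NF \<delta> \<beta>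
        \<and> bounded_linear_on V N F NF S \<and> (\<forall>x\<in>V. \<beta> (S x) = x))"

locale psemi =
  fixes p :: real and V :: "'v::real_vector set" and R :: "'v \<Rightarrow> real"
  assumes p0: "0 < p" and p1: "p \<le> 1" and sub: "subspace V"
    and nn: "x \<in> V \<Longrightarrow> 0 \<le> R x"
    and sc: "x \<in> V \<Longrightarrow> R (a *\<^sub>R x) = \<bar>a\<bar> powr p * R x"
    and add: "x \<in> V \<Longrightarrow> y \<in> V \<Longrightarrow> R (x + y) \<le> R x + R y"
begin

lemmas mem = subspace_add[OF sub] subspace_diff[OF sub] subspace_scale[OF sub] subspace_0[OF sub]
  subspace_neg[OF sub]

lemma R0: "R 0 = 0"
  using sc[of 0 0] mem by simp

lemma Rminus: "x \<in> V \<Longrightarrow> R (- x) = R x"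
  using sc[of x "-1"] by simp

lemma Rcomm: "x \<in> V \<Longrightarrow> y \<in> V \<Longrightarrow> R (x - y) = R (y - x)"
  using Rminus[of "x - y"] mem by simp

lemma Rtri: "x \<in> V \<Longrightarrow> y \<in> V \<Longrightarrow> z \<in> V \<Longrightarrow> R (x - z) \<le> R (x - y) + R (y - z)"
  using add[of "x - y" "y - z"] mem by simp

lemma Rabs: assumes "x \<in> V" "y \<in> V" shows "\<bar>R x - R y\<bar> \<le> R (x - y)"
  using add[of "x - y" y] add[of "y - x" x] Rcomm[of x y] assms mem by simp

lemma Rlim:
  assumes "\<And>n. s n \<in> V" "x \<in> V" "(\<lambda>n. R (s n - x)) \<longlonglongrightarrow> 0"
  shows "(\<lambda>n. R (s n)) \<longlonglongrightarrow> R x"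
proof -
  have "(\<lambda>n. R (s n) - R x) \<longlonglongrightarrow> 0"
    by (rule Lim_null_comparison[OF _ assms(3)]) (simp add: Rabs assms)
  then show ?thesis by (simp add: LIM_zero_iff)
qed

lemma Rlim_add:
  assumes "\<And>n. s n \<in> V" "x \<in> V" "(\<lambda>n. R (s n - x)) \<longlonglongrightarrow> 0"
    "\<And>n. t n \<in> V" "y \<in> V" "(\<lambda>n. R (t n - y)) \<longlonglongrightarrow> 0"
  shows "(\<lambda>n. R ((s n + t n) - (x + y))) \<longlonglongrightarrow> 0"
proof -
  have *: "(s n + t n) - (x + y) = (s n - x) + (t n - y)" for n by simp
  have "(\<lambda>n. R (s n - x) + R (t n - y)) \<longlonglongrightarrow> 0"
    using tendsto_add[OF assms(3,6)] by simp
  then show ?thesis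
    by (rule tendsto_0_le[where K=1]) (use nn add assms mem in \<open>auto simp: *\<close>)
qed

lemma Rlim_sc:
  assumes "\<And>n. s n \<in> V" "x \<in> V" "(\<lambda>n. R (s n - x)) \<longlonglongrightarrow> 0"
  shows "(\<lambda>n. R (a *\<^sub>R s n - a *\<^sub>R x)) \<longlonglongrightarrow> 0"
  using tendsto_mult_left[OF assms(3), of "\<bar>a\<bar> powr p"] assms mem
  by (simp add: sc flip: scaleR_diff_right)

lemma Rlim_le:
  assumes "\<And>n. s n \<in> V" "x \<in> V" "y \<in> V" "(\<lambda>n. R (s n - x)) \<longlonglongrightarrow> 0" "(\<lambda>n. R (s n - y)) \<longlonglongrightarrow> 0"
  shows "R (x - y) = 0"
proof -
  have "(\<lambda>n. R (s n - x) + R (s n - y)) \<longlonglongrightarrow> 0"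
    using tendsto_add[OF assms(4,5)] by simp
  moreover have "R (x - y) \<le> R (s n - x) + R (s n - y)" for n
    using Rtri[of x "s n" y] Rcomm[of x "s n"] assms by simp
  ultimately have "R (x - y) \<le> 0"
    by (intro LIMSEQ_le_const) auto
  then show ?thesis using nn[of "x - y"] assms mem by force
qed

end

locale pnorm = psemi +
  assumes zero: "x \<in> V \<Longrightarrow> R x = 0 \<Longrightarrow> x = 0"

lemma powr_less_iff: 
  fixes p a e :: real
  assumes "0 < p" "0 \<le> a" "0 < e" shows "a powr p < e powr p \<longleftrightarrow> a < e"
  by (metis assms linorder_not_le powr_less_mono2 powr_mono2 less_le)

lemma complete_on_powr:
  assumes p: "0 < p" and V: "subspace V" and nn: "\<And>x. x \<in> V \<Longrightarrow> 0 \<le> N x"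
  shows "complete_on V (\<lambda>x. N x powr p) \<longleftrightarrow> complete_on V N"
proof -
  have lim: "(\<lambda>n. N (s n - x) powr p) \<longlonglongrightarrow> 0 \<longleftrightarrow> (\<lambda>n. N (s n - x)) \<longlonglongrightarrow> 0"
    if "\<And>n. s n \<in> V" "x \<in> V" for s x
  proof
    have nx: "0 \<le> N (s n - x)" for n using that nn subspace_diff[OF V] by blast
    { assume "(\<lambda>n. N (s n - x) powr p) \<longlonglongrightarrow> 0"
      then have "(\<lambda>n. (N (s n - x) powr p) powr (1/p)) \<longlonglongrightarrow> 0 powr (1/p)"
        by (rule tendsto_powr') (use p in auto)
      then show "(\<lambda>n. N (s n - x)) \<longlonglongrightarrow> 0"
        using p nx by (simp add: powr_powr) }
    { assume "(\<lambda>n. N (s n - x)) \<longlonglongrightarrow> 0"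
      then have "(\<lambda>n. N (s n - x) powr p) \<longlonglongrightarrow> 0 powr p"
        by (rule tendsto_powr') (use p nx in auto)
      then show "(\<lambda>n. N (s n - x) powr p) \<longlonglongrightarrow> 0" by simp }
  qed
  have cau: "(\<forall>e>0. \<exists>K. \<forall>m\<ge>K. \<forall>n\<ge>K. N (s m - s n) powr p < e) \<longleftrightarrow>
     (\<forall>e>0. \<exists>K. \<forall>m\<ge>K. \<forall>n\<ge>K. N (s m - s n) < e)" if "\<And>n. s n \<in> V" for s :: "nat \<Rightarrow> _"
  proof -
    have eq: "N (s m - s n) powr p < e powr p \<longleftrightarrow> N (s m - s n) < e" if "e > 0" for e m n
      using powr_less_iff p nn[of "s m - s n"] subspace_diff[OF V] \<open>\<And>n. s n \<in> V\<close> that by blast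
    show ?thesis
    proof (intro iffI allI impI)
      fix e :: real assume H: "\<forall>e>0. \<exists>K. \<forall>m\<ge>K. \<forall>n\<ge>K. N (s m - s n) powr p < e" and e: "e > 0"
      have "0 < e powr p" using e by simp
      with H obtain K where "\<forall>m\<ge>K. \<forall>n\<ge>K. N (s m - s n) powr p < e powr p" by meson
      then show "\<exists>K. \<forall>m\<ge>K. \<forall>n\<ge>K. N (s m - s n) < e" using eq[OF e] by auto
    next
      fix e :: real assume H: "\<forall>e>0. \<exists>K. \<forall>m\<ge>K. \<forall>n\<ge>K. N (s m - s n) < e" and e: "e > 0"
      have e': "0 < e powr (1/p)" using e by simp
      with H obtain K where "\<forall>m\<ge>K. \<forall>n\<ge>K. N (s m - s n) < e powr (1/p)" by meson
      moreover have "(e powr (1/p)) powr p = e" using e p by (simp add: powr_powr)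
      ultimately show "\<exists>K. \<forall>m\<ge>K. \<forall>n\<ge>K. N (s m - s n) powr p < e" using eq[OF e'] by auto
    qed
  qed
  have "((\<forall>n. s n \<in> V) \<longrightarrow> (\<forall>e>0. \<exists>K. \<forall>m\<ge>K. \<forall>n\<ge>K. N (s m - s n) powr p < e)
          \<longrightarrow> (\<exists>x\<in>V. (\<lambda>n. N (s n - x) powr p) \<longlonglongrightarrow> 0)) \<longleftrightarrow>
        ((\<forall>n. s n \<in> V) \<longrightarrow> (\<forall>e>0. \<exists>K. \<forall>m\<ge>K. \<forall>n\<ge>K. N (s m - s n) < e)
          \<longrightarrow> (\<exists>x\<in>V. (\<lambda>n. N (s n - x)) \<longlonglongrightarrow> 0))" for s :: "nat \<Rightarrow> _"
  proof (cases "\<forall>n. s n \<in> V")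
    case True
    then have "(\<exists>x\<in>V. (\<lambda>n. N (s n - x) powr p) \<longlonglongrightarrow> 0) \<longleftrightarrow> (\<exists>x\<in>V. (\<lambda>n. N (s n - x)) \<longlonglongrightarrow> 0)"
      using lim[of s] by (intro bex_cong refl) auto
    then show ?thesis using cau[of s] True by presburger
  qed blast
  then show ?thesis unfolding complete_on_def by presburger
qed

lemma quasi_triangle_of_powr:
  fixes p a b c :: real
  assumes p: "0 < p" and nn: "0 \<le> a" "0 \<le> b" "0 \<le> c" and le: "c powr p \<le> a powr p + b powr p"
  shows "c \<le> 2 powr (1/p) * (a + b)"
proof -
  have "c powr p \<le> (a + b) powr p + (a + b) powr p"
    using le powr_mono2[of p a "a + b"] powr_mono2[of p b "a + b"] p nn by simp
  also have "\<dots> = (2 powr (1/p) * (a + b)) powr p"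
    using p nn by (simp add: powr_mult powr_powr)
  finally show ?thesis
    using p nn powr_less_mono2[of p "2 powr (1/p) * (a + b)" c] by (smt (verit) mult_nonneg_nonneg powr_ge_zero)
qed

lemma s_banach_iff:
  assumes p: "0 < p" "p \<le> 1"
  shows "s_banach p V N \<longleftrightarrow>
    pnorm p V (\<lambda>x. N x powr p) \<and> (\<forall>x\<in>V. 0 \<le> N x) \<and> complete_on V (\<lambda>x. N x powr p)"
  (is "?L \<longleftrightarrow> ?R")
proof
  assume L: ?L
  then have V: "subspace V" and nn: "\<And>x. x \<in> V \<Longrightarrow> 0 \<le> N x"
    and z: "\<And>x. x \<in> V \<Longrightarrow> N x = 0 \<longleftrightarrow> x = 0"
    and s: "\<And>a x. x \<in> V \<Longrightarrow> N (a *\<^sub>R x) = \<bar>a\<bar> * N x"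
    unfolding s_banach_def quasi_norm_on_def by auto
  have "pnorm p V (\<lambda>x. N x powr p)"
  proof
    show "N (x + y) powr p \<le> N x powr p + N y powr p" if "x \<in> V" "y \<in> V" for x y
      using L that unfolding s_banach_def by blast
  qed (use p V nn z s in \<open>auto simp: powr_mult\<close>)
  then show ?R using nn L complete_on_powr[of p V N] p V unfolding s_banach_def by auto
next
  assume R: ?R
  then interpret pnorm p V "\<lambda>x. N x powr p" by simp
  have nnN: "\<And>x. x \<in> V \<Longrightarrow> 0 \<le> N x" using R by blast
  have ss: "N (a *\<^sub>R x) = \<bar>a\<bar> * N x" if x: "x \<in> V" for a x
  proof -
    have "N (a *\<^sub>R x) powr p = (\<bar>a\<bar> * N x) powr p"
      using sc[OF x, of a] nnN[OF x] by (simp add: powr_mult)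
    then have "(N (a *\<^sub>R x) powr p) powr (1/p) = ((\<bar>a\<bar> * N x) powr p) powr (1/p)" by simp
    then show ?thesis using p nnN[OF x] nnN[of "a *\<^sub>R x"] x mem by (simp add: powr_powr)
  qed
  have tri: "N (x + y) \<le> 2 powr (1/p) * (N x + N y)" if "x \<in> V" "y \<in> V" for x y
    using quasi_triangle_of_powr[OF p(1)] add[OF that] that nnN mem by blast
  have z: "N x = 0 \<longleftrightarrow> x = 0" if "x \<in> V" for x
    using zero[OF that] R0 by auto
  have "quasi_norm_on V N"
    unfolding quasi_norm_on_def
    by (intro conjI ballI allI exI[of _ "2 powr (1/p)"] sub nnN ss z tri)
  moreover have "complete_on V N"
    using R complete_on_powr[of p V N, OF p(1) sub nnN] by blast
  ultimately show ?L unfolding s_banach_def using add by blast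
qed

lemma bound_dense:
  assumes p: "0 < p" "p \<le> 1" and F: "s_banach p F N" and Y: "s_banach p Y NY"
    and T: "bounded_linear_on F N Y NY T"
    and D: "D \<subseteq> F" "\<And>u e. u \<in> F \<Longrightarrow> e > 0 \<Longrightarrow> \<exists>v\<in>D. N (u - v) powr p < e"
    and C: "0 \<le> C" "\<And>u. u \<in> D \<Longrightarrow> NY (T u) \<le> C * N u" and u: "u \<in> F"
  shows "NY (T u) \<le> C * N u"
proof -
  interpret F: pnorm p F "\<lambda>x. N x powr p" using F s_banach_iff p by blast
  interpret Y: pnorm p Y "\<lambda>x. NY x powr p" using Y s_banach_iff p by blast
  have nF: "\<And>x. x \<in> F \<Longrightarrow> 0 \<le> N x" and nY: "\<And>x. x \<in> Y \<Longrightarrow> 0 \<le> NY x"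
    using F Y unfolding s_banach_def quasi_norm_on_def by auto
  have TY: "\<And>x. x \<in> F \<Longrightarrow> T x \<in> Y" and Tadd: "\<And>x y. x \<in> F \<Longrightarrow> y \<in> F \<Longrightarrow> T (x + y) = T x + T y"
    and Tsc: "\<And>a x. x \<in> F \<Longrightarrow> T (a *\<^sub>R x) = a *\<^sub>R T x"
    using T unfolding bounded_linear_on_def by auto
  obtain B0 where B0: "\<And>x. x \<in> F \<Longrightarrow> NY (T x) \<le> B0 * N x"
    using T unfolding bounded_linear_on_def by blast
  define B where "B = max 0 B0"
  have B: "0 \<le> B" "\<And>x. x \<in> F \<Longrightarrow> NY (T x) \<le> B * N x"
  proof -
    show "0 \<le> B" by (simp add: B_def)
    fix x assume x: "x \<in> F"
    have "B0 * N x \<le> B * N x" using nF[OF x] by (intro mult_right_mono) (auto simp: B_def)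
    then show "NY (T x) \<le> B * N x" using B0[OF x] by simp
  qed
  have "NY (T u) powr p \<le> (C * N u) powr p"
  proof (rule field_le_epsilon)
    fix e :: real assume e: "e > 0"
    define c where "c = B powr p + C powr p + 1"
    have c: "c > 0" unfolding c_def by (smt (verit) powr_ge_zero)
    obtain v where v: "v \<in> D" "N (u - v) powr p < e / c"
      using D(2)[OF u, of "e / c"] e c by auto
    have vF: "v \<in> F" using v D by blast
    have uv: "u - v \<in> F" using u vF F.mem by blast
    have e1: "T u = T (u - v) + T v" using Tadd[OF uv vF] by simp
    have "NY (T u) powr p \<le> NY (T (u - v)) powr p + NY (T v) powr p"
      unfolding e1 using Y.add TY uv vF by blast
    also have "NY (T (u - v)) powr p \<le> (B * N (u - v)) powr p"
      using B(2)[OF uv] nY[OF TY[OF uv]] p by (intro powr_mono2) auto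
    also have "NY (T v) powr p \<le> (C * N v) powr p"
      using C(2)[OF v(1)] nY[OF TY[OF vF]] p by (intro powr_mono2) auto
    also have "(C * N v) powr p = C powr p * N v powr p"
      using C nF[OF vF] by (simp add: powr_mult)
    also have "N v powr p \<le> N u powr p + N (u - v) powr p"
      using F.Rabs[OF u vF] by simp
    finally have "NY (T u) powr p \<le> B powr p * N (u - v) powr p + C powr p * (N u powr p + N (u - v) powr p)"
      using B(1) nF[OF uv] by (simp add: powr_mult mult_left_mono)
    also have "\<dots> \<le> (C * N u) powr p + c * N (u - v) powr p"
      using C nF[OF u] by (simp add: powr_mult c_def algebra_simps)
    also have "c * N (u - v) powr p \<le> e" using v(2) c by (simp add: field_simps)
    finally show "NY (T u) powr p \<le> (C * N u) powr p + e" by simp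
  qed
  then show ?thesis
    using p C(1) nF[OF u] powr_less_mono2[of p "C * N u" "NY (T u)"] by (smt (verit) mult_nonneg_nonneg)
qed

lemma bounded_linear_on_eq_dense:
  assumes p: "0 < p" "p \<le> 1" and F: "s_banach p F N" and Y: "s_banach p Y NY"
    and T: "bounded_linear_on F N Y NY T" and T': "bounded_linear_on F N Y NY T'"
    and D: "D \<subseteq> F" "\<And>u e. u \<in> F \<Longrightarrow> e > 0 \<Longrightarrow> \<exists>v\<in>D. N (u - v) powr p < e"
    and eq: "\<And>u. u \<in> D \<Longrightarrow> T u = T' u" and u: "u \<in> F"
  shows "T u = T' u"
proof -
  interpret Y: pnorm p Y "\<lambda>x. NY x powr p" using Y s_banach_iff p by blast
  interpret F: pnorm p F "\<lambda>x. N x powr p" using F s_banach_iff p by blast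
  have nY: "\<And>x. x \<in> Y \<Longrightarrow> 0 \<le> NY x" and nF: "\<And>x. x \<in> F \<Longrightarrow> 0 \<le> N x"
    using F Y unfolding s_banach_def quasi_norm_on_def by auto
  have z: "NY 0 = 0" using Y.R0 by simp
  define U where "U = (\<lambda>x. T x - T' x)"
  obtain B where B1: "\<And>x. x \<in> F \<Longrightarrow> NY (T x) \<le> B * N x"
    using T unfolding bounded_linear_on_def by blast
  obtain B' where B2: "\<And>x. x \<in> F \<Longrightarrow> NY (T' x) \<le> B' * N x"
    using T' unfolding bounded_linear_on_def by blast
  note B = B1 B2
  have TY: "T x \<in> Y" "T' x \<in> Y" if "x \<in> F" for x
    using T T' that unfolding bounded_linear_on_def by auto
  have UB: "NY (U x) \<le> 2 powr (1/p) * (B + B') * N x" if x: "x \<in> F" for x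
  proof -
    have "NY (U x) powr p \<le> NY (T x) powr p + NY (T' x) powr p"
      using Y.add[of "T x" "- T' x"] Y.Rminus[of "T' x"] TY[OF x] Y.mem by (simp add: U_def)
    then have "NY (U x) \<le> 2 powr (1/p) * (NY (T x) + NY (T' x))"
      using quasi_triangle_of_powr p nY TY[OF x] Y.mem by (simp add: U_def)
    also have "\<dots> \<le> 2 powr (1/p) * (B * N x + B' * N x)"
      using B[OF x] by (intro mult_left_mono add_mono) auto
    finally show ?thesis by (simp add: algebra_simps)
  qed
  have U: "bounded_linear_on F N Y NY U"
    unfolding bounded_linear_on_def
  proof (intro conjI)
    show "U ` F \<subseteq> Y" using TY Y.mem by (auto simp: U_def)
    show "\<exists>C. \<forall>x\<in>F. NY (U x) \<le> C * N x" using UB by blast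
  qed (use T T' in \<open>auto simp: bounded_linear_on_def U_def algebra_simps\<close>)
  have "NY (U u) \<le> 0 * N u"
    by (rule bound_dense[OF p F Y U D _ _ u]) (use eq z in \<open>auto simp: U_def\<close>)
  moreover have "0 \<le> NY (U u)" using nY U u unfolding bounded_linear_on_def by auto
  ultimately have "NY (U u) powr p = 0" by simp
  then have "U u = 0" using Y.zero U u unfolding bounded_linear_on_def by blast
  then show ?thesis by (simp add: U_def)
qed

lemma bounded_linear_on_extend:
  assumes p: "0 < p" "p \<le> 1" and F: "s_banach p F N" and Y: "s_banach p Y NY"
    and D: "subspace D" "D \<subseteq> F" "\<And>u e. u \<in> F \<Longrightarrow> e > 0 \<Longrightarrow> \<exists>v\<in>D. N (u - v) powr p < e"
    and C: "0 \<le> C" "\<And>u. u \<in> D \<Longrightarrow> NY (T u) \<le> C * N u"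
    and TY: "\<And>u. u \<in> D \<Longrightarrow> T u \<in> Y"
    and Tadd: "\<And>x y. x \<in> D \<Longrightarrow> y \<in> D \<Longrightarrow> T (x + y) = T x + T y"
    and Tsc: "\<And>a x. x \<in> D \<Longrightarrow> T (a *\<^sub>R x) = a *\<^sub>R T x"
  shows "\<exists>T'. bounded_linear_on F N Y NY T' \<and> (\<forall>u\<in>D. T' u = T u)"
proof -
  interpret Y: pnorm p Y "\<lambda>x. NY x powr p" using Y s_banach_iff p by blast
  interpret F: pnorm p F "\<lambda>x. N x powr p" using F s_banach_iff p by blast
  have nY: "\<And>x. x \<in> Y \<Longrightarrow> 0 \<le> NY x" and nF: "\<And>x. x \<in> F \<Longrightarrow> 0 \<le> N x"
    and cY: "complete_on Y (\<lambda>x. NY x powr p)"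
    using F Y s_banach_iff[OF p] by blast+
  note DD = subspace_add[OF D(1)] subspace_diff[OF D(1)] subspace_scale[OF D(1)] 
  have Tdiff: "T (x - y) = T x - T y" if "x \<in> D" "y \<in> D" for x y
    using Tadd[of "x - y" y] DD that by simp
  have bd: "NY (T u) powr p \<le> C powr p * N u powr p" if "u \<in> D" for u
  proof -
    have "NY (T u) powr p \<le> (C * N u) powr p"
      using C(2)[OF that] nY[OF TY[OF that]] p by (intro powr_mono2) auto
    then show ?thesis using C(1) nF that D(2) by (auto simp: powr_mult)
  qed
  have "\<exists>s. \<forall>n::nat. s n \<in> D \<and> N (u - s n) powr p < inverse (Suc n)" if "u \<in> F" for u
    using D(3)[OF that] by (intro choice) (auto simp: Bex_def)
  then obtain s where s: "\<And>u n. u \<in> F \<Longrightarrow> s u n \<in> D" 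
    "\<And>u n. u \<in> F \<Longrightarrow> N (u - s u n) powr p < inverse (real (Suc n))"
    by metis
  have sF: "u \<in> F \<Longrightarrow> s u n \<in> F" for u n using s D by blast
  have slim: "(\<lambda>n. N (s u n - u) powr p) \<longlonglongrightarrow> 0" if u: "u \<in> F" for u
  proof (rule tendsto_0_le[OF LIMSEQ_inverse_real_of_nat, where K=1])
    show "\<forall>\<^sub>F n in sequentially. norm (N (s u n - u) powr p) \<le> norm (inverse (real (Suc n))) * 1"
      using s(2)[OF u] F.Rcomm[OF u sF[OF u]] by (intro always_eventually) (auto intro: less_imp_le)
  qed
  have ex: "\<exists>y\<in>Y. (\<lambda>n. NY (T (s u n) - y) powr p) \<longlonglongrightarrow> 0" if u: "u \<in> F" for u
  proof -
    have "\<exists>K. \<forall>m\<ge>K. \<forall>n\<ge>K. NY (T (s u m) - T (s u n)) powr p < e" if e: "e > 0" for e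
    proof -
      define c where "c = C powr p + 1"
      have c: "c > 0" unfolding c_def by (smt (verit) powr_ge_zero)
      obtain K where K: "\<And>n. n \<ge> K \<Longrightarrow> \<bar>N (s u n - u) powr p\<bar> < e / (2 * c)"
        using slim[OF u] e c unfolding LIMSEQ_def by (auto simp: dist_real_def) (metis divide_pos_pos zero_less_mult_iff zero_less_numeral)
      have "NY (T (s u m) - T (s u n)) powr p < e" if "m \<ge> K" "n \<ge> K" for m n
      proof -
        have "NY (T (s u m) - T (s u n)) powr p \<le> C powr p * N (s u m - s u n) powr p"
          using bd[of "s u m - s u n"] Tdiff s(1)[OF u] DD by simp
        also have "\<dots> \<le> c * N (s u m - s u n) powr p" by (intro mult_right_mono) (auto simp: c_def)
        also have "N (s u m - s u n) powr p \<le> N (s u m - u) powr p + N (s u n - u) powr p"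
          using F.Rtri[of "s u m" u "s u n"] F.Rcomm[of u "s u n"] sF[OF u] u by simp
        also have "c * \<dots> < c * (e / (2*c) + e/(2*c))"
          using K[OF that(1)] K[OF that(2)] c by (intro mult_strict_left_mono add_strict_mono) auto
        also have "\<dots> = e" using c by (simp add: field_simps)
        finally show ?thesis using c by simp
      qed
      then show ?thesis by blast
    qed
    then show ?thesis using cY TY s(1)[OF u] unfolding complete_on_def by simp
  qed
  then obtain T' where T'Y: "\<And>u. u \<in> F \<Longrightarrow> T' u \<in> Y" 
    and T'lim: "\<And>u. u \<in> F \<Longrightarrow> (\<lambda>n. NY (T (s u n) - T' u) powr p) \<longlonglongrightarrow> 0"
    by metis
  have uniq: "T' u = y" if u: "u \<in> F" and y: "y \<in> Y" and v: "\<And>n. v n \<in> D"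
    and vl: "(\<lambda>n. N (v n - u) powr p) \<longlonglongrightarrow> 0" and yl: "(\<lambda>n. NY (T (v n) - y) powr p) \<longlonglongrightarrow> 0" for u y v
  proof -
    have vF: "v n \<in> F" for n using v D by blast
    have "(\<lambda>n. C powr p * (N (v n - u) powr p + N (s u n - u) powr p)) \<longlonglongrightarrow> C powr p * (0 + 0)"
      by (intro tendsto_intros vl slim u)
    then have l0: "(\<lambda>n. C powr p * (N (v n - u) powr p + N (s u n - u) powr p)) \<longlonglongrightarrow> 0" by simp
    have "(\<lambda>n. NY (T (v n) - T (s u n)) powr p) \<longlonglongrightarrow> 0"
    proof (rule Lim_null_comparison[OF _ l0], intro always_eventually allI)
      fix n
      have "NY (T (v n) - T (s u n)) powr p \<le> C powr p * N (v n - s u n) powr p"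
        using bd[of "v n - s u n"] Tdiff s(1)[OF u] v DD by simp
      also have "\<dots> \<le> C powr p * (N (v n - u) powr p + N (s u n - u) powr p)"
        using F.Rtri[of "v n" u "s u n"] F.Rcomm[of u "s u n"] sF[OF u] u vF by (intro mult_left_mono) auto
      finally show "norm (NY (T (v n) - T (s u n)) powr p) \<le> C powr p * (N (v n - u) powr p + N (s u n - u) powr p)"
        by simp
    qed
    from Y.Rlim_add[OF _ _ _ _ _ T'lim[OF u], of "\<lambda>n. T (v n) - T (s u n)" 0] this
    have "(\<lambda>n. NY (T (v n) - T' u) powr p) \<longlonglongrightarrow> 0"
      using Y.mem TY v s(1)[OF u] T'Y[OF u] by simp
    from Y.Rlim_le[OF _ _ _ this yl] have "NY (T' u - y) powr p = 0"
      using Y.mem TY v s(1)[OF u] T'Y[OF u] y by simp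
    then show ?thesis using Y.zero[of "T' u - y"] Y.mem T'Y[OF u] y by simp
  qed
  have eqD: "T' u = T u" if "u \<in> D" for u
    by (rule uniq[of u "T u" "\<lambda>_. u"]) (use that D TY F.R0 Y.R0 in auto)
  have add: "T' (u + v) = T' u + T' v" if u: "u \<in> F" "v \<in> F" for u v
  proof (rule uniq[of _ _ "\<lambda>n. s u n + s v n"])
    show "(\<lambda>n. N (s u n + s v n - (u + v)) powr p) \<longlonglongrightarrow> 0"
      by (rule F.Rlim_add) (use u sF slim in auto)
    have "(\<lambda>n. NY (T (s u n) + T (s v n) - (T' u + T' v)) powr p) \<longlonglongrightarrow> 0"
      by (rule Y.Rlim_add) (use u s TY T'Y T'lim in auto)
    then show "(\<lambda>n. NY (T (s u n + s v n) - (T' u + T' v)) powr p) \<longlonglongrightarrow> 0"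
      using Tadd s u by simp
  qed (use u F.mem Y.mem T'Y s DD in auto)
  have scal: "T' (a *\<^sub>R u) = a *\<^sub>R T' u" if u: "u \<in> F" for a u
  proof (rule uniq[of _ _ "\<lambda>n. a *\<^sub>R s u n"])
    show "(\<lambda>n. N (a *\<^sub>R s u n - a *\<^sub>R u) powr p) \<longlonglongrightarrow> 0"
      by (rule F.Rlim_sc) (use u sF slim in auto)
    have "(\<lambda>n. NY (a *\<^sub>R T (s u n) - a *\<^sub>R T' u) powr p) \<longlonglongrightarrow> 0"
      by (rule Y.Rlim_sc) (use u s TY T'Y T'lim in auto)
    then show "(\<lambda>n. NY (T (a *\<^sub>R s u n) - a *\<^sub>R T' u) powr p) \<longlonglongrightarrow> 0"
      using Tsc s u by simp
  qed (use u F.mem Y.mem T'Y s DD in auto)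
  have bnd: "NY (T' u) \<le> C * N u" if u: "u \<in> F" for u
  proof -
    have l1: "(\<lambda>n. NY (T (s u n)) powr p) \<longlonglongrightarrow> NY (T' u) powr p"
      by (rule Y.Rlim) (use TY s u T'Y T'lim in auto)
    have l2: "(\<lambda>n. C powr p * N (s u n) powr p) \<longlonglongrightarrow> C powr p * N u powr p"
      by (intro tendsto_mult_left F.Rlim) (use sF u slim in auto)
    have "NY (T' u) powr p \<le> C powr p * N u powr p"
      by (rule LIMSEQ_le[OF l1 l2]) (use bd s u in auto)
    then have "NY (T' u) powr p \<le> (C * N u) powr p" using C nF u by (simp add: powr_mult)
    then show ?thesis
      using p C(1) nF[OF u] powr_less_mono2[of p "C * N u" "NY (T' u)"] by (smt (verit) mult_nonneg_nonneg)
  qed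
  have "bounded_linear_on F N Y NY T'"
    unfolding bounded_linear_on_def using T'Y add scal bnd by blast
  then show ?thesis using eqD by blast
qed

text \<open>Completion of a \<open>p\<close>-seminormed space inside the free vector space on its sequences.\<close>

definition lin_ext :: "('i \<Rightarrow> 'b::real_vector) \<Rightarrow> ('i, real) poly_mapping \<Rightarrow> 'b" where
  "lin_ext g b = (\<Sum>i\<in>Poly_Mapping.keys b. Poly_Mapping.lookup b i *\<^sub>R g i)"

lemma lookup_scaleR: "Poly_Mapping.lookup (a *\<^sub>R b) i = a * Poly_Mapping.lookup b i"
  for b :: "('i, real) poly_mapping"
  by (simp add: scaleR_poly_mapping_def)

lemma lin_ext_superset:
  assumes "finite K" "Poly_Mapping.keys b \<subseteq> K"
  shows "lin_ext g b = (\<Sum>i\<in>K. Poly_Mapping.lookup b i *\<^sub>R g i)"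
  unfolding lin_ext_def using assms
  by (intro sum.mono_neutral_left) (auto simp: in_keys_iff)

lemma linear_lin_ext: "linear (lin_ext g)"
proof (rule linearI)
  fix b c :: "('a, real) poly_mapping" and a :: real
  let ?K = "Poly_Mapping.keys b \<union> Poly_Mapping.keys c"
  show "lin_ext g (b + c) = lin_ext g b + lin_ext g c"
    using keys_add[of b c]
    by (simp add: lin_ext_superset[of ?K] lookup_add scaleR_add_left sum.distrib)
  have "Poly_Mapping.keys (a *\<^sub>R b) \<subseteq> Poly_Mapping.keys b"
    by (auto simp: in_keys_iff lookup_scaleR)
  then show "lin_ext g (a *\<^sub>R b) = a *\<^sub>R lin_ext g b"
    by (simp add: lin_ext_superset[of "Poly_Mapping.keys b"] lookup_scaleR scaleR_sum_right)
qed

lemma lin_ext_single [simp]: "lin_ext g (Poly_Mapping.single i 1) = g i"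
  by (simp add: lin_ext_def)

lemma (in psemi) quotient:
  "\<exists>\<pi>. linear \<pi> \<and> (\<forall>x\<in>V. \<pi> x \<in> V \<and> R (x - \<pi> x) = 0) \<and> (\<forall>x\<in>V. R x = 0 \<longrightarrow> \<pi> x = 0)"
proof -
  define Z where "Z = {x \<in> V. R x = 0}"
  have Z: "subspace Z"
  proof (rule subspaceI)
    fix x y assume xy: "x \<in> Z" "y \<in> Z"
    then have "R (x + y) \<le> 0" using add[of x y] by (simp add: Z_def)
    with xy nn[of "x + y"] mem show "x + y \<in> Z" by (auto simp: Z_def)
  qed (use mem R0 sc in \<open>auto simp: Z_def\<close>)
  obtain B0 where B0: "B0 \<subseteq> Z" "independent B0" "Z \<subseteq> span B0"
    using maximal_independent_subset[of Z] by blast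
  have "B0 \<subseteq> V" using B0 by (auto simp: Z_def)
  then obtain B where B: "B0 \<subseteq> B" "B \<subseteq> V" "independent B" "V \<subseteq> span B"
    using maximal_independent_subset_extend[OF _ B0(2)] by blast
  obtain \<pi> where pi: "linear \<pi>" "\<And>x. x \<in> B \<Longrightarrow> \<pi> x = (if x \<in> B0 then 0 else x)"
    using linear_independent_extend[OF B(3), of "\<lambda>x. if x \<in> B0 then 0 else x"] by blast
  have "subspace {x. x - \<pi> x \<in> Z}"
    using Z pi(1) subspace_add[OF Z] subspace_scale[OF Z] subspace_0[OF Z]
    by (intro subspaceI) (auto simp: linear_add linear_scale linear_0 add_diff_add simp flip: scaleR_diff_right)
  moreover have "B \<subseteq> {x. x - \<pi> x \<in> Z}" using pi(2) B0 subspace_0[OF Z] by auto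
  ultimately have "span B \<subseteq> {x. x - \<pi> x \<in> Z}" by (rule span_minimal[rotated])
  then have 1: "x - \<pi> x \<in> Z" if "x \<in> V" for x using B(4) that by blast
  have "subspace {x. \<pi> x = 0}" using pi(1) by (intro subspaceI) (auto simp: linear_add linear_scale linear_0)
  moreover have "B0 \<subseteq> {x. \<pi> x = 0}" using pi(2) B(1) by auto
  ultimately have "span B0 \<subseteq> {x. \<pi> x = 0}" by (rule span_minimal[rotated])
  then have 2: "\<pi> x = 0" if "x \<in> Z" for x using B0(3) that by blast
  have 3: "\<pi> x \<in> V" if "x \<in> V" for x
    using mem(2)[OF that, of "x - \<pi> x"] 1[OF that] by (simp add: Z_def)
  show ?thesis using pi(1) 1 2 3 unfolding Z_def by blast
qed

definition cauchy_seqs :: "'v::real_vector set \<Rightarrow> ('v \<Rightarrow> real) \<Rightarrow> (nat \<Rightarrow> 'v) set" where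
  "cauchy_seqs V R = {s. (\<forall>n. s n \<in> V) \<and> (\<forall>e>0. \<exists>K. \<forall>m\<ge>K. \<forall>n\<ge>K. R (s m - s n) < e)}"

context psemi
begin

lemma cauchy_seqs_add:
  assumes "s \<in> cauchy_seqs V R" "t \<in> cauchy_seqs V R"
  shows "(\<lambda>n. s n + t n) \<in> cauchy_seqs V R"
proof -
  have st: "s n \<in> V" "t n \<in> V" for n using assms by (auto simp: cauchy_seqs_def)
  have "\<exists>K. \<forall>m\<ge>K. \<forall>n\<ge>K. R ((s m + t m) - (s n + t n)) < e" if e: "e > 0" for e
  proof -
    have "e / 2 > 0" using e by simp
    then obtain K K' where K: "\<forall>m\<ge>K. \<forall>n\<ge>K. R (s m - s n) < e / 2" "\<forall>m\<ge>K'. \<forall>n\<ge>K'. R (t m - t n) < e / 2"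
      using assms unfolding cauchy_seqs_def by blast
    have "R ((s m + t m) - (s n + t n)) < e" if "m \<ge> max K K'" "n \<ge> max K K'" for m n
    proof -
      have "R ((s m - s n) + (t m - t n)) \<le> R (s m - s n) + R (t m - t n)"
        by (rule add[OF mem(2)[OF st(1) st(1)] mem(2)[OF st(2) st(2)]])
      also have "\<dots> < e / 2 + e / 2" using K that by (intro add_strict_mono) auto
      finally show ?thesis by (simp add: algebra_simps)
    qed
    then show ?thesis by blast
  qed
  then show ?thesis using st mem by (auto simp: cauchy_seqs_def)
qed

lemma cauchy_seqs_sc:
  assumes "s \<in> cauchy_seqs V R"
  shows "(\<lambda>n. a *\<^sub>R s n) \<in> cauchy_seqs V R"
proof -
  have st: "s n \<in> V" for n using assms by (auto simp: cauchy_seqs_def)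
  have "\<exists>K. \<forall>m\<ge>K. \<forall>n\<ge>K. R (a *\<^sub>R s m - a *\<^sub>R s n) < e" if e: "e > 0" for e
  proof -
    define c where "c = \<bar>a\<bar> powr p + 1"
    have c: "c > 0" unfolding c_def by (smt (verit) powr_ge_zero)
    have "e / c > 0" using e c by simp
    then obtain K where K: "\<forall>m\<ge>K. \<forall>n\<ge>K. R (s m - s n) < e / c"
      using assms unfolding cauchy_seqs_def by blast
    have "R (a *\<^sub>R s m - a *\<^sub>R s n) < e" if "m \<ge> K" "n \<ge> K" for m n
    proof -
      have "R (a *\<^sub>R s m - a *\<^sub>R s n) = \<bar>a\<bar> powr p * R (s m - s n)"
        using sc st mem by (simp flip: scaleR_diff_right)
      also have "\<dots> \<le> c * R (s m - s n)"
        using nn st mem by (intro mult_right_mono) (auto simp: c_def)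
      also have "\<dots> < e" using K that c by (auto simp: field_simps)
      finally show ?thesis .
    qed
    then show ?thesis by blast
  qed
  then show ?thesis using st mem by (auto simp: cauchy_seqs_def)
qed

lemma cauchy_seqs_const: "u \<in> V \<Longrightarrow> (\<lambda>n. u) \<in> cauchy_seqs V R"
  using R0 by (auto simp: cauchy_seqs_def)

lemma cauchy_seqs_lim:
  assumes "s \<in> cauchy_seqs V R" shows "(\<lambda>n. R (s n)) \<longlonglongrightarrow> lim (\<lambda>n. R (s n))"
proof -
  have "Cauchy (\<lambda>n. R (s n))"
    unfolding Cauchy_def dist_real_def
  proof (intro allI impI)
    fix e :: real assume "e > 0"
    then obtain K where K: "\<forall>m\<ge>K. \<forall>n\<ge>K. R (s m - s n) < e"
      using assms unfolding cauchy_seqs_def by blast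
    then show "\<exists>K. \<forall>m\<ge>K. \<forall>n\<ge>K. \<bar>R (s m) - R (s n)\<bar> < e"
      using Rabs assms unfolding cauchy_seqs_def by (blast intro: order.strict_trans1)
  qed
  then show ?thesis by (simp add: Cauchy_convergent_iff convergent_LIMSEQ_iff)
qed

theorem completion:
  "\<exists>(F :: (nat \<Rightarrow> 'v, real) poly_mapping set) Q \<iota>. pnorm p F Q \<and> complete_on F Q
     \<and> (\<forall>u\<in>V. \<iota> u \<in> F \<and> Q (\<iota> u) = R u) \<and> (\<forall>u\<in>V. \<forall>v\<in>V. \<iota> (u + v) = \<iota> u + \<iota> v)
     \<and> (\<forall>a. \<forall>u\<in>V. \<iota> (a *\<^sub>R u) = a *\<^sub>R \<iota> u)
     \<and> (\<forall>w\<in>F. \<forall>e>0. \<exists>u\<in>V. Q (w - \<iota> u) < e)"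
proof -
  define ev where "ev b n = lin_ext (\<lambda>s :: nat \<Rightarrow> 'v. s n) b" for b n
  define B where "B = {b. ev b \<in> cauchy_seqs V R}"
  define Q where "Q b = lim (\<lambda>n. R (ev b n))" for b
  define E where "E s = Poly_Mapping.single s (1::real)" for s :: "nat \<Rightarrow> 'v"
  have evE [simp]: "ev (E s) = s" for s by (rule ext) (simp add: ev_def E_def)
  have ev_add: "ev (b + c) = (\<lambda>n. ev b n + ev c n)" 
    and ev_diff: "ev (b - c) = (\<lambda>n. ev b n - ev c n)" 
    and ev_sc: "ev (a *\<^sub>R b) = (\<lambda>n. a *\<^sub>R ev b n)" 
    and ev_0: "ev 0 = (\<lambda>n. 0)" for b c a
    by (auto simp: ev_def linear_add[OF linear_lin_ext] linear_diff[OF linear_lin_ext]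
         linear_scale[OF linear_lin_ext] linear_0[OF linear_lin_ext])
  have Qlim: "(\<lambda>n. R (ev b n)) \<longlonglongrightarrow> Q b" if "b \<in> B" for b
    using cauchy_seqs_lim that by (auto simp: B_def Q_def)
  have Qeq: "Q b = q" if "(\<lambda>n. R (ev b n)) \<longlonglongrightarrow> q" for b q
    using that by (simp add: Q_def limI)
  have evV: "ev b n \<in> V" if "b \<in> B" for b n using that by (auto simp: B_def cauchy_seqs_def)
  interpret B: psemi p B Q
  proof
    show "subspace B"
      by (rule subspaceI)
        (use cauchy_seqs_add cauchy_seqs_sc cauchy_seqs_const[OF mem(4)] in \<open>auto simp: B_def ev_add ev_sc ev_0\<close>)
    show "0 \<le> Q b" if "b \<in> B" for b
      by (rule LIMSEQ_le_const[OF Qlim[OF that]]) (use nn evV that in blast)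
    show "Q (a *\<^sub>R b) = \<bar>a\<bar> powr p * Q b" if "b \<in> B" for a b
      by (rule Qeq) (use tendsto_mult_left[OF Qlim[OF that]] evV[OF that] sc in \<open>simp add: ev_sc\<close>)
    show "Q (b + c) \<le> Q b + Q c" if bc: "b \<in> B" "c \<in> B" for b c
    proof (rule LIMSEQ_le[OF Qlim tendsto_add[OF Qlim[OF bc(1)] Qlim[OF bc(2)]]])
      show "b + c \<in> B" using bc cauchy_seqs_add by (simp add: B_def ev_add)
      show "\<exists>N. \<forall>n\<ge>N. R (ev (b + c) n) \<le> R (ev b n) + R (ev c n)"
        using add evV bc by (simp add: ev_add)
    qed
  qed (use p0 p1 in auto)
  obtain \<pi> where pi: "linear \<pi>" "\<And>b. b \<in> B \<Longrightarrow> \<pi> b \<in> B" "\<And>b. b \<in> B \<Longrightarrow> Q (b - \<pi> b) = 0"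
    "\<And>b. b \<in> B \<Longrightarrow> Q b = 0 \<Longrightarrow> \<pi> b = 0"
    using B.quotient by blast
  have Qpi: "Q (\<pi> b) = Q b" if "b \<in> B" for b
    using B.Rabs[OF that pi(2)[OF that]] pi(3)[OF that] by simp
  define F where "F = \<pi> ` B"
  have FB: "F \<subseteq> B" using pi(2) by (auto simp: F_def)
  have pieq: "\<pi> w = w" if w: "w \<in> F" for w
  proof -
    obtain b where b: "b \<in> B" "w = \<pi> b" using w unfolding F_def by blast
    then have "\<pi> (b - \<pi> b) = 0" using pi B.mem by simp
    then show ?thesis using b pi(1) by (simp add: linear_diff)
  qed
  interpret F: pnorm p F Q
  proof
    show "subspace F" unfolding F_def by (rule linear_subspace_image[OF pi(1) B.sub])
    show "w = 0" if "w \<in> F" "Q w = 0" for w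
      using pi(4)[of w] pieq[of w] that FB by auto
    show "Q (v + w) \<le> Q v + Q w" if "v \<in> F" "w \<in> F" for v w using B.add FB that by blast
    show "Q (a *\<^sub>R v) = \<bar>a\<bar> powr p * Q v" if "v \<in> F" for a v using B.sc FB that by blast
    show "0 \<le> Q v" if "v \<in> F" for v using B.nn FB that by blast
  qed (use p0 p1 in auto)
  define \<iota> where "\<iota> u = \<pi> (E (\<lambda>n. u))" for u
  have EB: "E s \<in> B" if "s \<in> cauchy_seqs V R" for s using that by (simp add: B_def)
  have EcB: "E (\<lambda>n. u) \<in> B" if "u \<in> V" for u using EB cauchy_seqs_const that by blast
  have iF: "\<iota> u \<in> F" if "u \<in> V" for u using EcB[OF that] by (simp add: \<iota>_def F_def)
  have ev_zero_pi: "\<pi> b = \<pi> c" if "b \<in> B" "c \<in> B" "ev b = ev c" for b c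
  proof -
    have "Q (b - c) = 0" using that R0 by (intro Qeq) (simp add: ev_diff)
    then have "\<pi> (b - c) = 0" using pi(4) B.mem that by blast
    then show ?thesis using pi(1) by (simp add: linear_diff)
  qed
  have iQ: "Q (\<pi> b - \<iota> u) = Q (b - E (\<lambda>n. u))" if "b \<in> B" "u \<in> V" for b u
  proof -
    have "Q (\<pi> (b - E (\<lambda>n. u))) = Q (b - E (\<lambda>n. u))"
      by (rule Qpi[OF B.mem(2)[OF that(1) EcB[OF that(2)]]])
    then show ?thesis using pi(1) by (simp add: \<iota>_def linear_diff)
  qed
  have QE: "Q (E (\<lambda>n. u)) = R u" for u by (rule Qeq) simp
  have iadd: "\<iota> (u + v) = \<iota> u + \<iota> v" if "u \<in> V" "v \<in> V" for u v
  proof -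
    have "\<pi> (E (\<lambda>n. u + v)) = \<pi> (E (\<lambda>n. u) + E (\<lambda>n. v))"
      by (rule ev_zero_pi[OF EcB[OF mem(1)[OF that]] B.mem(1)[OF EcB[OF that(1)] EcB[OF that(2)]]])
        (simp add: ev_add)
    then show ?thesis by (simp add: \<iota>_def linear_add[OF pi(1)])
  qed
  have isc: "\<iota> (a *\<^sub>R u) = a *\<^sub>R \<iota> u" if "u \<in> V" for a u
  proof -
    have "\<pi> (E (\<lambda>n. a *\<^sub>R u)) = \<pi> (a *\<^sub>R E (\<lambda>n. u))"
      by (rule ev_zero_pi[OF EcB[OF mem(3)[OF that]] B.mem(3)[OF EcB[OF that]]]) (simp add: ev_sc)
    then show ?thesis by (simp add: \<iota>_def linear_scale[OF pi(1)])
  qed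
  have Qi: "Q (\<iota> u) = R u" if "u \<in> V" for u using Qpi[OF EcB[OF that]] QE by (simp add: \<iota>_def)
  have idiff: "\<iota> (u - v) = \<iota> u - \<iota> v" if "u \<in> V" "v \<in> V" for u v
    using iadd[of "u - v" v] mem that by (simp add: algebra_simps)
  have tail: "Q (\<pi> b - \<iota> (ev b n)) \<le> e"
    if b: "b \<in> B" and K: "\<And>m. m \<ge> K \<Longrightarrow> R (ev b m - ev b n) \<le> e" for b n K e
  proof -
    have "b - E (\<lambda>_. ev b n) \<in> B" by (rule B.mem(2)[OF b EcB[OF evV[OF b]]])
    from Qlim[OF this] have "Q (b - E (\<lambda>_. ev b n)) \<le> e"
      by (rule LIMSEQ_le_const2) (use K in \<open>auto simp: ev_diff\<close>)
    then show ?thesis using iQ[OF b evV[OF b]] by simp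
  qed
  have dense: "\<exists>u\<in>V. Q (w - \<iota> u) < e" if w: "w \<in> F" and e: "e > 0" for w e
  proof -
    obtain b where b: "b \<in> B" "w = \<pi> b" using w unfolding F_def by blast
    have "e / 2 > 0" using e by simp
    then obtain K where K: "\<forall>m\<ge>K. \<forall>n\<ge>K. R (ev b m - ev b n) < e / 2"
      using b(1) unfolding B_def cauchy_seqs_def by blast
    have "Q (\<pi> b - \<iota> (ev b K)) \<le> e / 2"
      by (rule tail[OF b(1), of K]) (use K in \<open>auto intro: less_imp_le\<close>)
    then have "Q (w - \<iota> (ev b K)) < e" using e b by simp
    then show ?thesis using evV[OF b(1)] by blast
  qed
  have "complete_on F Q"
    unfolding complete_on_def
  proof (intro allI impI)
    fix w :: "nat \<Rightarrow> _" 
    assume wF: "\<forall>n. w n \<in> F" and wC: "\<forall>e>0. \<exists>K. \<forall>m\<ge>K. \<forall>n\<ge>K. Q (w m - w n) < e"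
    have "\<exists>u\<in>V. Q (w n - \<iota> u) < inverse (real (Suc n))" for n
      using dense wF by simp
    then obtain u where u: "\<And>n. u n \<in> V" "\<And>n. Q (w n - \<iota> (u n)) < inverse (real (Suc n))"
      by metis
    have small: "\<exists>K. \<forall>n\<ge>K. Q (w n - \<iota> (u n)) < e" if e: "e > 0" for e
    proof -
      obtain K where K: "inverse (real (Suc K)) < e" using reals_Archimedean[OF e] by blast
      have "Q (w n - \<iota> (u n)) < e" if "n \<ge> K" for n
      proof -
        have "inverse (real (Suc n)) \<le> inverse (real (Suc K))" using that by (simp add: field_simps)
        then show ?thesis using u(2)[of n] K by linarith
      qed
      then show ?thesis by blast
    qed
    have uC: "u \<in> cauchy_seqs V R"
      unfolding cauchy_seqs_def
    proof (intro CollectI conjI allI impI u(1))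
      fix e :: real assume "e > 0"
      then have e: "e / 3 > 0" by simp
      obtain K where K: "\<forall>m\<ge>K. \<forall>n\<ge>K. Q (w m - w n) < e / 3" using wC e by blast
      obtain K' where K': "\<forall>n\<ge>K'. Q (w n - \<iota> (u n)) < e / 3" using small[OF e] by blast
      have "R (u m - u n) < e" if mn: "m \<ge> max K K'" "n \<ge> max K K'" for m n
      proof -
        have F: "w m \<in> F" "w n \<in> F" "\<iota> (u m) \<in> F" "\<iota> (u n) \<in> F" using wF iF u(1) by auto
        have "R (u m - u n) = Q (\<iota> (u m) - \<iota> (u n))"
          using Qi[of "u m - u n"] idiff u(1) mem by simp
        also have "\<dots> \<le> Q (\<iota> (u m) - w m) + Q (w m - \<iota> (u n))" by (rule F.Rtri) (use F in auto)
        also have "Q (w m - \<iota> (u n)) \<le> Q (w m - w n) + Q (w n - \<iota> (u n))" by (rule F.Rtri) (use F in auto)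
        also have "Q (\<iota> (u m) - w m) = Q (w m - \<iota> (u m))" by (rule F.Rcomm) (use F in auto)
        also have "Q (w m - \<iota> (u m)) + (Q (w m - w n) + Q (w n - \<iota> (u n))) < e / 3 + (e / 3 + e / 3)"
          using K K' mn by (intro add_strict_mono) auto
        finally show ?thesis by simp
      qed
      then show "\<exists>K. \<forall>m\<ge>K. \<forall>n\<ge>K. R (u m - u n) < e" by blast
    qed
    define x where "x = \<pi> (E u)"
    have xF: "x \<in> F" using EB[OF uC] by (simp add: x_def F_def)
    have "(\<lambda>n. Q (w n - x)) \<longlonglongrightarrow> 0"
      unfolding LIMSEQ_def
    proof (intro allI impI)
      fix e :: real assume e: "e > 0"
      then have e2: "e / 2 > 0" "e / 4 > 0" by auto
      obtain K' where K': "\<forall>n\<ge>K'. Q (w n - \<iota> (u n)) < e / 2" using small[OF e2(1)] by blast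
      obtain K where K: "\<forall>m\<ge>K. \<forall>n\<ge>K. R (u m - u n) < e / 4"
        using uC e2 unfolding cauchy_seqs_def by blast
      have "dist (Q (w n - x)) 0 < e" if n: "n \<ge> max K K'" for n
      proof -
        have F: "w n \<in> F" "\<iota> (u n) \<in> F" using wF iF u(1) by auto
        have "Q (\<pi> (E u) - \<iota> (ev (E u) n)) \<le> e / 4"
          by (rule tail[OF EB[OF uC], of K]) (use K n in \<open>auto intro: less_imp_le\<close>)
        then have "Q (\<iota> (u n) - x) \<le> e / 4" using F.Rcomm[OF F(2) xF] by (simp add: x_def)
        moreover have "Q (w n - x) \<le> Q (w n - \<iota> (u n)) + Q (\<iota> (u n) - x)"
          by (rule F.Rtri) (use F xF in auto)
        moreover have "Q (w n - \<iota> (u n)) < e / 2" using K' n by auto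
        moreover have "0 \<le> Q (w n - x)" by (rule F.nn[OF F.mem(2)[OF F(1) xF]])
        ultimately show ?thesis using e by simp
      qed
      then show "\<exists>N. \<forall>n\<ge>N. dist (Q (w n - x)) 0 < e" by blast
    qed
    then show "\<exists>x\<in>F. (\<lambda>n. Q (w n - x)) \<longlonglongrightarrow> 0" using xF by blast
  qed
  with F.pnorm_axioms show ?thesis
    using iF Qi iadd isc dense by (intro exI[of _ F] exI[of _ Q] exI[of _ \<iota>]) blast
qed

end

lemma s_banach_of_pnorm:
  assumes "pnorm p F Q" "complete_on F Q"
  shows "s_banach p F (\<lambda>x. Q x powr (1/p))"
proof -
  interpret pnorm p F Q by fact
  have *: "(Q x powr (1/p)) powr p = Q x" if "x \<in> F" for x
    using nn[OF that] p0 by (simp add: powr_powr)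
  have 1: "pnorm p F (\<lambda>x. (Q x powr (1/p)) powr p)"
  proof
    show "(Q (a *\<^sub>R x) powr (1/p)) powr p = \<bar>a\<bar> powr p * (Q x powr (1/p)) powr p" if "x \<in> F" for a x
      unfolding *[OF that] *[OF mem(3)[OF that]] by (rule sc[OF that])
    show "(Q (x + y) powr (1/p)) powr p \<le> (Q x powr (1/p)) powr p + (Q y powr (1/p)) powr p"
      if "x \<in> F" "y \<in> F" for x y
      unfolding *[OF that(1)] *[OF that(2)] *[OF mem(1)[OF that]] by (rule add[OF that])
    show "x = 0" if "x \<in> F" "(Q x powr (1/p)) powr p = 0" for x
      using zero that *[OF that(1)] by simp
  qed (use p0 p1 sub in auto)
  have "complete_on F (\<lambda>x. Q x powr (1/p))"
    using complete_on_powr[OF _ sub nn, of "1/p"] assms(2) p0 by simp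
  then have 2: "complete_on F (\<lambda>x. (Q x powr (1/p)) powr p)"
    using complete_on_powr[OF p0 sub, of "\<lambda>x. Q x powr (1/p)"] by simp
  show ?thesis unfolding s_banach_iff[OF p0 p1] using 1 2 by simp
qed

lemma extends_lipschitzI:
  assumes p: "0 < p" "p \<le> 1" and F: "s_banach p F N" and Y: "s_banach p Y NY"
    and \<delta>: "\<delta> ` M \<subseteq> F" and iso: "\<And>x y. x \<in> M \<Longrightarrow> y \<in> M \<Longrightarrow> N (\<delta> x - \<delta> y) = d x y"
    and dense: "\<And>u e. u \<in> F \<Longrightarrow> e > 0 \<Longrightarrow> \<exists>v\<in>span (\<delta> ` M). N (u - v) < e"
    and ext: "\<And>f C. f ` M \<subseteq> Y \<Longrightarrow> f z = 0 \<Longrightarrow> 0 \<le> C \<Longrightarrow> (\<And>x y. x \<in> M \<Longrightarrow> y \<in> M \<Longrightarrow> NY (f x - f y) \<le> C * d x y)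
      \<Longrightarrow> \<exists>T. bounded_linear_on F N Y NY T \<and> (\<forall>x\<in>M. T (\<delta> x) = f x) \<and> (\<forall>u\<in>F. NY (T u) \<le> C * N u)"
  shows "extends_lipschitz M d z F N \<delta> Y NY"
  unfolding extends_lipschitz_def
proof (intro allI impI)
  fix f assume f: "pointed_lipschitz M d z Y NY f"
  interpret F: pnorm p F "\<lambda>x. N x powr p" using F s_banach_iff p by blast
  have nF: "\<And>x. x \<in> F \<Longrightarrow> 0 \<le> N x" using F s_banach_iff[OF p] by blast
  define S where "S = {C. 0 \<le> C \<and> (\<forall>x\<in>M. \<forall>y\<in>M. NY (f x - f y) \<le> C * d x y)}"
  have dnn: "0 \<le> d x y" if "x \<in> M" "y \<in> M" for x y
    using iso[OF that] nF[OF F.mem(2), of "\<delta> x" "\<delta> y"] \<delta> that by auto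
  have span: "span (\<delta> ` M) \<subseteq> F" by (rule span_minimal[OF \<delta> F.sub])
  have dense': "\<exists>v\<in>span (\<delta> ` M). N (u - v) powr p < e" if u: "u \<in> F" and e: "e > 0" for u e
  proof -
    have e': "e powr (1/p) > 0" using e by simp
    obtain v where v: "v \<in> span (\<delta> ` M)" "N (u - v) < e powr (1/p)"
      using dense[OF u e'] by blast
    have "0 \<le> N (u - v)" using nF[OF F.mem(2)[OF u]] v(1) span by blast
    from powr_less_iff[OF p(1) this e'] v(2) have "N (u - v) powr p < (e powr (1/p)) powr p" by simp
    then show ?thesis using v(1) p e by (auto simp: powr_powr)
  qed
  have uniq: "T' u = T u" if T: "bounded_linear_on F N Y NY T" "\<forall>x\<in>M. T (\<delta> x) = f x"
      and T': "bounded_linear_on F N Y NY T'" "\<forall>x\<in>M. T' (\<delta> x) = f x" and u: "u \<in> F" for T T' u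
  proof (rule bounded_linear_on_eq_dense[OF p F Y T'(1) T(1) span dense' _ u])
    fix u assume "u \<in> span (\<delta> ` M)"
    moreover have "span (\<delta> ` M) \<subseteq> {v \<in> F. T' v = T v}"
    proof (rule span_minimal)
      show "\<delta> ` M \<subseteq> {v \<in> F. T' v = T v}" using \<delta> T(2) T'(2) by auto
      have "T 0 = 0" "T' 0 = 0" 
        using T(1) T'(1) F.mem(4) unfolding bounded_linear_on_def by (metis scaleR_zero_left)+
      then show "subspace {v \<in> F. T' v = T v}"
        using T(1) T'(1) F.mem unfolding bounded_linear_on_def by (intro subspaceI) auto
    qed
    ultimately show "T' u = T u" by blast
  qed
  obtain C0 where C0: "\<forall>x\<in>M. \<forall>y\<in>M. NY (f x - f y) \<le> C0 * d x y"
    using f unfolding pointed_lipschitz_def by blast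
  have C1: "max 0 C0 \<in> S"
    unfolding S_def
  proof (intro CollectI conjI ballI)
    fix x y assume xy: "x \<in> M" "y \<in> M"
    have "C0 * d x y \<le> max 0 C0 * d x y" using dnn[OF xy] by (intro mult_right_mono) auto
    then show "NY (f x - f y) \<le> max 0 C0 * d x y" using C0 xy by force
  qed simp
  have exS: "\<exists>T. bounded_linear_on F N Y NY T \<and> (\<forall>x\<in>M. T (\<delta> x) = f x) \<and> (\<forall>u\<in>F. NY (T u) \<le> C * N u)"
    if "C \<in> S" for C
    by (rule ext) (use f that in \<open>auto simp: S_def pointed_lipschitz_def\<close>)
  obtain T where T: "bounded_linear_on F N Y NY T" "\<forall>x\<in>M. T (\<delta> x) = f x"
    using exS[OF C1] by blast
  have "S = {C. 0 \<le> C \<and> (\<forall>u\<in>F. NY (T u) \<le> C * N u)}" (is "_ = ?S")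
  proof (intro equalityI subsetI)
    fix C assume C: "C \<in> S"
    obtain T' where T': "bounded_linear_on F N Y NY T'" "\<forall>x\<in>M. T' (\<delta> x) = f x"
      "\<forall>u\<in>F. NY (T' u) \<le> C * N u" using exS[OF C] by blast
    show "C \<in> ?S" using uniq[OF T T'(1,2)] T'(3) C by (auto simp: S_def)
  next
    fix C assume C: "C \<in> ?S"
    have "NY (f x - f y) \<le> C * d x y" if xy: "x \<in> M" "y \<in> M" for x y
    proof -
      have m: "\<delta> x \<in> F" "\<delta> y \<in> F" using \<delta> xy by auto
      have "T (\<delta> x - \<delta> y) + T (\<delta> y) = T (\<delta> x)"
        using T(1) m F.mem(2)[OF m] unfolding bounded_linear_on_def by (metis diff_add_cancel)
      then have "T (\<delta> x - \<delta> y) = f x - f y" using T(2) xy by (simp add: algebra_simps)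
      moreover have "NY (T (\<delta> x - \<delta> y)) \<le> C * N (\<delta> x - \<delta> y)" using C F.mem(2)[OF m] by blast
      ultimately show ?thesis using iso[OF xy] by simp
    qed
    then show "C \<in> S" using C by (auto simp: S_def)
  qed
  then have "op_norm F N NY T = lip_const M d NY f"
    unfolding op_norm_def lip_const_def S_def by simp
  then show "\<exists>T. bounded_linear_on F N Y NY T \<and> (\<forall>x\<in>M. T (\<delta> x) = f x)
           \<and> op_norm F N NY T = lip_const M d NY f
           \<and> (\<forall>T'. bounded_linear_on F N Y NY T' \<and> (\<forall>x\<in>M. T' (\<delta> x) = f x) \<longrightarrow> (\<forall>u\<in>F. T' u = T u))"
    using T uniq[OF T] by blast
qed

lemma op_norm_bound:
  assumes p: "0 < p" "p \<le> 1" and F: "s_banach p F N" and T: "bounded_linear_on F N Y NY T" and u: "u \<in> F"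
  shows "NY (T u) \<le> op_norm F N NY T * N u"
proof -
  have nF: "\<And>x. x \<in> F \<Longrightarrow> 0 \<le> N x" using F s_banach_iff[OF p] by blast
  obtain C where C: "\<forall>x\<in>F. NY (T x) \<le> C * N x" using T unfolding bounded_linear_on_def by blast
  show ?thesis
  proof (cases "N u = 0")
    case True then show ?thesis using C u by fastforce
  next
    case False
    then have Nu: "N u > 0" using nF[OF u] by simp
    have "NY (T u) / N u \<le> op_norm F N NY T"
      unfolding op_norm_def
    proof (rule cInf_greatest)
      have "NY (T x) \<le> max 0 C * N x" if "x \<in> F" for x
        using C that mult_right_mono[of C "max 0 C" "N x"] nF[OF that] by force
      then have "max 0 C \<in> {C. 0 \<le> C \<and> (\<forall>x\<in>F. NY (T x) \<le> C * N x)}" by simp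
      then show "{C. 0 \<le> C \<and> (\<forall>x\<in>F. NY (T x) \<le> C * N x)} \<noteq> {}" by blast
    qed (use u Nu in \<open>auto simp: pos_divide_le_eq\<close>)
    then show ?thesis using Nu by (simp add: pos_divide_le_eq)
  qed
qed

text \<open>Molecules: the combinations of differences of point masses, with the \<open>p\<close>-th power of the
  infimum of their transport costs.\<close>

abbreviation pt :: "'a \<Rightarrow> ('a, real) poly_mapping" where "pt x \<equiv> Poly_Mapping.single x 1"

definition mval :: "(real \<times> 'a \<times> 'a) list \<Rightarrow> ('a, real) poly_mapping" where
  "mval l = (\<Sum>(a, x, y)\<leftarrow>l. a *\<^sub>R (pt x - pt y))"

definition mcost :: "real \<Rightarrow> ('a \<Rightarrow> 'a \<Rightarrow> real) \<Rightarrow> (real \<times> 'a \<times> 'a) list \<Rightarrow> real" where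
  "mcost p d l = (\<Sum>(a, x, y)\<leftarrow>l. \<bar>a\<bar> powr p * d x y powr p)"

definition mlists :: "'a set \<Rightarrow> (real \<times> 'a \<times> 'a) list set" where
  "mlists M = lists (UNIV \<times> M \<times> M)"

definition mnorm :: "real \<Rightarrow> 'a set \<Rightarrow> ('a \<Rightarrow> 'a \<Rightarrow> real) \<Rightarrow> ('a, real) poly_mapping \<Rightarrow> real" where
  "mnorm p M d m = Inf (mcost p d ` {l \<in> mlists M. mval l = m})"

lemma mval_simps [simp]: "mval [] = 0" "mval ((a, x, y) # l) = a *\<^sub>R (pt x - pt y) + mval l"
    "mval (l @ l') = mval l + mval l'"
  and mcost_simps [simp]: "mcost p d [] = 0" 
    "mcost p d ((a, x, y) # l) = \<bar>a\<bar> powr p * d x y powr p + mcost p d l"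
    "mcost p d (l @ l') = mcost p d l + mcost p d l'"
  and mlists_simps [simp]: "[] \<in> mlists M" "(a, x, y) # l \<in> mlists M \<longleftrightarrow> x \<in> M \<and> y \<in> M \<and> l \<in> mlists M"
    "l @ l' \<in> mlists M \<longleftrightarrow> l \<in> mlists M \<and> l' \<in> mlists M"
  by (auto simp: mval_def mcost_def mlists_def)

lemma mcost_nonneg: "0 \<le> mcost p d l"
  unfolding mcost_def by (rule sum_list_nonneg) auto

lemma mscale: "mval (map (\<lambda>(a, xy). (c * a, xy)) l) = c *\<^sub>R mval l"
    "mcost p d (map (\<lambda>(a, xy). (c * a, xy)) l) = \<bar>c\<bar> powr p * mcost p d l"
    "map (\<lambda>(a, xy). (c * a, xy)) l \<in> mlists M \<longleftrightarrow> l \<in> mlists M"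
  by (induction l) (auto simp: algebra_simps abs_mult powr_mult)

lemma mnorm_le: "l \<in> mlists M \<Longrightarrow> mnorm p M d (mval l) \<le> mcost p d l"
  unfolding mnorm_def by (intro cInf_lower bdd_belowI[of _ 0]) (auto simp: mcost_nonneg)

lemma mnorm_ge: "m \<in> mval ` mlists M \<Longrightarrow> (\<And>l. l \<in> mlists M \<Longrightarrow> mval l = m \<Longrightarrow> c \<le> mcost p d l) \<Longrightarrow> c \<le> mnorm p M d m"
  unfolding mnorm_def by (intro cInf_greatest) auto

lemma psemi_mnorm:
  assumes p: "0 < p" "p \<le> 1"
  shows "psemi p (mval ` mlists M) (mnorm p M d)"
proof
  let ?P = "mval ` mlists M"
  have scale: "c *\<^sub>R mval l \<in> ?P" if "l \<in> mlists M" for c l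
    using mscale(1)[of c l] mscale(3)[of c l M] that by (metis imageI)
  show "subspace ?P"
  proof (rule subspaceI)
    show "0 \<in> ?P" by (rule image_eqI[of _ _ "[]"]) auto
    show "x + y \<in> ?P" if xy: "x \<in> ?P" "y \<in> ?P" for x y
    proof -
      obtain l l' where "l \<in> mlists M" "l' \<in> mlists M" "x = mval l" "y = mval l'" using xy by blast
      then show ?thesis by (intro image_eqI[of _ _ "l @ l'"]) auto
    qed
  qed (use scale in auto)
  show "0 \<le> mnorm p M d m" if "m \<in> ?P" for m
    by (rule mnorm_ge[OF that mcost_nonneg])
  have le: "mnorm p M d (c *\<^sub>R m) \<le> \<bar>c\<bar> powr p * mnorm p M d m" if m: "m \<in> ?P" and c: "c \<noteq> 0" for c m
  proof -
    have cp: "\<bar>c\<bar> powr p > 0" using c by simp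
    have "mnorm p M d (c *\<^sub>R m) / \<bar>c\<bar> powr p \<le> mnorm p M d m"
    proof (rule mnorm_ge[OF m])
      fix l assume l: "l \<in> mlists M" "mval l = m"
      have "mnorm p M d (c *\<^sub>R m) \<le> \<bar>c\<bar> powr p * mcost p d l"
        using mnorm_le[of "map (\<lambda>(a, xy). (c * a, xy)) l" M p d] l by (simp add: mscale)
      then show "mnorm p M d (c *\<^sub>R m) / \<bar>c\<bar> powr p \<le> mcost p d l"
        using cp by (simp add: pos_divide_le_eq mult.commute)
    qed
    then show ?thesis using cp by (simp add: pos_divide_le_eq mult.commute)
  qed
  show "mnorm p M d (c *\<^sub>R m) = \<bar>c\<bar> powr p * mnorm p M d m" if m: "m \<in> ?P" for c m
  proof (cases "c = 0")
    case True
    have "mnorm p M d 0 \<le> 0" using mnorm_le[of "[]" M p d] by simp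
    moreover have "0 \<le> mnorm p M d 0" by (rule mnorm_ge[OF image_eqI[of _ _ "[]"] mcost_nonneg]) auto
    ultimately show ?thesis using True p by simp
  next
    case False
    have cm: "c *\<^sub>R m \<in> ?P" using m scale by auto
    have "mnorm p M d m \<le> \<bar>1/c\<bar> powr p * mnorm p M d (c *\<^sub>R m)"
      using le[OF cm, of "1/c"] False by simp
    then have "\<bar>c\<bar> powr p * mnorm p M d m \<le> \<bar>c\<bar> powr p * (\<bar>1/c\<bar> powr p * mnorm p M d (c *\<^sub>R m))"
      by (intro mult_left_mono) auto
    also have "\<dots> = (\<bar>c\<bar> * \<bar>1/c\<bar>) powr p * mnorm p M d (c *\<^sub>R m)"
      by (simp only: powr_mult abs_ge_zero mult.assoc)
    also have "\<bar>c\<bar> * \<bar>1/c\<bar> = 1" using False by simp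
    finally show ?thesis using le[OF m False] by simp
  qed
  show "mnorm p M d (m + m') \<le> mnorm p M d m + mnorm p M d m'" if m: "m \<in> ?P" "m' \<in> ?P" for m m'
  proof -
    have "mnorm p M d (m + m') - mnorm p M d m' \<le> mnorm p M d m"
    proof (rule mnorm_ge[OF m(1)])
      fix l assume l: "l \<in> mlists M" "mval l = m"
      have "mnorm p M d (m + m') - mcost p d l \<le> mnorm p M d m'"
      proof (rule mnorm_ge[OF m(2)])
        fix l' assume l': "l' \<in> mlists M" "mval l' = m'"
        show "mnorm p M d (m + m') - mcost p d l \<le> mcost p d l'"
          using mnorm_le[of "l @ l'" M p d] l l' by simp
      qed
      then show "mnorm p M d (m + m') - mnorm p M d m' \<le> mcost p d l" by simp
    qed
    then show ?thesis by simp
  qed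
qed (use p in auto)

lemma powr_abs_add:
  assumes "0 < p" "p \<le> (1::real)" shows "\<bar>a + b\<bar> powr p \<le> \<bar>a\<bar> powr p + \<bar>b\<bar> powr p"
proof -
  have "\<bar>a + b\<bar> powr p \<le> (\<bar>a\<bar> + \<bar>b\<bar>) powr p" using assms by (intro powr_mono2) auto
  also have "\<dots> \<le> \<bar>a\<bar> powr p + \<bar>b\<bar> powr p"
  proof (cases "\<bar>a\<bar> + \<bar>b\<bar> = 0")
    case False
    define s where "s = \<bar>a\<bar> + \<bar>b\<bar>"
    have s: "s > 0" using False by (simp add: s_def)
    have *: "t * s powr (p - 1) \<le> t powr p" if t: "0 \<le> t" "t \<le> s" for t
    proof (cases "t = 0")
      case False
      then have "t powr (p - 1) \<ge> s powr (p - 1)" using t assms by (intro powr_mono2') auto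
      then have "t * s powr (p - 1) \<le> t * t powr (p - 1)" using t by (intro mult_left_mono) auto
      also have "\<dots> = t powr p" using t False by (simp add: powr_mult_base)
      finally show ?thesis .
    qed simp
    have "s powr p = s * s powr (p - 1)" using s by (simp add: powr_mult_base)
    also have "\<dots> = \<bar>a\<bar> * s powr (p - 1) + \<bar>b\<bar> * s powr (p - 1)" by (simp add: s_def algebra_simps)
    also have "\<dots> \<le> \<bar>a\<bar> powr p + \<bar>b\<bar> powr p" by (intro add_mono *) (auto simp: s_def)
    finally show ?thesis by (simp add: s_def)
  next
    case True
    then have "a = 0" "b = 0" by linarith+
    then show ?thesis by simp
  qed
  finally show ?thesis .
qed

text \<open>Lower bound: test a molecule against the indicators of the balls around \<open>y\<close>.\<close>

lemma mnorm_pt: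
  assumes p: "0 < p" "p \<le> 1" and M: "p_metric_on p M d" and xy: "x \<in> M" "y \<in> M"
  shows "mnorm p M d (pt x - pt y) = d x y powr p"
proof (rule antisym)
  show "mnorm p M d (pt x - pt y) \<le> d x y powr p"
    using mnorm_le[of "[(1, x, y)]" M p d] xy by simp
  show "d x y powr p \<le> mnorm p M d (pt x - pt y)"
  proof (rule mnorm_ge)
    show "pt x - pt y \<in> mval ` mlists M" using xy by (intro image_eqI[of _ _ "[(1, x, y)]"]) auto
    fix l assume l: "l \<in> mlists M" "mval l = pt x - pt y"
    define t where "t u = d u y powr p" for u
    define g where "g r u = (if 0 < r \<and> r \<le> t u then 1 else 0 :: real)" for r u
    have tri: "\<bar>t u - t v\<bar> \<le> d u v powr p" if uv: "u \<in> M" "v \<in> M" for u v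
    proof -
      have "d u y powr p \<le> d u v powr p + d v y powr p" "d v y powr p \<le> d v u powr p + d u y powr p"
        and "d u v = d v u"
        using M uv xy unfolding p_metric_on_def by blast+
      then show ?thesis by (simp add: t_def)
    qed
    define h where "h l' r = (\<Sum>(a, u, v)\<leftarrow>l'. \<bar>a\<bar> powr p * indicator {min (t u) (t v)<..max (t u) (t v)} r)"
      for l' :: "(real \<times> 'a \<times> 'a) list" and r :: real
    have hs [simp]: "h [] r = 0" 
      "h ((a, u, v) # l') r = \<bar>a\<bar> powr p * indicator {min (t u) (t v)<..max (t u) (t v)} r + h l' r" for a u v l' r
      by (auto simp: h_def)
    have le: "\<bar>lin_ext (g r) (mval l')\<bar> powr p \<le> h l' r" for r l'
    proof (induction l')
      case Nil
      then show ?case using p by (simp add: linear_0[OF linear_lin_ext])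
    next
      case (Cons axy l')
      obtain a u v where [simp]: "axy = (a, u, v)" by (cases axy)
      have tn: "0 \<le> t u" "0 \<le> t v" by (auto simp: t_def)
      have "\<bar>lin_ext (g r) (mval (axy # l'))\<bar> powr p = \<bar>a * (g r u - g r v) + lin_ext (g r) (mval l')\<bar> powr p"
        by (simp add: linear_add[OF linear_lin_ext] linear_scale[OF linear_lin_ext] linear_diff[OF linear_lin_ext])
      also have "\<dots> \<le> \<bar>a * (g r u - g r v)\<bar> powr p + \<bar>lin_ext (g r) (mval l')\<bar> powr p"
        by (rule powr_abs_add[OF p])
      also have "\<bar>a * (g r u - g r v)\<bar> powr p \<le> \<bar>a\<bar> powr p * indicator {min (t u) (t v)<..max (t u) (t v)} r"
        using p tn by (auto simp: g_def indicator_def abs_mult powr_mult min_def max_def split: if_splits)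
      also note Cons.IH
      finally show ?case by simp
    qed
    have int: "integrable lborel (h l') \<and> (l' \<in> mlists M \<longrightarrow> (LINT r|lborel. h l' r) \<le> mcost p d l')" for l'
    proof (induction l')
      case Nil
      then show ?case by simp
    next
      case (Cons axy l')
      obtain a u v where [simp]: "axy = (a, u, v)" by (cases axy)
      let ?I = "{min (t u) (t v)<..max (t u) (t v)}"
      have i1: "integrable lborel (\<lambda>r. \<bar>a\<bar> powr p * indicator ?I r :: real)"
        by (intro integrable_mult_right integrable_real_indicator) auto
      have i2: "integrable lborel (h l')" using Cons.IH by simp
      have e: "h (axy # l') = (\<lambda>r. \<bar>a\<bar> powr p * indicator ?I r + h l' r)" by (rule ext) simp
      have "(LINT r|lborel. h (axy # l') r) = \<bar>a\<bar> powr p * \<bar>t u - t v\<bar> + (LINT r|lborel. h l' r)"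
        unfolding e using i1 i2 by (subst Bochner_Integration.integral_add) (auto simp: min_def max_def)
      moreover have "\<bar>a\<bar> powr p * \<bar>t u - t v\<bar> \<le> \<bar>a\<bar> powr p * d u v powr p" if "u \<in> M" "v \<in> M"
        by (intro mult_left_mono tri that) auto
      moreover have "integrable lborel (h (axy # l'))"
        unfolding e by (rule Bochner_Integration.integrable_add[OF i1 i2])
      ultimately show ?case using Cons.IH by force
    qed
    have ty: "t y = 0" using M xy p by (simp add: t_def p_metric_on_def)
    have eq: "\<bar>lin_ext (g r) (mval l)\<bar> powr p = indicator {0<..t x} r" for r
      unfolding l(2) using p by (simp add: linear_diff[OF linear_lin_ext] g_def ty indicator_def)
    have "t x = (LINT r|lborel. indicator {0<..t x} r)" by (simp add: t_def)
    also have "\<dots> \<le> (LINT r|lborel. h l r)"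
    proof (rule integral_mono)
      show "integrable lborel (indicator {0<..t x} :: real \<Rightarrow> real)"
        by (intro integrable_real_indicator) (auto simp: t_def)
      show "integrable lborel (h l)" using int by blast
      show "indicator {0<..t x} r \<le> h l r" for r using le[of r l] eq[of r] by simp
    qed
    also have "\<dots> \<le> mcost p d l" using int l(1) by blast
    finally show "d x y powr p \<le> mcost p d l" by (simp add: t_def)
  qed
qed

lemma lin_ext_mnorm_bound:
  assumes p: "0 < p" "p \<le> 1" and Y: "s_banach p Y NY"
    and f: "f ` M \<subseteq> Y" and C: "0 \<le> C"
    and lip: "\<And>x y. x \<in> M \<Longrightarrow> y \<in> M \<Longrightarrow> NY (f x - f y) \<le> C * d x y"
    and dnn: "\<And>x y. x \<in> M \<Longrightarrow> y \<in> M \<Longrightarrow> 0 \<le> d x y"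
    and m: "m \<in> mval ` mlists M"
  shows "lin_ext f m \<in> Y" "NY (lin_ext f m) powr p \<le> C powr p * mnorm p M d m"
proof -
  interpret Y: pnorm p Y "\<lambda>x. NY x powr p" using Y s_banach_iff p by blast
  have nY: "\<And>x. x \<in> Y \<Longrightarrow> 0 \<le> NY x" using Y s_banach_iff[OF p] by blast
  note L = linear_lin_ext[of f]
  have *: "lin_ext f (mval l) \<in> Y \<and> NY (lin_ext f (mval l)) powr p \<le> C powr p * mcost p d l"
    if "l \<in> mlists M" for l
    using that
  proof (induction l)
    case Nil
    then show ?case using Y.mem(4) Y.R0 by (simp add: linear_0[OF L])
  next
    case (Cons axy l)
    obtain a x y where [simp]: "axy = (a, x, y)" by (cases axy)
    have xy: "x \<in> M" "y \<in> M" and l: "l \<in> mlists M" using Cons.prems by auto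
    have mem: "f x \<in> Y" "f y \<in> Y" using f xy by auto
    have fxy: "f x - f y \<in> Y" by (rule Y.mem(2)[OF mem])
    have IH: "lin_ext f (mval l) \<in> Y" "NY (lin_ext f (mval l)) powr p \<le> C powr p * mcost p d l"
      using Cons.IH[OF l] by auto
    have e: "lin_ext f (mval (axy # l)) = a *\<^sub>R (f x - f y) + lin_ext f (mval l)"
      by (simp add: linear_add[OF L] linear_scale[OF L] linear_diff[OF L])
    have "NY (f x - f y) powr p \<le> (C * d x y) powr p"
      using lip[OF xy] nY[OF fxy] p by (intro powr_mono2) auto
    also have "(C * d x y) powr p = C powr p * d x y powr p"
      using C dnn[OF xy] by (simp add: powr_mult)
    finally have le: "\<bar>a\<bar> powr p * NY (f x - f y) powr p \<le> \<bar>a\<bar> powr p * (C powr p * d x y powr p)"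
      by (intro mult_left_mono) auto
    have "NY (lin_ext f (mval (axy # l))) powr p \<le> NY (a *\<^sub>R (f x - f y)) powr p + NY (lin_ext f (mval l)) powr p"
      unfolding e by (rule Y.add[OF Y.mem(3)[OF fxy] IH(1)])
    also have "\<dots> \<le> C powr p * mcost p d (axy # l)"
      using le IH(2) Y.sc[OF fxy, of a] by (simp add: algebra_simps)
    finally have "NY (lin_ext f (mval (axy # l))) powr p \<le> C powr p * mcost p d (axy # l)" .
    moreover have "lin_ext f (mval (axy # l)) \<in> Y"
      unfolding e by (rule Y.mem(1)[OF Y.mem(3)[OF fxy] IH(1)])
    ultimately show ?case by blast
  qed
  show "lin_ext f m \<in> Y" using m * by blast
  show "NY (lin_ext f m) powr p \<le> C powr p * mnorm p M d m"
  proof (cases "C powr p = 0")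
    case True
    then show ?thesis using m * by auto
  next
    case False
    then have Cp: "C powr p > 0" by (smt (verit) powr_ge_zero)
    have "NY (lin_ext f m) powr p / C powr p \<le> mnorm p M d m"
      by (rule mnorm_ge[OF m]) (use * Cp in \<open>auto simp: pos_divide_le_eq mult.commute\<close>)
    then show ?thesis using Cp by (simp add: pos_divide_le_eq mult.commute)
  qed
qed

lemma lipschitz_free_core:
  fixes M :: "'a set"
  assumes p: "0 < p" "p \<le> 1" and M: "p_metric_on p M d" and z: "z \<in> M"
  shows "\<exists>F N \<delta>. lipschitz_free p M d z F N \<delta>
     \<and> (\<forall>(Y :: 'y::real_vector set) NY. s_banach p Y NY \<longrightarrow> extends_lipschitz M d z F N \<delta> Y NY)"
proof -
  let ?P = "mval ` mlists M :: ('a, real) poly_mapping set"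
  interpret P: psemi p ?P "mnorm p M d" by (rule psemi_mnorm[OF p])
  obtain F :: "'a big set" and Q \<iota> where
    *: "pnorm p F Q \<and> complete_on F Q
     \<and> (\<forall>u\<in>?P. \<iota> u \<in> F \<and> Q (\<iota> u) = mnorm p M d u) \<and> (\<forall>u\<in>?P. \<forall>v\<in>?P. \<iota> (u + v) = \<iota> u + \<iota> v)
     \<and> (\<forall>a. \<forall>u\<in>?P. \<iota> (a *\<^sub>R u) = a *\<^sub>R \<iota> u)
     \<and> (\<forall>w\<in>F. \<forall>e>0. \<exists>u\<in>?P. Q (w - \<iota> u) < e)"
    using P.completion by (elim exE) (rule that)
  have FQ: "pnorm p F Q" "complete_on F Q"
    using *[THEN conjunct1] *[THEN conjunct2, THEN conjunct1] .
  have i: "\<iota> u \<in> F" "Q (\<iota> u) = mnorm p M d u" if "u \<in> ?P" for u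
    using *[THEN conjunct2, THEN conjunct2, THEN conjunct1] that by blast+
  have iadd: "\<iota> (u + v) = \<iota> u + \<iota> v" if "u \<in> ?P" "v \<in> ?P" for u v
    using *[THEN conjunct2, THEN conjunct2, THEN conjunct2, THEN conjunct1] that by blast
  have isc: "\<iota> (a *\<^sub>R u) = a *\<^sub>R \<iota> u" if "u \<in> ?P" for a u
    using *[THEN conjunct2, THEN conjunct2, THEN conjunct2, THEN conjunct2, THEN conjunct1] that by blast
  have dn: "\<exists>u\<in>?P. Q (w - \<iota> u) < e" if "w \<in> F" "e > 0" for w e
    using *[THEN conjunct2, THEN conjunct2, THEN conjunct2, THEN conjunct2, THEN conjunct2] that by blast
  interpret F: pnorm p F Q by fact
  define N where "N w = Q w powr (1/p)" for w
  have N: "s_banach p F N" unfolding N_def by (rule s_banach_of_pnorm[OF FQ])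
  have Np: "N w powr p = Q w" if "w \<in> F" for w
    using F.nn[OF that] p by (simp add: N_def powr_powr)
  define \<delta> where "\<delta> x = \<iota> (pt x - pt z)" for x
  have ptP: "pt x - pt y \<in> ?P" if "x \<in> M" "y \<in> M" for x y
    using that by (intro image_eqI[of _ _ "[(1, x, y)]"]) auto
  have i0: "\<iota> 0 = 0" using isc[OF P.mem(4), of 0] by simp
  have idiff: "\<iota> (u - v) = \<iota> u - \<iota> v" if "u \<in> ?P" "v \<in> ?P" for u v
    using iadd[OF P.mem(2)[OF that] that(2)] by (simp add: algebra_simps)
  have dF: "\<delta> ` M \<subseteq> F" using i(1) ptP z by (auto simp: \<delta>_def)
  have dz: "\<delta> z = 0" by (simp add: \<delta>_def i0)
  have dd: "\<delta> x - \<delta> y = \<iota> (pt x - pt y)" if "x \<in> M" "y \<in> M" for x y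
    using idiff[OF ptP[OF that(1) z] ptP[OF that(2) z]] by (simp add: \<delta>_def)
  have dnn: "0 \<le> d x y" if "x \<in> M" "y \<in> M" for x y
    using M that unfolding p_metric_on_def by blast
  have iso: "N (\<delta> x - \<delta> y) = d x y" if "x \<in> M" "y \<in> M" for x y
    using i(2)[OF ptP[OF that]] mnorm_pt[OF p M that] dnn[OF that] p
    by (simp add: N_def dd[OF that] powr_powr)
  have iP: "\<iota> u \<in> span (\<delta> ` M)" if "u \<in> ?P" for u
  proof -
    have "\<iota> (mval l) \<in> span (\<delta> ` M)" if "l \<in> mlists M" for l
      using that
    proof (induction l)
      case Nil
      then show ?case by (simp add: i0 span_zero)
    next
      case (Cons axy l)
      obtain a x y where [simp]: "axy = (a, x, y)" by (cases axy)
      have xy: "x \<in> M" "y \<in> M" and l: "l \<in> mlists M" using Cons.prems by auto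
      have "\<iota> (mval (axy # l)) = a *\<^sub>R \<iota> (pt x - pt y) + \<iota> (mval l)"
        using iadd[OF P.mem(3)[OF ptP[OF xy]] imageI[OF l], of a] isc[OF ptP[OF xy], of a] by simp
      also have "\<iota> (pt x - pt y) = \<delta> x - \<delta> y" using dd[OF xy] by simp
      finally show ?case using xy Cons.IH[OF l]
        by (auto intro!: span_add span_scale span_diff intro: span_base)
    qed
    then show ?thesis using that by blast
  qed
  have dense: "\<exists>v\<in>span (\<delta> ` M). N (u - v) < e" if u: "u \<in> F" and e: "e > 0" for u e
  proof -
    have "e powr p > 0" using e by simp
    from dn[OF u this] obtain m where m: "m \<in> ?P" "Q (u - \<iota> m) < e powr p" by blast
    have um: "u - \<iota> m \<in> F" by (rule F.mem(2)[OF u i(1)[OF m(1)]])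
    have "N (u - \<iota> m) powr p < e powr p" using m(2) Np[OF um] by simp
    moreover have "0 \<le> N (u - \<iota> m)" by (simp add: N_def)
    ultimately have "N (u - \<iota> m) < e" using powr_less_iff[OF p(1) _ e] by blast
    then show ?thesis using iP[OF m(1)] by blast
  qed
  have ext: "extends_lipschitz M d z F N \<delta> Y NY" if Y: "s_banach p Y NY" for Y :: "'w::real_vector set" and NY
  proof (rule extends_lipschitzI[OF p N Y dF iso dense])
    fix f :: "'a \<Rightarrow> 'w" and C
    assume f: "f ` M \<subseteq> Y" "f z = 0" and C: "0 \<le> C"
      and lip: "\<And>x y. x \<in> M \<Longrightarrow> y \<in> M \<Longrightarrow> NY (f x - f y) \<le> C * d x y"
    interpret Y: pnorm p Y "\<lambda>x. NY x powr p" using Y s_banach_iff p by blast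
    have nY: "\<And>x. x \<in> Y \<Longrightarrow> 0 \<le> NY x" using Y s_banach_iff[OF p] by blast
    note L = linear_lin_ext[of f]
    note bd = lin_ext_mnorm_bound[OF p Y f(1) C lip dnn]
    define g where "g w = (SOME m. m \<in> ?P \<and> \<iota> m = w)" for w
    define T where "T w = lin_ext f (g w)" for w
    have g: "g (\<iota> m) \<in> ?P" "\<iota> (g (\<iota> m)) = \<iota> m" if "m \<in> ?P" for m
      using someI[of "\<lambda>m'. m' \<in> ?P \<and> \<iota> m' = \<iota> m" m] that unfolding g_def by auto
    have Ti: "T (\<iota> m) = lin_ext f m" if m: "m \<in> ?P" for m
    proof -
      let ?m = "g (\<iota> m) - m"
      have mP: "?m \<in> ?P" by (rule P.mem(2)[OF g(1)[OF m] m])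
      have "mnorm p M d ?m = Q (\<iota> ?m)" using i(2)[OF mP] by simp
      also have "\<dots> = 0" using idiff[OF g(1)[OF m] m] g(2)[OF m] F.R0 by simp
      finally have "NY (lin_ext f ?m) powr p \<le> 0" using bd(2)[OF _ _ _ _ mP] by simp
      then have "NY (lin_ext f ?m) powr p = 0" by (smt (verit) powr_ge_zero)
      then have "lin_ext f ?m = 0" using Y.zero bd(1)[OF _ _ _ _ mP] by blast
      then show ?thesis by (simp add: T_def linear_diff[OF L])
    qed
    have sub: "subspace (\<iota> ` ?P)"
    proof (rule subspaceI)
      show "0 \<in> \<iota> ` ?P" using i0 P.mem(4) by (metis imageI)
      show "x + y \<in> \<iota> ` ?P" if xy: "x \<in> \<iota> ` ?P" "y \<in> \<iota> ` ?P" for x y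
      proof -
        obtain u v where "u \<in> ?P" "v \<in> ?P" "x = \<iota> u" "y = \<iota> v" using xy by blast
        then show ?thesis using iadd P.mem(1) by (metis imageI)
      qed
      show "c *\<^sub>R x \<in> \<iota> ` ?P" if x: "x \<in> \<iota> ` ?P" for c x
      proof -
        obtain u where "u \<in> ?P" "x = \<iota> u" using x by blast
        then show ?thesis using isc P.mem(3) by (metis imageI)
      qed
    qed
    have dP: "\<exists>v\<in>\<iota> ` ?P. N (u - v) powr p < e" if u: "u \<in> F" and e: "e > 0" for u e
    proof -
      from dn[OF u e] obtain m where m: "m \<in> ?P" "Q (u - \<iota> m) < e" by blast
      then have "N (u - \<iota> m) powr p < e" using Np[OF F.mem(2)[OF u i(1)[OF m(1)]]] by simp
      then show ?thesis using m(1) by blast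
    qed
    have iF: "\<iota> ` ?P \<subseteq> F" using i(1) by blast
    have Tb: "NY (T w) \<le> C * N w" if w: "w \<in> \<iota> ` ?P" for w
    proof -
      obtain m where m: "m \<in> ?P" "w = \<iota> m" using w by blast
      have wF: "w \<in> F" using w iF by blast
      have nN: "0 \<le> N w" by (simp add: N_def)
      have "NY (T w) powr p \<le> C powr p * mnorm p M d m" using bd(2)[OF _ _ _ _ m(1)] Ti[OF m(1)] m(2) by simp
      also have "mnorm p M d m = N w powr p" using i(2)[OF m(1)] Np[OF wF] m(2) by simp
      also have "C powr p * N w powr p = (C * N w) powr p" using C nN by (simp add: powr_mult)
      finally show ?thesis
        using p C nN powr_less_mono2[of p "C * N w" "NY (T w)"] by (smt (verit) mult_nonneg_nonneg)
    qed
    have TY: "T w \<in> Y" if w: "w \<in> \<iota> ` ?P" for w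
    proof -
      obtain m where m: "m \<in> ?P" "w = \<iota> m" using w by blast
      then show ?thesis using bd(1)[OF _ _ _ _ m(1)] Ti[OF m(1)] by simp
    qed
    have Tadd: "T (v + w) = T v + T w" if vw: "v \<in> \<iota> ` ?P" "w \<in> \<iota> ` ?P" for v w
    proof -
      obtain m m' where m: "m \<in> ?P" "v = \<iota> m" "m' \<in> ?P" "w = \<iota> m'" using vw by blast
      have "T (\<iota> (m + m')) = lin_ext f (m + m')" by (rule Ti[OF P.mem(1)[OF m(1,3)]])
      then show ?thesis using m Ti[OF m(1)] Ti[OF m(3)] iadd[OF m(1,3)] by (simp add: linear_add[OF L])
    qed
    have Tsc: "T (a *\<^sub>R w) = a *\<^sub>R T w" if w: "w \<in> \<iota> ` ?P" for a w
    proof -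
      obtain m where m: "m \<in> ?P" "w = \<iota> m" using w by blast
      have "T (\<iota> (a *\<^sub>R m)) = lin_ext f (a *\<^sub>R m)" by (rule Ti[OF P.mem(3)[OF m(1)]])
      then show ?thesis using m Ti[OF m(1)] isc[OF m(1)] by (simp add: linear_scale[OF L])
    qed
    obtain T' where T': "bounded_linear_on F N Y NY T'" "\<forall>u\<in>\<iota> ` ?P. T' u = T u"
      using bounded_linear_on_extend[where T=T, OF p N Y sub iF dP C Tb TY Tadd Tsc] by blast
    have 1: "\<forall>x\<in>M. T' (\<delta> x) = f x"
    proof
      fix x assume x: "x \<in> M"
      have "T' (\<delta> x) = lin_ext f (pt x - pt z)"
        using T'(2)[rule_format, OF imageI[OF ptP[OF x z]]] Ti[OF ptP[OF x z]] by (simp add: \<delta>_def)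
      then show "T' (\<delta> x) = f x" using f(2) by (simp add: linear_diff[OF L])
    qed
    have 2: "\<forall>u\<in>F. NY (T' u) \<le> C * N u"
    proof
      fix u assume u: "u \<in> F"
      show "NY (T' u) \<le> C * N u"
        by (rule bound_dense[OF p N Y T'(1) iF dP C _ u]) (use Tb T'(2) in auto)
    qed
    show "\<exists>T. bounded_linear_on F N Y NY T \<and> (\<forall>x\<in>M. T (\<delta> x) = f x) \<and> (\<forall>u\<in>F. NY (T u) \<le> C * N u)"
      using T'(1) 1 2 by blast
  qed
  have "lipschitz_free p M d z F N \<delta>"
    unfolding lipschitz_free_def by (intro conjI ballI allI impI M z N dF dz iso dense ext)
  then show ?thesis
    by (intro exI[of _ F] exI[of _ N] exI[of _ \<delta>] conjI allI impI ext)
qed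

theorem lipschitz_free_exists:
  assumes "0 < p" "p \<le> 1" "p_metric_on p M d" "z \<in> M"
  shows "\<exists>F N \<delta>. lipschitz_free p M d z F N \<delta>"
  using lipschitz_free_core[OF assms, where ?'y = real] by blast

lemma lipschitz_freeD:
  fixes F :: "'a big set"
  assumes "lipschitz_free p M d z F N \<delta>"
  shows "p_metric_on p M d" "z \<in> M" "s_banach p F N" "\<delta> ` M \<subseteq> F" "\<delta> z = 0"
    "\<And>x y. x \<in> M \<Longrightarrow> y \<in> M \<Longrightarrow> N (\<delta> x - \<delta> y) = d x y"
    "\<And>u e. u \<in> F \<Longrightarrow> e > 0 \<Longrightarrow> \<exists>v\<in>span (\<delta> ` M). N (u - v) < e"
    "\<And>(Y :: 'a big set) NY. s_banach p Y NY \<Longrightarrow> extends_lipschitz M d z F N \<delta> Y NY"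
  using assms unfolding lipschitz_free_def by simp_all

theorem lipschitz_free_universal:
  fixes Y :: "'y::real_vector set" and F :: "'a big set"
  assumes p: "0 < p" "p \<le> 1" and free: "lipschitz_free p M d z F N \<delta>" and Y: "s_banach p Y NY"
  shows "extends_lipschitz M d z F N \<delta> Y NY"
proof -
  note M = lipschitz_freeD(1,2)[OF free] and F = lipschitz_freeD(3)[OF free] and dF = lipschitz_freeD(4)[OF free]
    and iso = lipschitz_freeD(6)[OF free] and dense = lipschitz_freeD(7)[OF free]
    and univ = lipschitz_freeD(8)[OF free]
  obtain F0 :: "'a big set" and N0 \<delta>0 where free0: "lipschitz_free p M d z F0 N0 \<delta>0
     \<and> (\<forall>(Y :: 'y set) NY. s_banach p Y NY \<longrightarrow> extends_lipschitz M d z F0 N0 \<delta>0 Y NY)"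
    using lipschitz_free_core[OF p M, where ?'y = 'y] by (elim exE) (rule that)
  then have univ0: "\<And>(Y :: 'y set) NY. s_banach p Y NY \<Longrightarrow> extends_lipschitz M d z F0 N0 \<delta>0 Y NY"
    by blast
  note F0 = lipschitz_freeD(3)[OF conjunct1[OF free0]] and d0 = lipschitz_freeD(4,5)[OF conjunct1[OF free0]]
    and iso0 = lipschitz_freeD(6)[OF conjunct1[OF free0]]
  have nF0: "0 \<le> N0 x" if "x \<in> F0" for x using F0 s_banach_iff[OF p] that by blast
  have nF: "0 \<le> N x" if "x \<in> F" for x using F s_banach_iff[OF p] that by blast
  have "pointed_lipschitz M d z F0 N0 \<delta>0"
    unfolding pointed_lipschitz_def using d0 iso0 by (auto intro: exI[of _ 1])
  then obtain J where J: "bounded_linear_on F N F0 N0 J" "\<forall>x\<in>M. J (\<delta> x) = \<delta>0 x"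
    "op_norm F N N0 J = lip_const M d N0 \<delta>0"
    using univ[OF F0] unfolding extends_lipschitz_def by blast
  have "lip_const M d N0 \<delta>0 \<le> 1"
    unfolding lip_const_def by (rule cInf_lower) (auto simp: iso0 intro!: bdd_belowI[of _ 0])
  have Jb: "N0 (J u) \<le> N u" if u: "u \<in> F" for u
  proof -
    have "N0 (J u) \<le> op_norm F N N0 J * N u" by (rule op_norm_bound[OF p F J(1) u])
    also have "\<dots> \<le> 1 * N u"
      using J(3) \<open>lip_const M d N0 \<delta>0 \<le> 1\<close> nF[OF u] by (intro mult_right_mono) auto
    finally show ?thesis by simp
  qed
  show ?thesis
  proof (rule extends_lipschitzI[OF p F Y dF iso dense])
    fix f :: "'a \<Rightarrow> 'y" and C
    assume f: "f ` M \<subseteq> Y" "f z = 0" and C: "0 \<le> C"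
      and lip: "\<And>x y. x \<in> M \<Longrightarrow> y \<in> M \<Longrightarrow> NY (f x - f y) \<le> C * d x y"
    have "pointed_lipschitz M d z Y NY f" unfolding pointed_lipschitz_def using f lip by blast
    then obtain T where T: "bounded_linear_on F0 N0 Y NY T" "\<forall>x\<in>M. T (\<delta>0 x) = f x"
      "op_norm F0 N0 NY T = lip_const M d NY f"
      using univ0[OF Y] unfolding extends_lipschitz_def by blast
    have lC: "lip_const M d NY f \<le> C"
      unfolding lip_const_def by (rule cInf_lower) (use lip C in \<open>auto intro!: bdd_belowI[of _ 0]\<close>)
    have JF: "J u \<in> F0" if "u \<in> F" for u using J(1) that unfolding bounded_linear_on_def by blast
    have bd: "NY (T (J u)) \<le> C * N u" if u: "u \<in> F" for u
    proof -
      have "NY (T (J u)) \<le> op_norm F0 N0 NY T * N0 (J u)" by (rule op_norm_bound[OF p F0 T(1) JF[OF u]])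
      also have "\<dots> \<le> C * N0 (J u)" using T(3) lC nF0[OF JF[OF u]] by (intro mult_right_mono) auto
      also have "\<dots> \<le> C * N u" using Jb[OF u] C by (intro mult_left_mono) auto
      finally show ?thesis .
    qed
    have "bounded_linear_on F N Y NY (\<lambda>u. T (J u))"
      unfolding bounded_linear_on_def
    proof (intro conjI allI ballI)
      show "(\<lambda>u. T (J u)) ` F \<subseteq> Y" using JF T(1) unfolding bounded_linear_on_def by blast
      show "\<exists>C. \<forall>x\<in>F. NY (T (J x)) \<le> C * N x" using bd by blast
      show "T (J (x + y)) = T (J x) + T (J y)" if xy: "x \<in> F" "y \<in> F" for x y
      proof -
        have "J (x + y) = J x + J y" using J(1) xy unfolding bounded_linear_on_def by blast
        then show ?thesis using T(1) JF[OF xy(1)] JF[OF xy(2)] unfolding bounded_linear_on_def by simp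
      qed
      show "T (J (a *\<^sub>R x)) = a *\<^sub>R T (J x)" if x: "x \<in> F" for a x
      proof -
        have "J (a *\<^sub>R x) = a *\<^sub>R J x" using J(1) x unfolding bounded_linear_on_def by blast
        then show ?thesis using T(1) JF[OF x] unfolding bounded_linear_on_def by simp
      qed
    qed
    moreover have "\<forall>x\<in>M. T (J (\<delta> x)) = f x" using J(2) T(2) by simp
    ultimately show "\<exists>T. bounded_linear_on F N Y NY T \<and> (\<forall>x\<in>M. T (\<delta> x) = f x) \<and> (\<forall>u\<in>F. NY (T u) \<le> C * N u)"
      using bd by blast
  qed
qed

lemma s_banach_mono:
  assumes pq: "0 < p" "p \<le> q" and X: "s_banach q X N"
  shows "s_banach p X N"
  unfolding s_banach_def
proof (intro conjI ballI)
  show X': "quasi_norm_on X N" "complete_on X N" using X unfolding s_banach_def by auto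
  fix x y assume xy: "x \<in> X" "y \<in> X"
  have *: "N w powr p = (N w powr q) powr (p / q)" for w using pq by (simp add: powr_powr)
  have "N (x + y) powr q \<le> N x powr q + N y powr q" using X xy unfolding s_banach_def by blast
  then have "N (x + y) powr p \<le> \<bar>N x powr q + N y powr q\<bar> powr (p / q)"
    unfolding *[of "x + y"] using pq by (intro powr_mono2) auto
  also have "\<dots> \<le> \<bar>N x powr q\<bar> powr (p / q) + \<bar>N y powr q\<bar> powr (p / q)"
    using pq by (intro powr_abs_add) auto
  finally show "N (x + y) powr p \<le> N x powr p + N y powr p" using pq by (simp add: *[symmetric])
qed

lemma p_metric_on_s_banach:
  assumes p: "0 < p" "p \<le> 1" and X: "s_banach p X N"
  shows "p_metric_on p X (\<lambda>x y. N (x - y))"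
proof -
  interpret pnorm p X "\<lambda>x. N x powr p" using X s_banach_iff[OF p] by blast
  have nn': "0 \<le> N x" if "x \<in> X" for x using X s_banach_iff[OF p] that by blast
  have q: "N x = 0 \<longleftrightarrow> x = 0" "N (a *\<^sub>R x) = \<bar>a\<bar> * N x" if "x \<in> X" for x a
    using X that unfolding s_banach_def quasi_norm_on_def by blast+
  show ?thesis
    unfolding p_metric_on_def
  proof (intro conjI ballI)
    fix x y assume xy: "x \<in> X" "y \<in> X"
    note m = mem(2)[OF xy]
    show "0 \<le> N (x - y)" by (rule nn'[OF m])
    show "N (x - y) = 0 \<longleftrightarrow> x = y" using q(1)[OF m] by simp
    show "N (x - y) = N (y - x)" using q(2)[OF m, of "-1"] by simp
  qed (rule Rtri)
qed

theorem barycenter_exists: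
  assumes p: "0 < p" "p \<le> 1" and X: "s_banach p X N"
    and free: "lipschitz_free p X (\<lambda>x y. N (x - y)) 0 F NF \<delta>"
  shows "\<exists>\<beta>. barycenter X N F NF \<delta> \<beta>"
proof -
  have "pointed_lipschitz X (\<lambda>x y. N (x - y)) 0 X N (\<lambda>x. x)"
    unfolding pointed_lipschitz_def by (auto intro: exI[of _ 1])
  then show ?thesis
    using lipschitz_free_universal[OF p free X] unfolding extends_lipschitz_def barycenter_def by blast
qed

end

theory Submission
  imports Defs
begin

text \<open>
  With the metric \<open>D x y = N (x - y) powr q\<close>, the \<open>p\<close>-metric of \<open>X\<close> is the \<open>p / q\<close>-snowflake of \<open>D\<close>, and the
  free norm of a molecule is a transport cost. Cost functions whose sum is dominated by the snowflake
  bound this norm from below. If arbitrarily many unit vectors have liftings that are each seen by their own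
  cost function in such a family, then after disjointification the lifting of a sum of \<open>n\<close> of them costs
  at least a multiple of \<open>n\<close>, whereas the \<open>q\<close>-triangle inequality allows only a multiple of \<open>n powr (p / q)\<close>.

  Such families come from one of two sources. The barycenter of a molecule of bounded cost is controlled by the
  costs \<open>min (D x y) (2 ^ k)\<close>, suitably normalised, so the lifting of each unit vector is seen at some dyadic
  scale. Either these scales leave every finite set, and costs at distinct scales form the family; or the
  single cost \<open>min 1 (D x y)\<close> sees all unit vectors, and a gliding hump in space produces costs with
  disjoint supports, since in infinite dimensions the liftings cannot concentrate near a finite set.
\<close>

subsection \<open>Transport costs of molecules\<close>

text \<open>For \<open>p < 1\<close> the free norm need not be a supremum of linear functionals, so
  duality cannot supply its lower bounds. Cost functions replace functionals: each
  \<open>s \<ge> 0\<close> on pairs of points yields the \<open>p\<close>-th power of a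
  \<open>p\<close>-seminorm on molecules. The obstacle is that a molecule has no preferred
  representation, and one that is cheap for a given cost may be expensive for another. Seeing a unit
  vector at some scale means recovering its barycenter from a different representation at each
  scale. Removing cycles from a flow makes this possible: it merges a bound on the weights of one
  representation with a bound on the lengths in another. The strict inequality \<open>p < q\<close>
  enters twice. The normalised costs decay geometrically on both sides of the length of an edge
  because \<open>0 < p / q < 1\<close>, and \<open>n powr (p / q)\<close> is eventually below any
  multiple of \<open>n\<close>. In the gliding hump the thresholds have to be fixed before the
  finite set that is to be left.\<close>

definition tcost :: "real \<Rightarrow> ('a \<Rightarrow> 'a \<Rightarrow> real) \<Rightarrow> (real \<times> 'a \<times> 'a) list \<Rightarrow> real" where
  "tcost p s l = (\<Sum>(a, x, y)\<leftarrow>l. \<bar>a\<bar> powr p * s x y)"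

text \<open>Stated through a witness instead of an infimum: the negation says that every
  representation of \<open>m\<close> costs more than \<open>k\<close>, which is how a test sees a
  molecule.\<close>

definition cost_le :: "real \<Rightarrow> ('a \<Rightarrow> 'a \<Rightarrow> real) \<Rightarrow> ('a, real) poly_mapping \<Rightarrow> real \<Rightarrow> bool" where
  "cost_le p s m k \<longleftrightarrow> (\<exists>l. mval l = m \<and> tcost p s l \<le> k)"

definition push :: "('a \<Rightarrow> 'b) \<Rightarrow> ('a, real) poly_mapping \<Rightarrow> ('b, real) poly_mapping" where
  "push h = lin_ext (\<lambda>x. pt (h x))"

lemmas lin_ext_linear = linear_add[OF linear_lin_ext] linear_diff[OF linear_lin_ext]
  linear_scale[OF linear_lin_ext] linear_0[OF linear_lin_ext] linear_neg[OF linear_lin_ext]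
  linear_sum[OF linear_lin_ext]

lemma linear_push: "linear (push h)"
  unfolding push_def by (rule linear_lin_ext)

lemma tcost_simps [simp]: "tcost p s [] = 0"
    "tcost p s ((a, x, y) # l) = \<bar>a\<bar> powr p * s x y + tcost p s l"
    "tcost p s (l @ l') = tcost p s l + tcost p s l'"
  by (auto simp: tcost_def)

lemma tcost_nonneg: "(\<And>x y. 0 \<le> s x y) \<Longrightarrow> 0 \<le> tcost p s l"
  by (induction l) auto

lemma tcost_mono:
  "(\<And>a x y. (a, x, y) \<in> set l \<Longrightarrow> s x y \<le> s' x y) \<Longrightarrow> tcost p s l \<le> tcost p s' l"
proof (induction l)
  case (Cons e l)
  obtain a x y where [simp]: "e = (a, x, y)" by (cases e)
  have "\<bar>a\<bar> powr p * s x y \<le> \<bar>a\<bar> powr p * s' x y"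
    using Cons.prems[of a x y] by (intro mult_left_mono) auto
  then show ?case using Cons.IH Cons.prems by (auto intro!: add_mono)
qed simp

lemma tcost_scale: "tcost p s (map (\<lambda>(a, xy). (c * a, xy)) l) = \<bar>c\<bar> powr p * tcost p s l"
  by (induction l) (auto simp: abs_mult powr_mult algebra_simps)

lemma tcost_mult: "tcost p (\<lambda>x y. c * s x y) l = c * tcost p s l"
  by (induction l) (auto simp: algebra_simps)

lemma tcost_add: "tcost p (\<lambda>x y. s x y + s' x y) l = tcost p s l + tcost p s' l"
  by (induction l) (auto simp: algebra_simps)

lemma tcost_sum: "tcost p (\<lambda>x y. \<Sum>i\<in>I. s i x y) l = (\<Sum>i\<in>I. tcost p (s i) l)"
proof (induction l)
  case (Cons e l)
  then show ?case by (cases e) (auto simp: sum.distrib sum_distrib_left)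
qed simp

lemma tcost_filter: "tcost p s (filter P l) + tcost p s (filter (\<lambda>e. \<not> P e) l) = tcost p s l"
  by (induction l) auto

lemma mval_filter: "mval (filter P l) + mval (filter (\<lambda>e. \<not> P e) l) = mval l"
  by (induction l) (auto simp: algebra_simps)

lemma tcost_filter_le: "(\<And>x y. 0 \<le> s x y) \<Longrightarrow> tcost p s (filter P l) \<le> tcost p s l"
  using tcost_filter[of p s P l] tcost_nonneg[of s p "filter (\<lambda>e. \<not> P e) l"] by simp

lemma lin_ext_mval: "lin_ext f (mval l) = (\<Sum>(a, x, y)\<leftarrow>l. a *\<^sub>R (f x - f y))"
  by (induction l) (auto simp: lin_ext_linear)

text \<open>Subadditivity of the \<open>p\<close>-th power along a representation. For an indicator
  \<open>f\<close> it bounds the mass of a set by the weight of the edges with exactly one end in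
  it; the bounds on coefficients below rest on this.\<close>

lemma lin_ext_scalar_powr_le:
  fixes f :: "'a \<Rightarrow> real"
  assumes p: "0 < p" "p \<le> 1"
  shows "\<bar>lin_ext f (mval l)\<bar> powr p \<le> tcost p (\<lambda>x y. \<bar>f x - f y\<bar> powr p) l"
proof (induction l)
  case Nil then show ?case using p by (simp add: lin_ext_linear)
next
  case (Cons e l)
  obtain a x y where [simp]: "e = (a, x, y)" by (cases e)
  have "\<bar>lin_ext f (mval (e # l))\<bar> powr p \<le> \<bar>a * (f x - f y)\<bar> powr p + \<bar>lin_ext f (mval l)\<bar> powr p"
    using powr_abs_add[OF p, of "a * (f x - f y)" "lin_ext f (mval l)"] by (simp add: lin_ext_linear)
  then show ?case using Cons.IH by (simp add: abs_mult powr_mult)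
qed

lemma push_mval: "push h (mval l) = mval (map (\<lambda>(a, x, y). (a, h x, h y)) l)"
  by (induction l) (auto simp: push_def lin_ext_linear)

lemma tcost_push: "tcost p s (map (\<lambda>(a, x, y). (a, h x, h y)) l) = tcost p (\<lambda>x y. s (h x) (h y)) l"
  by (induction l) auto

lemma cost_leI: "tcost p s l \<le> k \<Longrightarrow> cost_le p s (mval l) k"
  unfolding cost_le_def by blast

lemma cost_le_0: "0 \<le> k \<Longrightarrow> cost_le p s 0 k"
  unfolding cost_le_def by (rule exI[of _ "[]"]) simp

lemma cost_le_mono: "cost_le p s m k \<Longrightarrow> k \<le> k' \<Longrightarrow> cost_le p s m k'"
  unfolding cost_le_def by force

lemma cost_le_mono_fun: "cost_le p s' m k \<Longrightarrow> (\<And>x y. s x y \<le> s' x y) \<Longrightarrow> cost_le p s m k"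
  unfolding cost_le_def by (blast intro: order_trans tcost_mono)

lemma cost_le_add: "cost_le p s m k \<Longrightarrow> cost_le p s m' k' \<Longrightarrow> cost_le p s (m + m') (k + k')"
  unfolding cost_le_def by (metis add_mono mval_simps(3) tcost_simps(3))

lemma cost_le_scale: "cost_le p s m k \<Longrightarrow> cost_le p s (c *\<^sub>R m) (\<bar>c\<bar> powr p * k)"
  unfolding cost_le_def by (metis abs_ge_zero mscale(1) mult_left_mono powr_ge_zero tcost_scale)

lemma cost_le_minus: "cost_le p s m k \<Longrightarrow> cost_le p s (- m) k"
  using cost_le_scale[of p s m k "-1"] by simp

lemma cost_le_diff: "cost_le p s m k \<Longrightarrow> cost_le p s m' k' \<Longrightarrow> cost_le p s (m - m') (k + k')"
  using cost_le_add[OF _ cost_le_minus, of p s m k m' k'] by simp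

lemma cost_le_sum:
  "(\<And>i. i \<in> I \<Longrightarrow> cost_le p s (m i) (k i)) \<Longrightarrow> cost_le p s (\<Sum>i\<in>I. m i) (\<Sum>i\<in>I. k i)"
  by (induction I rule: infinite_finite_induct) (auto intro: cost_le_0 cost_le_add)

lemma cost_le_mult_fun:
  assumes "0 < c" shows "cost_le p (\<lambda>x y. c * s x y) m (c * k) \<longleftrightarrow> cost_le p s m k"
  unfolding cost_le_def tcost_mult using assms by simp

lemma cost_le_single: "cost_le p s (a *\<^sub>R (pt x - pt y)) (\<bar>a\<bar> powr p * s x y)"
  using cost_leI[of p s "[(a, x, y)]"] by simp

lemma cost_le_pt: "cost_le p s (pt x - pt y) (s x y)"
  using cost_le_single[of p s 1 x y] by simp

text \<open>It suffices to represent the image of each single edge, at a price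
  \<open>\<theta>\<close> that may differ from the cost \<open>s\<close>. With
  \<open>\<Phi> m = m - push h m\<close> this prices the displacement of a molecule by a
  map.\<close>

lemma cost_le_linear:
  assumes "linear \<Phi>" and "\<And>a x y. (a, x, y) \<in> set l \<Longrightarrow> cost_le p s (\<Phi> (pt x - pt y)) (\<theta> x y)"
  shows "cost_le p s (\<Phi> (mval l)) (tcost p \<theta> l)"
  using assms(2)
proof (induction l)
  case Nil then show ?case by (simp add: linear_0[OF assms(1)] cost_le_0)
next
  case (Cons e l)
  obtain a x y where [simp]: "e = (a, x, y)" by (cases e)
  have "cost_le p s (a *\<^sub>R \<Phi> (pt x - pt y)) (\<bar>a\<bar> powr p * \<theta> x y)"
    by (rule cost_le_scale[OF Cons.prems[of a]]) simp
  moreover have "cost_le p s (\<Phi> (mval l)) (tcost p \<theta> l)"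
  proof (rule Cons.IH)
    fix b u v assume "(b, u, v) \<in> set l"
    then show "cost_le p s (\<Phi> (pt u - pt v)) (\<theta> u v)" by (intro Cons.prems[of b]) simp
  qed
  ultimately show ?case
    using cost_le_add by (fastforce simp: linear_add[OF assms(1)] linear_scale[OF assms(1)])
qed

subsection \<open>Removing cycles from a flow\<close>

text \<open>Adding 1 for each traversed edge turns a path into a unit flow. An edge may be traversed
  repeatedly, so \<open>g\<close> can exceed 1.\<close>

lemma flow_reach:
  fixes x y :: "nat \<Rightarrow> 'a"
  assumes "(u, v) \<in> {(x j, y j) | j. j \<in> J \<and> 0 < f j}\<^sup>*" and "finite J"
  shows "\<exists>g :: nat \<Rightarrow> real. (\<forall>j. 0 \<le> g j) \<and> (\<forall>j\<in>J. 0 < g j \<longrightarrow> 0 < f j)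
     \<and> (\<Sum>j\<in>J. g j *\<^sub>R (pt (x j) - pt (y j))) = pt u - pt v"
  using assms(1)
proof (induction rule: rtrancl_induct)
  case base
  show ?case by (rule exI[of _ "\<lambda>_. 0"]) simp
next
  case (step v w)
  then obtain g j where g: "\<forall>j. 0 \<le> (g j :: real)" "\<forall>j\<in>J. 0 < g j \<longrightarrow> 0 < (f j :: 'b)"
      "(\<Sum>j\<in>J. g j *\<^sub>R (pt (x j) - pt (y j))) = pt u - pt v"
    and j: "j \<in> J" "0 < f j" "v = x j" "w = y j" by blast
  have "(\<Sum>i\<in>J. (g i + (if i = j then 1 else 0)) *\<^sub>R (pt (x i) - pt (y i)))
     = (\<Sum>i\<in>J. g i *\<^sub>R (pt (x i) - pt (y i))) + (\<Sum>i\<in>J. if i = j then pt (x i) - pt (y i) else 0)"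
    unfolding sum.distrib[symmetric] by (rule sum.cong) (auto simp: scaleR_add_left)
  also have "\<dots> = pt u - pt w" using j g(3) assms(2) by simp
  finally show ?case using g j by (intro exI[of _ "\<lambda>i. g i + (if i = j then 1 else 0)"]) auto
qed

text \<open>A flow in which no closed walk carries mass sends at most the mass of the divergence through
  each edge: the points reachable from the head of the edge form a set without outgoing edges.\<close>

lemma bounded_subflow:
  fixes x y :: "nat \<Rightarrow> 'a" and f :: "nat \<Rightarrow> real"
  assumes J: "finite J" and f: "\<And>j. j \<in> J \<Longrightarrow> 0 \<le> f j"
    and T: "\<And>U. \<bar>lin_ext (indicator U :: 'a \<Rightarrow> real) (\<Sum>j\<in>J. f j *\<^sub>R (pt (x j) - pt (y j)))\<bar> \<le> T"
  shows "\<exists>g. (\<forall>j\<in>J. 0 \<le> g j \<and> g j \<le> f j \<and> g j \<le> T)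
     \<and> (\<Sum>j\<in>J. g j *\<^sub>R (pt (x j) - pt (y j))) = (\<Sum>j\<in>J. f j *\<^sub>R (pt (x j) - pt (y j)))"
  using f T
proof (induction "card {j \<in> J. 0 < f j}" arbitrary: f rule: less_induct)
  case less
  let ?v = "\<lambda>j. pt (x j) - pt (y j)"
  show ?case
  proof (cases "\<forall>j\<in>J. f j \<le> T")
    case True
    then show ?thesis using less.prems by blast
  next
    case False
    then obtain j0 where j0: "j0 \<in> J" "f j0 > T" by force
    have T0: "0 \<le> T" using less.prems(2)[of "{}"] by linarith
    define r where "r = {(x j, y j) | j. j \<in> J \<and> 0 < f j}"
    define U where "U = {v. (y j0, v) \<in> r\<^sup>*}"
    have "x j0 \<in> U"
    proof (rule ccontr)
      assume n: "x j0 \<notin> U"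
      let ?t = "\<lambda>j. f j * (indicator U (x j) - indicator U (y j)) :: real"
      have neg: "?t j \<le> 0" if j: "j \<in> J" for j
      proof (cases "f j > 0")
        case True
        have "y j \<in> U" if "x j \<in> U"
          using that True j unfolding U_def r_def by (auto intro: rtrancl_into_rtrancl)
        then show ?thesis using True by (auto simp: indicator_def)
      next
        case False
        then show ?thesis using less.prems(1)[OF j] by simp
      qed
      have "lin_ext (indicator U) (\<Sum>j\<in>J. f j *\<^sub>R ?v j) = sum ?t J"
        by (simp add: lin_ext_linear)
      also have "\<dots> = ?t j0 + sum ?t (J - {j0})" by (rule sum.remove[OF J j0(1)])
      also have "\<dots> \<le> ?t j0" using sum_nonpos[of "J - {j0}" ?t] neg by simp
      also have "?t j0 = - f j0" using n by (simp add: U_def)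
      finally show False using less.prems(2)[of U] j0 by linarith
    qed
    then obtain g where g: "\<forall>j. 0 \<le> (g j :: real)" "\<forall>j\<in>J. 0 < g j \<longrightarrow> 0 < f j"
        "(\<Sum>j\<in>J. g j *\<^sub>R ?v j) = pt (y j0) - pt (x j0)"
      using flow_reach[OF _ J, of "y j0" "x j0" x y f] unfolding U_def r_def by blast
    \<comment> \<open>The way back from the head of the edge \<open>j0\<close> to its tail, together
      with the edge itself, is a circulation: its divergence is zero.\<close>
    define h where "h j = g j + (if j = j0 then 1 else 0)" for j
    have h0: "0 \<le> h j" for j using g(1) by (simp add: h_def)
    have hJ: "0 < f j" if "j \<in> J" "0 < h j" for j
      using that g(2) j0 T0 by (auto simp: h_def split: if_splits)
    have "(\<Sum>j\<in>J. h j *\<^sub>R ?v j) = (\<Sum>j\<in>J. g j *\<^sub>R ?v j) + (\<Sum>j\<in>J. if j = j0 then ?v j else 0)"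
      unfolding sum.distrib[symmetric] by (rule sum.cong) (auto simp: h_def scaleR_add_left)
    then have hs: "(\<Sum>j\<in>J. h j *\<^sub>R ?v j) = 0" using g(3) j0 J by simp
    define H where "H = {j \<in> J. 0 < h j}"
    have H: "finite H" "j0 \<in> H" using J j0 g(1) by (auto simp: H_def h_def add_nonneg_pos)
    \<comment> \<open>The largest multiple of the circulation whose removal leaves all weights
      nonnegative. It empties the edge \<open>j1\<close>, so fewer edges carry mass, while the
      divergence and with it \<open>T\<close> stay the same.\<close>
    define \<eta> where "\<eta> = Min ((\<lambda>j. f j / h j) ` H)"
    have "\<eta> \<in> (\<lambda>j. f j / h j) ` H" unfolding \<eta>_def using H by (intro Min_in) auto
    then obtain j1 where j1: "j1 \<in> H" "\<eta> = f j1 / h j1" by blast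
    have \<eta>: "0 \<le> \<eta>" using j1 hJ[of j1] by (auto simp: H_def)
    have \<eta>le: "\<eta> * h j \<le> f j" if "j \<in> J" for j
    proof (cases "j \<in> H")
      case True
      then have "\<eta> \<le> f j / h j" unfolding \<eta>_def using H by (intro Min_le) auto
      then show ?thesis using True by (simp add: H_def pos_le_divide_eq)
    next
      case False
      then have "h j = 0" using h0[of j] that by (auto simp: H_def)
      then show ?thesis using less.prems(1)[OF that] by simp
    qed
    define f' where "f' j = f j - \<eta> * h j" for j
    have s: "(\<Sum>j\<in>J. f' j *\<^sub>R ?v j) = (\<Sum>j\<in>J. f j *\<^sub>R ?v j)"
      using hs by (simp add: f'_def scaleR_diff_left sum_subtractf flip: scaleR_scaleR scaleR_sum_right)
    have f'f: "f' j \<le> f j" for j using \<eta> h0[of j] by (simp add: f'_def)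
    have "{j \<in> J. 0 < f' j} \<subset> {j \<in> J. 0 < f j}"
    proof (rule psubsetI)
      show "{j \<in> J. 0 < f' j} \<subseteq> {j \<in> J. 0 < f j}" using f'f by (force intro: less_le_trans)
      have "f' j1 = 0" using j1 by (auto simp: f'_def H_def)
      moreover have "j1 \<in> J" "0 < f j1" using j1 hJ by (auto simp: H_def)
      ultimately show "{j \<in> J. 0 < f' j} \<noteq> {j \<in> J. 0 < f j}" by (metis (mono_tags, lifting) less_irrefl mem_Collect_eq)
    qed
    then have "card {j \<in> J. 0 < f' j} < card {j \<in> J. 0 < f j}" using J by (intro psubset_card_mono) auto
    from less.hyps[OF this, unfolded s] \<eta>le less.prems(2)
    obtain g' where "\<forall>j\<in>J. 0 \<le> g' j \<and> g' j \<le> f' j \<and> g' j \<le> T"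
        "(\<Sum>j\<in>J. g' j *\<^sub>R ?v j) = (\<Sum>j\<in>J. f j *\<^sub>R ?v j)"
      by (auto simp: f'_def)
    then show ?thesis using f'f by (meson order_trans)
  qed
qed

section \<open>Weights from one representation, lengths from another\<close>

lemma mval_sum: "mval l = (\<Sum>j<length l. fst (l ! j) *\<^sub>R (pt (fst (snd (l ! j))) - pt (snd (snd (l ! j)))))"
  unfolding mval_def sum_list_sum_nth by (simp add: atLeast0LessThan case_prod_unfold)

lemma tcost_sum_nth: "tcost p s l = (\<Sum>j<length l. \<bar>fst (l ! j)\<bar> powr p * s (fst (snd (l ! j))) (snd (snd (l ! j))))"
  unfolding tcost_def sum_list_sum_nth by (simp add: atLeast0LessThan case_prod_unfold)

text \<open>The gauge lives on the whole type and may vanish at nonzero vectors: it will be the norm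
  of \<open>X\<close> composed with a linear projection onto \<open>X\<close>.\<close>

locale snowflake =
  fixes p q :: real and N :: "'a::real_vector \<Rightarrow> real"
  assumes p0: "0 < p" and pq: "p < q" and q1: "q \<le> 1"
    and nonneg: "0 \<le> N x" and scale: "N (a *\<^sub>R x) = \<bar>a\<bar> * N x"
    and tri: "N (x + y) powr q \<le> N x powr q + N y powr q"
begin

lemma p1: "p \<le> 1" and q0: "0 < q" using p0 pq q1 by auto

definition D :: "'a \<Rightarrow> 'a \<Rightarrow> real" where "D x y = N (x - y) powr q"

definition snow :: "'a \<Rightarrow> 'a \<Rightarrow> real" where "snow x y = D x y powr (p / q)"

abbreviation bary :: "('a, real) poly_mapping \<Rightarrow> 'a" where "bary \<equiv> lin_ext (\<lambda>x. x)"

lemma N0 [simp]: "N 0 = 0" using scale[of 0 0] by simp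

lemma N_minus: "N (- x) = N x" using scale[of "-1" x] by simp

lemma N_commute: "N (x - y) = N (y - x)" using N_minus[of "x - y"] by simp

lemma D_nonneg [simp]: "0 \<le> D x y" by (simp add: D_def)

lemma D_self [simp]: "D x x = 0" by (simp add: D_def)

lemma D_commute: "D x y = D y x" by (simp add: D_def N_commute)

lemma D_tri: "D x z \<le> D x y + D y z" using tri[of "x - y" "y - z"] by (simp add: D_def)

lemma snow_eq: "snow x y = N (x - y) powr p" using q0 by (simp add: snow_def D_def powr_powr)

lemma snow_nonneg [simp]: "0 \<le> snow x y" by (simp add: snow_def)

lemma N_sum_le: "N (\<Sum>i\<in>I. x i) powr q \<le> (\<Sum>i\<in>I. N (x i) powr q)"
proof (induction I rule: infinite_finite_induct)
  case (insert i I)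
  then show ?case using tri[of "x i" "\<Sum>i\<in>I. x i"] by simp
qed auto

text \<open>The point is that the two bounds may come from different representations of the same molecule.\<close>

lemma bary_interpolation:
  assumes eq: "mval l = mval l'" and A: "tcost p (\<lambda>_ _. 1) l \<le> A" and H: "tcost p D l' \<le> H"
  shows "N (bary (mval l)) powr q \<le> A powr (q / p - 1) * H"
proof -
  define J where "J = {..<length l'}"
  define a where "a j = fst (l' ! j)" for j
  \<comment> \<open>Edges with a negative coefficient are reversed, which makes \<open>l'\<close> a
    flow with weights \<open>\<bar>a j\<bar>\<close>; as \<open>D\<close> is symmetric, the cost
    does not change.\<close>
  define x where "x j = (if 0 \<le> a j then fst (snd (l' ! j)) else snd (snd (l' ! j)))" for j
  define y where "y j = (if 0 \<le> a j then snd (snd (l' ! j)) else fst (snd (l' ! j)))" for j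
  have ml: "mval l' = (\<Sum>j\<in>J. \<bar>a j\<bar> *\<^sub>R (pt (x j) - pt (y j)))"
    unfolding mval_sum J_def by (intro sum.cong refl) (auto simp: a_def x_def y_def algebra_simps)
  have A0: "0 \<le> A" using tcost_nonneg[of "\<lambda>_ _. 1" p l] A by simp
  have T: "\<bar>lin_ext (indicator U :: 'a \<Rightarrow> real) (mval l)\<bar> \<le> A powr (1 / p)" for U
  proof -
    have "\<bar>lin_ext (indicator U) (mval l)\<bar> powr p \<le> tcost p (\<lambda>x y. \<bar>indicator U x - indicator U y :: real\<bar> powr p) l"
      by (rule lin_ext_scalar_powr_le[OF p0 p1])
    also have "\<dots> \<le> tcost p (\<lambda>_ _. 1) l" by (rule tcost_mono) (auto simp: indicator_def)
    also note A
    finally have "(\<bar>lin_ext (indicator U :: 'a \<Rightarrow> real) (mval l)\<bar> powr p) powr (1 / p) \<le> A powr (1 / p)"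
      using p0 by (intro powr_mono2) auto
    then show ?thesis using p0 by (simp add: powr_powr)
  qed
  \<comment> \<open>The flow of \<open>l'\<close> without its cycles: edges and lengths are those of
    \<open>l'\<close>, but the cap on the weights comes from \<open>l\<close>.\<close>
  obtain g where g: "\<forall>j\<in>J. 0 \<le> g j \<and> g j \<le> \<bar>a j\<bar> \<and> g j \<le> A powr (1 / p)"
    and gs: "(\<Sum>j\<in>J. g j *\<^sub>R (pt (x j) - pt (y j))) = mval l"
    using bounded_subflow[of J "\<lambda>j. \<bar>a j\<bar>" x y "A powr (1 / p)"] T eq ml by (auto simp: J_def)
  have "bary (mval l) = (\<Sum>j\<in>J. g j *\<^sub>R (x j - y j))"
    unfolding gs[symmetric] by (simp add: lin_ext_linear)
  then have "N (bary (mval l)) powr q \<le> (\<Sum>j\<in>J. N (g j *\<^sub>R (x j - y j)) powr q)"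
    using N_sum_le by simp
  also have "\<dots> \<le> (\<Sum>j\<in>J. A powr (q / p - 1) * (\<bar>a j\<bar> powr p * D (x j) (y j)))"
  proof (rule sum_mono)
    fix j assume "j \<in> J"
    then have gj: "0 \<le> g j" "g j \<le> \<bar>a j\<bar>" "g j \<le> A powr (1 / p)" using g by auto
    \<comment> \<open>The cap is spent on the factor with exponent \<open>q - p\<close>, the
      comparison with \<open>l'\<close> on the one with exponent \<open>p\<close>.\<close>
    have "N (g j *\<^sub>R (x j - y j)) powr q = (g j powr (q - p) * g j powr p) * D (x j) (y j)"
      using gj nonneg by (simp add: scale powr_mult D_def flip: powr_add)
    also have "\<dots> \<le> ((A powr (1 / p)) powr (q - p) * \<bar>a j\<bar> powr p) * D (x j) (y j)"
      using gj pq p0 by (intro mult_right_mono mult_mono powr_mono2) auto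
    also have "(A powr (1 / p)) powr (q - p) = A powr (q / p - 1)"
      using p0 by (simp add: powr_powr field_simps)
    finally show "N (g j *\<^sub>R (x j - y j)) powr q \<le> A powr (q / p - 1) * (\<bar>a j\<bar> powr p * D (x j) (y j))"
      by (simp add: mult.assoc)
  qed
  also have "\<dots> = A powr (q / p - 1) * tcost p D l'"
    unfolding tcost_sum_nth sum_distrib_left J_def
    by (intro sum.cong refl) (auto simp: a_def x_def y_def D_commute)
  also have "\<dots> \<le> A powr (q / p - 1) * H" using H by (intro mult_left_mono) auto
  finally show ?thesis .
qed

end

subsection \<open>Almost disjoint tests\<close>

text \<open>Greedy choice in a directed graph with out-degrees at most \<open>d\<close>. In-degrees
  have the same average, so some vertex has in-degree at most \<open>d\<close>; keeping it uses up
  itself and its neighbours, at most \<open>2 * d + 1\<close> vertices.\<close>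

lemma independent_subset:
  fixes bad :: "'i \<Rightarrow> 'i \<Rightarrow> bool"
  assumes "finite V" and "\<And>k. k \<in> V \<Longrightarrow> card {i \<in> V. bad k i} \<le> d" and "n * (2 * d + 1) \<le> card V"
  shows "\<exists>I\<subseteq>V. card I = n \<and> (\<forall>k\<in>I. \<forall>i\<in>I. k \<noteq> i \<longrightarrow> \<not> bad k i)"
  using assms
proof (induction n arbitrary: V)
  case 0
  then show ?case by (intro exI[of _ "{}"]) simp
next
  case (Suc n)
  note V = Suc.prems(1) and out = Suc.prems(2)
  have V0: "card V > 0" using Suc.prems(3) by (cases "card V") auto
  have "\<exists>v\<in>V. card {k \<in> V. bad k v} \<le> d"
  proof (rule ccontr)
    assume "\<not> ?thesis"
    then have in_ge: "card {k \<in> V. bad k v} \<ge> d + 1" if "v \<in> V" for v using that by force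
    have "card V * (d + 1) \<le> (\<Sum>v\<in>V. card {k \<in> V. bad k v})"
      using sum_mono[of V "\<lambda>_. d + 1"] in_ge by simp
    also have "\<dots> = (\<Sum>k\<in>V. card {v \<in> V. bad k v})"
      using sum_multicount_gen[OF V V, of "\<lambda>v k. bad k v"] by simp
    also have "\<dots> \<le> card V * d" using sum_mono[of V _ "\<lambda>_. d"] out by simp
    finally show False using V0 by simp
  qed
  then obtain v where v: "v \<in> V" "card {k \<in> V. bad k v} \<le> d" by blast
  define W where "W = insert v ({i \<in> V. bad v i} \<union> {k \<in> V. bad k v})"
  have W: "finite W" "W \<subseteq> V" using V v by (auto simp: W_def)
  have "card W \<le> Suc (card ({i \<in> V. bad v i} \<union> {k \<in> V. bad k v}))"
    unfolding W_def by (rule card_insert_le_m1) auto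
  also have "\<dots> \<le> Suc (card {i \<in> V. bad v i} + card {k \<in> V. bad k v})" by (simp add: card_Un_le)
  also have "\<dots> \<le> 2 * d + 1" using out[OF v(1)] v(2) by simp
  finally have cW: "card W \<le> 2 * d + 1" .
  have "n * (2 * d + 1) \<le> card (V - W)"
    using Suc.prems(3) cW W V by (simp add: card_Diff_subset)
  moreover have "card {i \<in> V - W. bad k i} \<le> d" if "k \<in> V - W" for k
    using order_trans[OF card_mono out[of k], of "{i \<in> V - W. bad k i}"] that V by auto
  ultimately obtain I where I: "I \<subseteq> V - W" "card I = n" "\<forall>k\<in>I. \<forall>i\<in>I. k \<noteq> i \<longrightarrow> \<not> bad k i"
    using Suc.IH[of "V - W"] V by auto
  have "v \<notin> I" "finite I" using I V by (auto simp: W_def intro: finite_subset)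
  moreover have "\<not> bad v i \<and> \<not> bad i v" if "i \<in> I" for i using I(1) that by (auto simp: W_def)
  ultimately show ?case using I v by (intro exI[of _ "insert v I"]) auto
qed

text \<open>The relation \<open>G x e m\<close> says that the molecule \<open>m\<close> approximates the lifting of \<open>x\<close> up to \<open>e\<close>;
  it replaces the elements of the free space by molecules.\<close>

locale approximate_lifting = snowflake p q N for p q and N :: "'a::real_vector \<Rightarrow> real" +
  fixes G :: "'a \<Rightarrow> real \<Rightarrow> ('a, real) poly_mapping \<Rightarrow> bool" and K B :: real
  assumes K0: "0 \<le> K" and B0: "0 < B"
    and G_ex: "0 < e \<Longrightarrow> \<exists>m. G x e m"
    and G_mono: "G x e m \<Longrightarrow> e \<le> e' \<Longrightarrow> G x e' m"
    and G_add: "G x e m \<Longrightarrow> G y e' m' \<Longrightarrow> G (x + y) (e + e') (m + m')"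
    and G_scale: "G x e m \<Longrightarrow> G (a *\<^sub>R x) (\<bar>a\<bar> powr p * e) (a *\<^sub>R m)"
    and G_cost: "G x e m \<Longrightarrow> 0 < e \<Longrightarrow> cost_le p snow m (K * N x powr p + 2 * e)"
    and G_bary: "G x e m \<Longrightarrow> N (bary m - x) powr p \<le> B * e"
begin

lemma G_sum:
  assumes "\<And>i. i \<in> I \<Longrightarrow> G (x i) (e i) (m i)"
  shows "G (\<Sum>i\<in>I. x i) (\<Sum>i\<in>I. e i) (\<Sum>i\<in>I. m i)"
proof -
  obtain m0 where "G 0 1 m0" using G_ex[of 1 0] by auto
  from G_scale[OF this, of 0] p0 have "G 0 0 0" by simp
  then show ?thesis using assms
    by (induction I rule: infinite_finite_induct) (auto intro: G_add)
qed

lemma N_sum_powr_le: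
  assumes "finite I" "\<And>i. i \<in> I \<Longrightarrow> N (x i) = 1"
  shows "N (\<Sum>i\<in>I. x i) powr p \<le> real (card I) powr (p / q)"
proof -
  have "N (\<Sum>i\<in>I. x i) powr q \<le> (\<Sum>i\<in>I. N (x i) powr q)" by (rule N_sum_le)
  also have "\<dots> = real (card I)" using assms by simp
  finally have "(N (\<Sum>i\<in>I. x i) powr q) powr (p / q) \<le> real (card I) powr (p / q)"
    using p0 q0 by (intro powr_mono2) auto
  then show ?thesis using q0 by (simp add: powr_powr)
qed

text \<open>Disjointification as in Rosenthal's lemma: the tests \<open>s i\<close> share the cost of each \<open>m k\<close>, so many of
  them hardly see the other molecules. The cost of a sum of \<open>n\<close> molecules then grows linearly in \<open>n\<close>,
  while the \<open>q\<close>-triangle inequality bounds it by a multiple of \<open>n powr (p / q)\<close>.\<close>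

lemma no_disjoint_tests:
  assumes c: "0 < c" and C: "0 < C"
    and fam: "\<And>(M :: nat) e. 0 < e \<Longrightarrow> \<exists>x m s. (\<forall>i<M. N (x i) = 1 \<and> G (x i) e (m i)
        \<and> \<not> cost_le p (s i) (m i) c \<and> (\<forall>u v. 0 \<le> s i u v)) \<and> (\<forall>u v. (\<Sum>i<M. s i u v) \<le> C * snow u v)"
  shows False
proof -
  define \<alpha> where "\<alpha> = p / q"
  have \<alpha>: "0 < \<alpha>" "\<alpha> < 1" using p0 pq q0 by (auto simp: \<alpha>_def)
  \<comment> \<open>So large that \<open>C\<close> times the cost
    \<open>K * n powr \<alpha> + 2\<close> of a sum of \<open>n\<close> molecules stays below
    \<open>c * n / 2\<close>; this is possible because \<open>\<alpha> < 1\<close>.\<close>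
  obtain n :: nat where n: "real n > max ((4 * C * K / c) powr (1 / (1 - \<alpha>))) (max (8 * C / c) 1)"
    using reals_Archimedean2 by blast
  then have n1: "real n \<ge> 1" and n2: "8 * C / c < real n" and n3: "(4 * C * K / c) powr (1 / (1 - \<alpha>)) < real n"
    by auto
  have "4 * C * K / c \<le> real n powr (1 - \<alpha>)"
  proof -
    have "((4 * C * K / c) powr (1 / (1 - \<alpha>))) powr (1 - \<alpha>) \<le> real n powr (1 - \<alpha>)"
      using n3 \<alpha> by (intro powr_mono2) auto
    then show ?thesis using \<alpha> C K0 c by (simp add: powr_powr)
  qed
  then have "4 * C * K / c * real n powr \<alpha> \<le> real n powr (1 - \<alpha>) * real n powr \<alpha>"
    by (intro mult_right_mono) auto
  also have "\<dots> = real n" using n1 by (simp flip: powr_add)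
  finally have 1: "C * K * real n powr \<alpha> \<le> c * real n / 4" using c by (simp add: field_simps)
  have 2: "C * 2 < c * real n / 4" using n2 c by (simp add: field_simps)
  \<comment> \<open>\<open>n\<close> interferences of size \<open>\<delta>\<close> add up to
    \<open>c / 2\<close>. A molecule has cost at most \<open>K + 2\<close>, shared by the tests up
    to the factor \<open>C\<close>, so at most \<open>d\<close> of them charge it more than
    \<open>\<delta>\<close>.\<close>
  define \<delta> where "\<delta> = c / (2 * real n)"
  have \<delta>: "0 < \<delta>" using c n1 by (simp add: \<delta>_def)
  define d where "d = nat \<lceil>C * (K + 2) / \<delta>\<rceil>"
  define M where "M = n * (2 * d + 1)"
  \<comment> \<open>The errors of \<open>n\<close> summands then add up to 1.\<close>
  define e where "e = 1 / real n"
  have e: "0 < e" "e \<le> 1" using n1 by (auto simp: e_def)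
  obtain x m s where *: "(\<forall>i<M. N (x i) = 1 \<and> G (x i) e (m i)
        \<and> \<not> cost_le p (s i) (m i) c \<and> (\<forall>u v. 0 \<le> s i u v)) \<and> (\<forall>u v. (\<Sum>i<M. s i u v) \<le> C * snow u v)"
    using fam[OF e(1), of M] by blast
  then have x: "N (x i) = 1" and g: "G (x i) e (m i)" and t: "\<not> cost_le p (s i) (m i) c"
      and s0: "0 \<le> s i u v" if "i < M" for i u v using that by auto
  have s: "(\<Sum>i<M. s i u v) \<le> C * snow u v" for u v using * by blast
  have share: "(\<Sum>i<M. tcost p (s i) l) \<le> C * tcost p snow l" for l
    unfolding tcost_sum[symmetric] tcost_mult[symmetric] by (rule tcost_mono) (rule s)
  have s_nn: "0 \<le> tcost p (s i) l" if "i < M" for i l using s0 that by (intro tcost_nonneg) auto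
  define bad where "bad k i \<longleftrightarrow> \<not> cost_le p (s i) (m k) \<delta>" for k i
  have out: "card {i \<in> {..<M}. bad k i} \<le> d" if "k \<in> {..<M}" for k
  proof -
    have k: "k < M" using that by simp
    obtain l where l: "mval l = m k" "tcost p snow l \<le> K * N (x k) powr p + 2 * e"
      using G_cost[OF g[OF k] e(1)] unfolding cost_le_def by blast
    have "tcost p snow l \<le> K + 2" using l(2) x[OF k] e by simp
    then have "C * tcost p snow l \<le> C * (K + 2)" using C by simp
    then have T: "(\<Sum>i<M. tcost p (s i) l) \<le> C * (K + 2)" using share[of l] by simp
    let ?S = "{i \<in> {..<M}. bad k i}"
    have "real (card ?S) * \<delta> = (\<Sum>i\<in>?S. \<delta>)" by simp
    also have "\<dots> \<le> (\<Sum>i\<in>?S. tcost p (s i) l)"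
    proof (rule sum_mono)
      fix i assume "i \<in> ?S"
      then show "\<delta> \<le> tcost p (s i) l" using cost_leI[of p "s i" l \<delta>] l(1) by (force simp: bad_def)
    qed
    also have "\<dots> \<le> (\<Sum>i<M. tcost p (s i) l)" using s_nn by (intro sum_mono2) auto
    also note T
    finally have "real (card ?S) \<le> C * (K + 2) / \<delta>" using \<delta> by (simp add: pos_le_divide_eq)
    then show ?thesis unfolding d_def by linarith
  qed
  obtain I where I: "I \<subseteq> {..<M}" "card I = n" "\<forall>k\<in>I. \<forall>i\<in>I. k \<noteq> i \<longrightarrow> \<not> bad k i"
    using independent_subset[of "{..<M}" bad d n] out by (auto simp: M_def)
  have fI: "finite I" using I(1) finite_subset by blast
  have xI: "N (x i) = 1" if "i \<in> I" for i using x I(1) that by blast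
  have "G (\<Sum>i\<in>I. x i) (\<Sum>i\<in>I. e) (\<Sum>i\<in>I. m i)" using I(1) g by (intro G_sum) auto
  moreover have "(\<Sum>i\<in>I. e) = 1" using I(2) n1 by (simp add: e_def)
  ultimately have "cost_le p snow (\<Sum>i\<in>I. m i) (K * N (\<Sum>i\<in>I. x i) powr p + 2)"
    using G_cost[of _ 1] by simp
  moreover have "K * N (\<Sum>i\<in>I. x i) powr p \<le> K * real n powr \<alpha>"
    using N_sum_powr_le[OF fI xI] I(2) K0 by (intro mult_left_mono) (auto simp: \<alpha>_def)
  ultimately obtain l where l: "mval l = (\<Sum>i\<in>I. m i)" "tcost p snow l \<le> K * real n powr \<alpha> + 2"
    unfolding cost_le_def by force
  have "(\<Sum>i\<in>I. tcost p (s i) l) \<le> (\<Sum>i<M. tcost p (s i) l)"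
    using I(1) s_nn by (intro sum_mono2) auto
  also have "\<dots> \<le> C * tcost p snow l" by (rule share)
  also have "\<dots> \<le> C * (K * real n powr \<alpha> + 2)" using l(2) C by (intro mult_left_mono) auto
  also have "\<dots> < c * real n / 2" using 1 2 by (simp add: algebra_simps)
  also have "\<dots> = (\<Sum>i\<in>I. c / 2)" using I(2) by simp
  \<comment> \<open>One test charges the sum less than \<open>c / 2\<close>. Subtracting the other
    molecules, which it hardly sees, leaves \<open>m i\<close> at cost at most \<open>c\<close>,
    against its choice.\<close>
  finally obtain i where i: "i \<in> I" "tcost p (s i) l < c / 2"
    by (meson not_le sum_mono)
  have "cost_le p (s i) (\<Sum>k\<in>I - {i}. m k) (\<Sum>k\<in>I - {i}. \<delta>)"
    using I(3) i(1) by (intro cost_le_sum) (auto simp: bad_def)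
  then have "cost_le p (s i) ((\<Sum>k\<in>I. m k) - (\<Sum>k\<in>I - {i}. m k)) (c / 2 + (\<Sum>k\<in>I - {i}. \<delta>))"
    using cost_leI[of p "s i" l "c / 2"] i(2) l(1) by (intro cost_le_diff) auto
  moreover have "(\<Sum>k\<in>I. m k) - (\<Sum>k\<in>I - {i}. m k) = m i"
    using sum.remove[OF fI i(1), of m] by simp
  moreover have "c / 2 + (\<Sum>k\<in>I - {i}. \<delta>) \<le> c"
  proof -
    have "(\<Sum>k\<in>I - {i}. \<delta>) \<le> (\<Sum>k\<in>I. \<delta>)" using \<delta> fI by (intro sum_mono2) auto
    also have "\<dots> = c / 2" using I(2) n1 by (simp add: \<delta>_def)
    finally show ?thesis by simp
  qed
  ultimately have "cost_le p (s i) (m i) c" using cost_le_mono[of p "s i" "m i"] by simp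
  then show False using t[of i] i(1) I(1) by blast
qed

end

subsection \<open>Detection at a dyadic scale\<close>

lemma sum_inj_geometric_le:
  fixes \<theta> :: real
  assumes "0 \<le> \<theta>" "\<theta> < 1" "finite I" "inj_on f I"
  shows "(\<Sum>k\<in>I. \<theta> ^ f k) \<le> 1 / (1 - \<theta>)"
proof -
  have "(\<Sum>k\<in>I. \<theta> ^ f k) = (\<Sum>n\<in>f ` I. \<theta> ^ n)" using assms(4) by (simp add: sum.reindex)
  also have "\<dots> \<le> suminf (\<lambda>n. \<theta> ^ n)"
    using assms by (intro sum_le_suminf summable_geometric) auto
  also have "\<dots> = 1 / (1 - \<theta>)" using assms by (intro suminf_geometric) auto
  finally show ?thesis .
qed

lemma eventually_two_powr_less:
  assumes "0 < \<gamma>" "0 < \<epsilon>"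
  shows "\<forall>\<^sub>F n in sequentially. 2 powr (- \<gamma> * real n) < \<epsilon>"
proof -
  have "2 powr (- \<gamma>) < (1 :: real)" using powr_less_mono[of "- \<gamma>" 0 "2 :: real"] assms(1) by simp
  then have "(\<lambda>n. (2 powr (- \<gamma>)) ^ n) \<longlonglongrightarrow> (0 :: real)" by (intro LIMSEQ_power_zero) simp
  then have "\<forall>\<^sub>F n in sequentially. (2 powr (- \<gamma>)) ^ n < \<epsilon>" using assms(2) by (rule order_tendstoD)
  moreover have "(2 powr (- \<gamma>)) ^ n = 2 powr (- \<gamma> * real n)" for n
    by (simp add: powr_powr flip: powr_realpow)
  ultimately show ?thesis by simp
qed

context snowflake
begin

text \<open>The factor makes \<open>psi k\<close> agree with \<open>snow\<close> where
  \<open>D x y\<close> equals \<open>2 powr k\<close>. For a fixed pair the values decay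
  geometrically as \<open>k\<close> moves away from that scale in either direction.\<close>

definition psi :: "int \<Rightarrow> 'a \<Rightarrow> 'a \<Rightarrow> real" where
  "psi k x y = 2 powr (real_of_int k * (p / q - 1)) * min (D x y) (2 powr real_of_int k)"

definition psi_const :: real where
  "psi_const = 1 / (1 - 2 powr - (p / q)) + 1 / (1 - 2 powr - (1 - p / q))"

lemma exponent: "0 < p / q" "p / q < 1" using p0 pq q0 by auto

lemma psi_nonneg [simp]: "0 \<le> psi k x y" by (simp add: psi_def)

lemma psi_const_pos: "0 < psi_const"
proof -
  have "2 powr - (p / q) < (1 :: real)" "2 powr - (1 - p / q) < (1 :: real)"
    using powr_less_mono[of "- (p / q)" 0 "2 :: real"] powr_less_mono[of "- (1 - p / q)" 0 "2 :: real"] exponent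
    by auto
  then show ?thesis unfolding psi_const_def by (intro add_pos_pos divide_pos_pos) auto
qed

lemma psi_le_low: "psi k x y \<le> 2 powr (real_of_int k * (p / q))"
proof -
  have "psi k x y \<le> 2 powr (real_of_int k * (p / q - 1)) * 2 powr real_of_int k"
    unfolding psi_def by (intro mult_left_mono) auto
  also have "\<dots> = 2 powr (real_of_int k * (p / q))" by (simp add: algebra_simps flip: powr_add)
  finally show ?thesis .
qed

lemma psi_le_high: "psi k x y \<le> 2 powr (real_of_int k * (p / q - 1)) * D x y"
  unfolding psi_def by (intro mult_left_mono) auto

text \<open>The scales up to that of \<open>D x y\<close> form a geometric series of ratio
  \<open>2 powr - (p / q)\<close>, the larger ones a series of ratio
  \<open>2 powr - (1 - p / q)\<close>; \<open>psi_const\<close> is the sum of both.\<close>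

lemma sum_psi_le:
  assumes I: "finite I" shows "(\<Sum>k\<in>I. psi k x y) \<le> psi_const * snow x y"
proof (cases "D x y = 0")
  case True
  then show ?thesis by (simp add: psi_def snow_def)
next
  case False
  then have D: "D x y > 0" using D_nonneg[of x y] by linarith
  let ?\<alpha> = "p / q"
  note \<alpha> = exponent
  define j where "j = \<lfloor>log 2 (D x y)\<rfloor>"
  have "real_of_int j \<le> log 2 (D x y)" "log 2 (D x y) < real_of_int j + 1" unfolding j_def by linarith+
  then have j: "2 powr real_of_int j \<le> D x y" "D x y < 2 powr (real_of_int j + 1)"
    using D by (auto simp: le_log_iff log_less_iff)
  have th: "2 powr - ?\<alpha> < (1 :: real)" "2 powr - (1 - ?\<alpha>) < (1 :: real)"
    using powr_less_mono[of "- ?\<alpha>" 0 "2 :: real"] powr_less_mono[of "- (1 - ?\<alpha>)" 0 "2 :: real"] \<alpha> by auto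
  have low: "psi k x y \<le> snow x y * (2 powr - ?\<alpha>) ^ nat (j - k)" if "k \<le> j" for k
  proof -
    have "psi k x y \<le> 2 powr (real_of_int k * ?\<alpha>)" by (rule psi_le_low)
    also have "\<dots> = (2 powr real_of_int j) powr ?\<alpha> * (2 powr - ?\<alpha>) ^ nat (j - k)"
      using that by (simp add: powr_powr algebra_simps flip: powr_realpow powr_add)
    also have "\<dots> \<le> snow x y * (2 powr - ?\<alpha>) ^ nat (j - k)"
      unfolding snow_def using j(1) \<alpha> by (intro mult_right_mono powr_mono2) auto
    finally show ?thesis .
  qed
  \<comment> \<open>Here \<open>D x y\<close> is only known to be below
    \<open>2 powr (j + 1)\<close>, hence the shift by one in the exponent.\<close>
  have high: "psi k x y \<le> snow x y * (2 powr - (1 - ?\<alpha>)) ^ nat (k - j - 1)" if "j < k" for k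
  proof -
    have "psi k x y \<le> 2 powr (real_of_int k * (?\<alpha> - 1)) * D x y" by (rule psi_le_high)
    also have "D x y = snow x y * D x y powr (1 - ?\<alpha>)" using D by (simp add: snow_def flip: powr_add)
    also have "D x y powr (1 - ?\<alpha>) \<le> (2 powr (real_of_int j + 1)) powr (1 - ?\<alpha>)"
      using j(2) \<alpha> by (intro powr_mono2) auto
    also have "2 powr (real_of_int k * (?\<alpha> - 1)) * (snow x y * (2 powr (real_of_int j + 1)) powr (1 - ?\<alpha>))
        = snow x y * (2 powr (real_of_int k * (?\<alpha> - 1)) * (2 powr (real_of_int j + 1)) powr (1 - ?\<alpha>))"
      by (simp add: mult_ac)
    also have "2 powr (real_of_int k * (?\<alpha> - 1)) * (2 powr (real_of_int j + 1)) powr (1 - ?\<alpha>)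
        = (2 powr - (1 - ?\<alpha>)) ^ nat (k - j - 1)"
      using that by (simp add: powr_powr algebra_simps flip: powr_realpow powr_add)
    finally show ?thesis by (simp add: mult_left_mono)
  qed
  let ?L = "{k \<in> I. k \<le> j}" and ?H = "{k \<in> I. j < k}"
  have "(\<Sum>k\<in>I. psi k x y) = (\<Sum>k\<in>?L. psi k x y) + (\<Sum>k\<in>?H. psi k x y)"
    using I by (subst sum.union_disjoint[symmetric]) (auto intro!: sum.cong)
  also have "(\<Sum>k\<in>?L. psi k x y) \<le> (\<Sum>k\<in>?L. snow x y * (2 powr - ?\<alpha>) ^ nat (j - k))"
    using low by (intro sum_mono) auto
  also have "\<dots> \<le> snow x y * (1 / (1 - 2 powr - ?\<alpha>))"
    unfolding sum_distrib_left[symmetric] using th I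
    by (intro mult_left_mono sum_inj_geometric_le) (auto simp: inj_on_def)
  also have "(\<Sum>k\<in>?H. psi k x y) \<le> (\<Sum>k\<in>?H. snow x y * (2 powr - (1 - ?\<alpha>)) ^ nat (k - j - 1))"
    using high by (intro sum_mono) auto
  also have "\<dots> \<le> snow x y * (1 / (1 - 2 powr - (1 - ?\<alpha>)))"
    unfolding sum_distrib_left[symmetric] using th I
    by (intro mult_left_mono sum_inj_geometric_le) (auto simp: inj_on_def)
  finally show ?thesis by (simp add: psi_const_def algebra_simps)
qed

text \<open>Coefficients enter with the power \<open>q\<close>, so this is no bound by the cost of a
  molecule. It serves to discard edges with \<open>D x y = 0\<close>.\<close>

lemma N_bary_le: "N (bary (mval l)) powr q \<le> tcost q D l"
proof (induction l)
  case Nil then show ?case by (simp add: lin_ext_linear)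
next
  case (Cons e l)
  obtain a x y where [simp]: "e = (a, x, y)" by (cases e)
  have "N (bary (mval (e # l))) powr q \<le> N (a *\<^sub>R (x - y)) powr q + N (bary (mval l)) powr q"
    using tri[of "a *\<^sub>R (x - y)" "bary (mval l)"] by (simp add: lin_ext_linear)
  then show ?case using Cons.IH nonneg by (simp add: scale powr_mult D_def)
qed

text \<open>Split a representation that is good at scale \<open>2 ^ k\<close> into its long and its short edges. The
  difference of the long parts at consecutive scales is also a difference of short parts, so that
  its barycenter is controlled by interpolation.\<close>

lemma detection:
  assumes L: "tcost p snow l \<le> L" and \<kappa>: "0 < \<kappa>" and small: "\<And>k. cost_le p (psi k) (mval l) \<kappa>"
  shows "N (bary (mval l)) powr q \<le> 4 * (2 * \<kappa>) powr (q / p - 1) * psi_const * L"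
proof -
  let ?\<alpha> = "p / q"
  note \<alpha> = exponent
  \<comment> \<open>At extreme scales \<open>l\<close> itself is already cheap, and all its edges of
    nonzero length lie in between. The telescoping sum over scales is therefore finite.\<close>
  have ex: "\<exists>n::nat. (\<forall>e\<in>set l. case e of (a, x, y) \<Rightarrow> D x y < 2 powr real n)
     \<and> (\<forall>e\<in>set l. case e of (a, x, y) \<Rightarrow> D x y = 0 \<or> 2 powr - real n \<le> D x y)
     \<and> tcost p (psi (int n)) l \<le> \<kappa> \<and> tcost p (psi (- int n)) l \<le> \<kappa>"
  proof -
    have 1: "\<forall>\<^sub>F n in sequentially. D x y < 2 powr real n" for x y
    proof -
      have "\<forall>\<^sub>F n in sequentially. 2 powr (- 1 * real n) < 1 / (D x y + 1)"
        using D_nonneg[of x y] by (intro eventually_two_powr_less) (auto intro: add_nonneg_pos)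
      then show ?thesis
      proof eventually_elim
        case (elim n)
        moreover have "0 < D x y + 1" using D_nonneg[of x y] by linarith
        ultimately have "D x y + 1 < 2 powr real n" by (simp add: powr_minus field_simps)
        then show ?case by simp
      qed
    qed
    have 2: "\<forall>\<^sub>F n in sequentially. D x y = 0 \<or> 2 powr - real n \<le> D x y" for x y
    proof (cases "D x y = 0")
      case False
      then have "\<forall>\<^sub>F n in sequentially. 2 powr (- 1 * real n) < D x y"
        using D_nonneg[of x y] by (intro eventually_two_powr_less) linarith+
      then show ?thesis by (rule eventually_mono) simp
    qed simp
    have 3: "\<forall>\<^sub>F n in sequentially. tcost p (psi (int n)) l \<le> \<kappa>"
    proof -
      define c where "c = tcost p D l"
      have c: "0 \<le> c" unfolding c_def by (rule tcost_nonneg) simp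
      have "\<forall>\<^sub>F n in sequentially. 2 powr (- (1 - ?\<alpha>) * real n) < \<kappa> / (c + 1)"
        using \<alpha> \<kappa> c by (intro eventually_two_powr_less) auto
      then show ?thesis
      proof eventually_elim
        case (elim n)
        have "tcost p (psi (int n)) l \<le> 2 powr (- (1 - ?\<alpha>) * real n) * c"
          unfolding c_def tcost_mult[symmetric] using psi_le_high[of "int n"]
          by (intro tcost_mono) (simp add: algebra_simps)
        also have "\<dots> \<le> \<kappa> / (c + 1) * c" using elim c by (intro mult_right_mono) auto
        also have "\<dots> \<le> \<kappa>" using \<kappa> c by (simp add: field_simps)
        finally show ?case .
      qed
    qed
    have 4: "\<forall>\<^sub>F n in sequentially. tcost p (psi (- int n)) l \<le> \<kappa>"
    proof -
      define c where "c = tcost p (\<lambda>_ _. 1) l"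
      have c: "0 \<le> c" unfolding c_def by (rule tcost_nonneg) simp
      have "\<forall>\<^sub>F n in sequentially. 2 powr (- ?\<alpha> * real n) < \<kappa> / (c + 1)"
        using \<alpha> \<kappa> c by (intro eventually_two_powr_less) auto
      then show ?thesis
      proof eventually_elim
        case (elim n)
        have "tcost p (psi (- int n)) l \<le> 2 powr (- ?\<alpha> * real n) * c"
          unfolding c_def tcost_mult[symmetric] using psi_le_low[of "- int n"]
          by (intro tcost_mono) (simp add: algebra_simps)
        also have "\<dots> \<le> \<kappa> / (c + 1) * c" using elim c by (intro mult_right_mono) auto
        also have "\<dots> \<le> \<kappa>" using \<kappa> c by (simp add: field_simps)
        finally show ?case .
      qed
    qed
    have "\<forall>\<^sub>F n in sequentially. (\<forall>e\<in>set l. case e of (a, x, y) \<Rightarrow> D x y < 2 powr real n)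
     \<and> (\<forall>e\<in>set l. case e of (a, x, y) \<Rightarrow> D x y = 0 \<or> 2 powr - real n \<le> D x y)
     \<and> tcost p (psi (int n)) l \<le> \<kappa> \<and> tcost p (psi (- int n)) l \<le> \<kappa>"
      using 1 2 3 4 by (intro eventually_conj eventually_ball_finite) (auto split: prod.split)
    then show ?thesis using eventually_happens' sequentially_bot by blast
  qed
  then obtain n :: nat where far: "\<And>a x y. (a, x, y) \<in> set l \<Longrightarrow> D x y < 2 powr real n"
    and near: "\<And>a x y. (a, x, y) \<in> set l \<Longrightarrow> D x y = 0 \<or> 2 powr - real n \<le> D x y"
    and ends: "tcost p (psi (int n)) l \<le> \<kappa>" "tcost p (psi (- int n)) l \<le> \<kappa>" by fastforce
  \<comment> \<open>Keeping \<open>l\<close> where it is cheap enough ensures that no scale costs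
    more than it does for \<open>l\<close>, so the costs are summable over \<open>k\<close>; it also
    fixes both ends of the telescoping sum.\<close>
  have "\<exists>R. mval R = mval l \<and> tcost p (psi k) R \<le> \<kappa> \<and> tcost p (psi k) R \<le> tcost p (psi k) l
      \<and> (tcost p (psi k) l \<le> \<kappa> \<longrightarrow> R = l)" for k
  proof (cases "tcost p (psi k) l \<le> \<kappa>")
    case False
    then show ?thesis using small[of k] unfolding cost_le_def by force
  qed blast
  then obtain R where R: "\<And>k. mval (R k) = mval l" "\<And>k. tcost p (psi k) (R k) \<le> \<kappa>"
    "\<And>k. tcost p (psi k) (R k) \<le> tcost p (psi k) l" "\<And>k. tcost p (psi k) l \<le> \<kappa> \<Longrightarrow> R k = l"
    by metis
  define c where "c k = tcost p (psi k) (R k)" for k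
  have c0: "0 \<le> c k" for k unfolding c_def by (rule tcost_nonneg) simp
  define long where "long k = filter (\<lambda>(a, x, y). 2 powr real_of_int k \<le> D x y) (R k)" for k
  define short where "short k = filter (\<lambda>e. \<not> (case e of (a, x, y) \<Rightarrow> 2 powr real_of_int k \<le> D x y)) (R k)" for k
  have ls: "mval (long k) + mval (short k) = mval l" for k
    unfolding long_def short_def mval_filter by (rule R)
  have clong: "tcost p (\<lambda>_ _. 1) (long k) \<le> 2 powr - (real_of_int k * ?\<alpha>) * c k" for k
  proof -
    have "tcost p (\<lambda>_ _. 1) (long k) \<le> tcost p (\<lambda>x y. 2 powr - (real_of_int k * ?\<alpha>) * psi k x y) (long k)"
    proof (rule tcost_mono)
      fix a x y assume "(a, x, y) \<in> set (long k)"
      then have "min (D x y) (2 powr real_of_int k) = 2 powr real_of_int k" by (auto simp: long_def)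
      then show "1 \<le> 2 powr - (real_of_int k * ?\<alpha>) * psi k x y"
        by (simp add: psi_def algebra_simps flip: powr_add)
    qed
    also have "\<dots> \<le> 2 powr - (real_of_int k * ?\<alpha>) * c k"
      unfolding tcost_mult c_def long_def by (intro mult_left_mono tcost_filter_le) auto
    finally show ?thesis .
  qed
  have cshort: "tcost p D (short k) \<le> 2 powr (real_of_int k * (1 - ?\<alpha>)) * c k" for k
  proof -
    have "tcost p D (short k) \<le> tcost p (\<lambda>x y. 2 powr (real_of_int k * (1 - ?\<alpha>)) * psi k x y) (short k)"
    proof (rule tcost_mono)
      fix a x y assume "(a, x, y) \<in> set (short k)"
      then have "min (D x y) (2 powr real_of_int k) = D x y" by (auto simp: short_def)
      then have "2 powr (real_of_int k * (1 - ?\<alpha>)) * psi k x y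
          = (2 powr (real_of_int k * (1 - ?\<alpha>)) * 2 powr (real_of_int k * (?\<alpha> - 1))) * D x y"
        by (simp add: psi_def mult_ac)
      also have "\<dots> = D x y" by (simp add: algebra_simps flip: powr_add)
      finally show "D x y \<le> 2 powr (real_of_int k * (1 - ?\<alpha>)) * psi k x y" by simp
    qed
    also have "\<dots> \<le> 2 powr (real_of_int k * (1 - ?\<alpha>)) * c k"
      unfolding tcost_mult c_def short_def by (intro mult_left_mono tcost_filter_le) auto
    finally show ?thesis .
  qed
  have step: "N (bary (mval (long k) - mval (long (k + 1)))) powr q
      \<le> 2 * (2 * \<kappa>) powr (q / p - 1) * (c k + c (k + 1))" for k
  proof -
    define neg where "neg = map (\<lambda>(a :: real, xy :: 'a \<times> 'a). (- 1 * a, xy))"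
    have neg: "mval (neg r) = - mval r" "tcost p s (neg r) = tcost p s r" for r s
      unfolding neg_def mscale(1) tcost_scale by simp_all
    let ?l1 = "long k @ neg (long (k + 1))" and ?l2 = "short (k + 1) @ neg (short k)"
    have eq: "mval ?l1 = mval ?l2" using ls[of k] ls[of "k + 1"] by (simp add: neg algebra_simps)
    define A where "A = 2 powr - (real_of_int k * ?\<alpha>) * (c k + c (k + 1))"
    define H where "H = 2 * 2 powr (real_of_int k * (1 - ?\<alpha>)) * (c k + c (k + 1))"
    have "tcost p (\<lambda>_ _. 1) (long (k + 1)) \<le> 2 powr - (real_of_int (k + 1) * ?\<alpha>) * c (k + 1)"
      by (rule clong)
    also have "\<dots> \<le> 2 powr - (real_of_int k * ?\<alpha>) * c (k + 1)"
      using \<alpha> c0 by (intro mult_right_mono powr_mono) (auto simp: algebra_simps)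
    finally have A: "tcost p (\<lambda>_ _. 1) ?l1 \<le> A"
      using clong[of k] by (simp add: neg A_def algebra_simps)
    have e1: "2 powr (real_of_int (k + 1) * (1 - ?\<alpha>)) \<le> 2 * 2 powr (real_of_int k * (1 - ?\<alpha>))"
    proof -
      have "2 powr (real_of_int (k + 1) * (1 - ?\<alpha>)) \<le> 2 powr (1 + real_of_int k * (1 - ?\<alpha>))"
        using \<alpha> by (intro powr_mono) (auto simp: algebra_simps)
      then show ?thesis by (simp add: powr_add)
    qed
    have "tcost p D ?l2 \<le> 2 powr (real_of_int (k + 1) * (1 - ?\<alpha>)) * c (k + 1) + 2 powr (real_of_int k * (1 - ?\<alpha>)) * c k"
      using cshort[of k] cshort[of "k + 1"] by (simp add: neg)
    also have "\<dots> \<le> 2 * 2 powr (real_of_int k * (1 - ?\<alpha>)) * c (k + 1) + 2 * 2 powr (real_of_int k * (1 - ?\<alpha>)) * c k"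
      using e1 c0 by (intro add_mono mult_right_mono) auto
    finally have H: "tcost p D ?l2 \<le> H" by (simp add: H_def algebra_simps)
    have cc: "0 \<le> c k + c (k + 1)" "c k + c (k + 1) \<le> 2 * \<kappa>"
      using c0[of k] c0[of "k + 1"] R(2)[of k] R(2)[of "k + 1"] by (auto simp: c_def)
    have "N (bary (mval ?l1)) powr q \<le> A powr (q / p - 1) * H"
      by (rule bary_interpolation[OF eq A H])
    \<comment> \<open>The powers of 2 in this factor and in \<open>H\<close> cancel, so the estimate
      is the same at every scale.\<close>
    also have "A powr (q / p - 1) = 2 powr - (real_of_int k * (1 - ?\<alpha>)) * (c k + c (k + 1)) powr (q / p - 1)"
    proof -
      have "- (real_of_int k * ?\<alpha>) * (q / p - 1) = - (real_of_int k * (1 - ?\<alpha>))"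
        using p0 q0 by (simp add: field_simps)
      then show ?thesis using cc by (simp add: A_def powr_mult powr_powr)
    qed
    also have "2 powr - (real_of_int k * (1 - ?\<alpha>)) * (c k + c (k + 1)) powr (q / p - 1) * H
        = (2 powr - (real_of_int k * (1 - ?\<alpha>)) * 2 powr (real_of_int k * (1 - ?\<alpha>)))
          * (2 * (c k + c (k + 1)) powr (q / p - 1) * (c k + c (k + 1)))"
      by (simp add: H_def mult_ac)
    also have "\<dots> = 2 * (c k + c (k + 1)) powr (q / p - 1) * (c k + c (k + 1))"
      by (simp flip: powr_add)
    \<comment> \<open>Only the power is bounded through \<open>\<kappa>\<close>. The other factor is
      kept, to be summed over \<open>k\<close>.\<close>
    also have "\<dots> \<le> 2 * (2 * \<kappa>) powr (q / p - 1) * (c k + c (k + 1))"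
      using cc p0 pq by (intro mult_right_mono mult_left_mono powr_mono2) (auto simp: field_simps)
    finally show ?thesis by (simp add: neg)
  qed
  define f where "f i = mval (long (int i - int n))" for i
  have fS: "f (Suc i) = mval (long (int i - int n + 1))" for i
    unfolding f_def by (rule arg_cong[where f = "\<lambda>k. mval (long k)"]) simp
  have "short (- int n) = filter (\<lambda>e. \<not> (case e of (a, x, y) \<Rightarrow> 2 powr - real n \<le> D x y)) l"
    using R(4)[OF ends(2)] by (simp add: short_def)
  then have "tcost q D (short (- int n)) \<le> tcost q (\<lambda>_ _. 0) (short (- int n))"
    using near by (intro tcost_mono) force
  also have "\<dots> = 0" using tcost_mult[of q 0 "\<lambda>_ _. 0"] by simp
  finally have s0: "N (bary (mval (short (- int n)))) powr q \<le> 0"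
    using N_bary_le[of "short (- int n)"] by linarith
  have "long (int n) = filter (\<lambda>(a, x, y). 2 powr real n \<le> D x y) l"
    using R(4)[OF ends(1)] by (simp add: long_def)
  then have "long (int n) = []" using far by (fastforce simp: filter_empty_conv not_le)
  then have fn: "f (2 * n) = 0" by (simp add: f_def)
  have "mval l = mval (short (- int n)) + (\<Sum>i<2 * n. f i - f (Suc i))"
    unfolding sum_lessThan_telescope' fn using ls[of "- int n"] by (simp add: f_def add.commute)
  then have "bary (mval l) = bary (mval (short (- int n))) + (\<Sum>i<2 * n. bary (f i - f (Suc i)))"
    by (simp add: lin_ext_linear)
  then have "N (bary (mval l)) powr q
      \<le> N (bary (mval (short (- int n)))) powr q + N (\<Sum>i<2 * n. bary (f i - f (Suc i))) powr q"
    using tri by metis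
  also have "\<dots> \<le> 0 + (\<Sum>i<2 * n. N (bary (f i - f (Suc i))) powr q)"
    by (intro add_mono s0 N_sum_le)
  also have "\<dots> \<le> (\<Sum>i<2 * n. 2 * (2 * \<kappa>) powr (q / p - 1) * (c (int i - int n) + c (int i - int n + 1)))"
    unfolding fS add_0_left unfolding f_def by (intro sum_mono step)
  also have "\<dots> = 2 * (2 * \<kappa>) powr (q / p - 1) * ((\<Sum>i<2 * n. c (int i - int n)) + (\<Sum>i<2 * n. c (int i - int n + 1)))"
    by (simp only: sum.distrib flip: sum_distrib_left)
  also have "\<dots> \<le> 2 * (2 * \<kappa>) powr (q / p - 1) * (psi_const * L + psi_const * L)"
  proof -
    have *: "(\<Sum>i<2 * n. c (int i - b)) \<le> psi_const * L" for b
    proof -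
      have "(\<Sum>i<2 * n. c (int i - b)) = (\<Sum>k\<in>(\<lambda>i. int i - b) ` {..<2 * n}. c k)"
        by (subst sum.reindex) (auto simp: inj_on_def)
      also have "\<dots> \<le> (\<Sum>k\<in>(\<lambda>i. int i - b) ` {..<2 * n}. tcost p (psi k) l)"
        using R(3) by (intro sum_mono) (auto simp: c_def)
      also have "\<dots> \<le> psi_const * tcost p snow l"
        unfolding tcost_sum[symmetric] tcost_mult[symmetric] by (intro tcost_mono sum_psi_le) auto
      also have "\<dots> \<le> psi_const * L" using L psi_const_pos by (intro mult_left_mono) auto
      finally show ?thesis .
    qed
    have "int i - (int n - 1) = int i - int n + 1" for i by simp
    from *[of "int n - 1", unfolded this] *[of "int n"] show ?thesis by (intro mult_left_mono add_mono) simp_all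
  qed
  finally show ?thesis by (simp add: mult_ac)
qed

end

subsection \<open>Cutting at a random level\<close>

text \<open>The indicator that the level \<open>r\<close> separates \<open>u\<close> from
  \<open>v\<close>. The half-open interval counts a value equal to \<open>r\<close> as lying above,
  in accordance with the tests \<open>r \<le> w x\<close> below.\<close>

definition cross :: "real \<Rightarrow> real \<Rightarrow> real \<Rightarrow> real" where
  "cross u v r = indicator {min u v<..max u v} r"

text \<open>Together the two bounds produce a truncated distance: over a window of length at most 1,
  the integral is at most \<open>min 1 \<bar>u - v\<bar>\<close>.\<close>

lemma cross_integral:
  assumes "a \<le> b"
  shows "cross u v integrable_on {a..b}" "integral {a..b} (cross u v) \<le> \<bar>u - v\<bar>"
    "integral {a..b} (cross u v) \<le> b - a"
proof -
  let ?S = "{min u v<..max u v}"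
  have e: "cross u v = indicator ?S" by (rule ext) (simp add: cross_def)
  have S: "?S \<in> lmeasurable" "{a..b} \<in> lmeasurable"
    by (auto intro!: bounded_set_imp_lmeasurable bounded_subset[of "{min u v..max u v}" ?S])
  then have i: "?S \<inter> {a..b} \<in> lmeasurable" by blast
  show "cross u v integrable_on {a..b}" unfolding e using i by (simp add: integrable_on_indicator)
  have m: "integral {a..b} (cross u v) = measure lebesgue (?S \<inter> {a..b})"
    unfolding e using i by (simp add: integral_indicator)
  have "measure lebesgue (?S \<inter> {a..b}) \<le> measure lebesgue ?S"
    using i S by (intro measure_mono_fmeasurable) auto
  also have "\<dots> = \<bar>u - v\<bar>" by auto
  finally show "integral {a..b} (cross u v) \<le> \<bar>u - v\<bar>" using m by simp
  have "measure lebesgue (?S \<inter> {a..b}) \<le> measure lebesgue {a..b}"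
    using i S by (intro measure_mono_fmeasurable) auto
  then show "integral {a..b} (cross u v) \<le> b - a" using m assms by simp
qed

lemma cross_nonneg [simp]: "0 \<le> cross u v r" by (simp add: cross_def)

text \<open>The cost of a representation is linear in the cost function, so it may be integrated
  edge by edge, and some level is almost as good as the average. The slack \<open>\<epsilon>\<close>
  makes up for strictness being lost under the integral.\<close>

lemma tcost_average:
  assumes ab: "a < b" and \<epsilon>: "0 < \<epsilon>"
    and F: "\<And>x y. F x y integrable_on {a..b}" "\<And>x y. integral {a..b} (F x y) \<le> s x y"
  shows "\<exists>r\<in>{a..b}. (b - a) * tcost p (\<lambda>x y. F x y r) l \<le> tcost p s l + \<epsilon>"
proof (rule ccontr)
  assume neg: "\<not> ?thesis"
  define h where "h r = tcost p (\<lambda>x y. F x y r) l" for r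
  have h: "h integrable_on {a..b} \<and> integral {a..b} h \<le> tcost p s l"
    unfolding h_def
  proof (induction l)
    case (Cons e l)
    obtain c x y where [simp]: "e = (c, x, y)" by (cases e)
    have i: "(\<lambda>r. \<bar>c\<bar> powr p * F x y r) integrable_on {a..b}"
      using F(1) by (rule integrable_on_mult_right)
    have "\<bar>c\<bar> powr p * integral {a..b} (F x y) \<le> \<bar>c\<bar> powr p * s x y"
      using F(2) by (intro mult_left_mono) auto
    then show ?case using Cons.IH i by (auto simp: integral_add intro!: integrable_add)
  qed (simp add: integrable_0)
  define k where "k = (tcost p s l + \<epsilon>) / (b - a)"
  have "k \<le> h r" if "r \<in> {a..b}" for r
    using neg that ab by (auto simp: k_def h_def pos_divide_le_eq mult.commute not_le intro: less_imp_le)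
  then have "integral {a..b} (\<lambda>_. k) \<le> integral {a..b} h" using h by (intro integral_le) auto
  moreover have "integral {a..b} (\<lambda>_. k) = tcost p s l + \<epsilon>" using ab by (simp add: k_def)
  ultimately show False using h \<epsilon> by linarith
qed

lemma push_pt [simp]: "push h (pt x) = pt (h x)"
  by (simp add: push_def)

lemmas push_linear = linear_add[OF linear_push] linear_diff[OF linear_push] linear_scale[OF linear_push]

lemma linear_minus_push: "linear (\<lambda>m. m - push h m)"
  by (intro linear_compose_sub linear_ident linear_push)

lemma lin_ext_push_powr_le:
  fixes f :: "'b \<Rightarrow> real"
  assumes "0 < p" "p \<le> 1"
  shows "\<bar>lin_ext f (push g (mval l))\<bar> powr p \<le> tcost p (\<lambda>x y. \<bar>f (g x) - f (g y)\<bar> powr p) l"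
  using lin_ext_scalar_powr_le[OF assms, of f "map (\<lambda>(a, x, y). (a, g x, g y)) l"]
  unfolding tcost_push push_mval .

section \<open>Supports, coefficients and total mass of molecules\<close>

lemma poly_mapping_eq_sum:
  assumes "finite A" "Poly_Mapping.keys m \<subseteq> A"
  shows "m = (\<Sum>a\<in>A. Poly_Mapping.lookup m a *\<^sub>R pt a)"
proof (rule poly_mapping_eqI)
  fix k
  have "Poly_Mapping.lookup (\<Sum>a\<in>A. Poly_Mapping.lookup m a *\<^sub>R pt a) k
      = (\<Sum>a\<in>A. Poly_Mapping.lookup m a * (if a = k then 1 else 0))"
    by (simp add: lookup_sum lookup_scaleR lookup_single when_def)
  also have "\<dots> = (\<Sum>a\<in>A. if a = k then Poly_Mapping.lookup m a else 0)" by (intro sum.cong) auto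
  also have "\<dots> = Poly_Mapping.lookup m k" using assms by (auto simp: in_keys_iff)
  finally show "Poly_Mapping.lookup m k = Poly_Mapping.lookup (\<Sum>a\<in>A. Poly_Mapping.lookup m a *\<^sub>R pt a) k"
    by simp
qed

lemma lookup_eq_lin_ext: "Poly_Mapping.lookup m a = lin_ext (indicator {a} :: 'a \<Rightarrow> real) m"
proof -
  have "lin_ext (indicator {a} :: 'a \<Rightarrow> real) m
      = (\<Sum>i\<in>Poly_Mapping.keys m. if i = a then Poly_Mapping.lookup m i else 0)"
    unfolding lin_ext_def by (intro sum.cong) (auto simp: indicator_def)
  then show ?thesis by (simp add: in_keys_iff)
qed

lemma keys_subset_subspace: "subspace {m :: ('a, real) poly_mapping. Poly_Mapping.keys m \<subseteq> A}"
proof (rule subspaceI)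
  fix x y :: "('a, real) poly_mapping"
  assume "x \<in> {m. Poly_Mapping.keys m \<subseteq> A}" "y \<in> {m. Poly_Mapping.keys m \<subseteq> A}"
  then show "x + y \<in> {m. Poly_Mapping.keys m \<subseteq> A}" using keys_add[of x y] by auto
qed (auto simp: in_keys_iff lookup_scaleR)

lemma keys_push:
  assumes "h ` Poly_Mapping.keys m \<subseteq> A" shows "Poly_Mapping.keys (push h m) \<subseteq> A"
proof -
  note S = keys_subset_subspace[of A]
  have "push h m \<in> {m. Poly_Mapping.keys m \<subseteq> A}"
    unfolding push_def lin_ext_def using assms
    by (intro subspace_sum[OF S] subspace_scale[OF S]) auto
  then show ?thesis by simp
qed

lemma keys_mval:
  assumes "\<And>a x y. (a, x, y) \<in> set l \<Longrightarrow> x \<in> A \<and> y \<in> A"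
  shows "Poly_Mapping.keys (mval l) \<subseteq> A"
proof -
  note S = keys_subset_subspace[of A]
  have "mval l \<in> {m. Poly_Mapping.keys m \<subseteq> A}"
    using assms
  proof (induction l)
    case (Cons e l)
    obtain a x y where [simp]: "e = (a, x, y)" by (cases e)
    have "mval l \<in> {m. Poly_Mapping.keys m \<subseteq> A}" using Cons.prems by (intro Cons.IH) auto
    moreover have "pt x \<in> {m. Poly_Mapping.keys m \<subseteq> A}" "pt y \<in> {m. Poly_Mapping.keys m \<subseteq> A}"
      using Cons.prems[of a x y] by auto
    ultimately show ?case unfolding \<open>e = _\<close> mval_simps
      by (intro subspace_add[OF S] subspace_scale[OF S] subspace_diff[OF S])
  qed simp
  then show ?thesis by simp
qed

lemma mass_mval: "lin_ext (\<lambda>_. 1 :: real) (mval l) = 0"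
  by (induction l) (auto simp: lin_ext_linear)

section \<open>Truncated metric and neighbourhoods of finite sets\<close>

context snowflake
begin

text \<open>This is \<open>psi 0\<close>. Being at most 1, it moves mass to the origin from anywhere
  at a bounded price.\<close>

definition dtrunc :: "'a \<Rightarrow> 'a \<Rightarrow> real" where "dtrunc x y = min 1 (D x y)"

definition dst :: "'a set \<Rightarrow> 'a \<Rightarrow> real" where "dst A x = Min (D x ` A)"

lemma dtrunc_nonneg [simp]: "0 \<le> dtrunc x y" by (simp add: dtrunc_def)

lemma dtrunc_le_1: "dtrunc x y \<le> 1" by (simp add: dtrunc_def)

lemma dtrunc_commute: "dtrunc x y = dtrunc y x" by (simp add: dtrunc_def D_commute)

lemma dtrunc_tri: "dtrunc x z \<le> dtrunc x y + dtrunc y z"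
  using D_tri[of x z y] D_nonneg[of x y] D_nonneg[of y z] unfolding dtrunc_def by linarith

lemma dtrunc_le_snow: "dtrunc x y \<le> snow x y"
proof (cases "D x y \<le> 1")
  case True
  have "D x y powr 1 \<le> D x y powr (p / q)"
    using exponent True by (intro powr_mono') auto
  then show ?thesis using True by (simp add: dtrunc_def snow_def)
next
  case False
  then have "1 \<le> D x y powr (p / q)" using exponent by (intro ge_one_powr_ge_zero) auto
  then show ?thesis using False by (simp add: dtrunc_def snow_def)
qed

lemma
  assumes "finite A"
  shows dst_le: "a \<in> A \<Longrightarrow> dst A x \<le> D x a"
    and dst_attained: "A \<noteq> {} \<Longrightarrow> \<exists>a\<in>A. D x a = dst A x"
proof -
  show "dst A x \<le> D x a" if "a \<in> A" using assms that by (simp add: dst_def)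
  show "\<exists>a\<in>A. D x a = dst A x" if "A \<noteq> {}"
    using Min_in[of "D x ` A"] assms that unfolding dst_def by (metis finite_imageI image_iff image_is_empty)
qed

lemma dst_nonneg: "finite A \<Longrightarrow> A \<noteq> {} \<Longrightarrow> 0 \<le> dst A x"
  using dst_attained[of A x] D_nonneg[of x] by metis

lemma dst_mem: "finite A \<Longrightarrow> x \<in> A \<Longrightarrow> dst A x = 0"
  using dst_le[of A x x] dst_nonneg[of A x] by fastforce

lemma dst_mono:
  assumes "finite B" "A \<subseteq> B" "A \<noteq> {}" shows "dst B x \<le> dst A x"
  unfolding dst_def using assms by (intro Min_antimono) (auto intro: finite_subset)

lemma dst_lipschitz:
  assumes "finite A" "A \<noteq> {}" shows "\<bar>dst A x - dst A y\<bar> \<le> D x y"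
proof -
  have "dst A x \<le> D x y + dst A y" for x y
  proof -
    obtain a where a: "a \<in> A" "D y a = dst A y" using dst_attained[OF assms] by blast
    then show ?thesis using dst_le[OF assms(1) a(1), of x] D_tri[of x a y] by simp
  qed
  from this[of x y] this[of y x] show ?thesis by (simp add: D_commute abs_le_iff)
qed

text \<open>The collapsed distance \<open>min (D x y) (w x + w y)\<close> allows free transport where \<open>w\<close> vanishes. A cut at
  a random level of \<open>w\<close> moves the part of the molecule above that level to the origin.\<close>

lemma cut_collapse:
  assumes w: "\<And>x. 0 \<le> w x" "\<And>x y. \<bar>w x - w y\<bar> \<le> D x y" and t: "0 < t" and \<epsilon>: "0 < \<epsilon>"
    and m: "cost_le p (\<lambda>x y. min (D x y) (w x + w y)) m k"
  shows "\<exists>r\<in>{t / 16..t / 8}. cost_le p dtrunc (m - push (\<lambda>x. if r \<le> w x then 0 else x) m) (k + 16 / t * (k + \<epsilon>))"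
proof -
  let ?s = "\<lambda>x y. min (D x y) (w x + w y)"
  obtain l where l: "mval l = m" "tcost p ?s l \<le> k" using m unfolding cost_le_def by blast
  \<comment> \<open>If the collapsed cost is \<open>w x + w y\<close>, the edge is thought of as
    passing through the zero set of \<open>w\<close>, and the levels on the way down and up both
    count. Otherwise only the levels between its ends do.\<close>
  define F where "F x y r = (if w x + w y < D x y then cross 0 (w x) r + cross 0 (w y) r
      else cross (w x) (w y) r)" for x y r
  have t': "t / 16 \<le> t / 8" "t / 16 < t / 8" using t by auto
  have F: "F x y integrable_on {t / 16..t / 8}" "integral {t / 16..t / 8} (F x y) \<le> ?s x y" for x y
  proof -
    note ci = cross_integral[OF t'(1)]
    show "F x y integrable_on {t / 16..t / 8}"
      unfolding F_def by (cases "w x + w y < D x y") (auto intro!: integrable_add ci(1))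
    show "integral {t / 16..t / 8} (F x y) \<le> ?s x y"
    proof (cases "w x + w y < D x y")
      case True
      then have "integral {t / 16..t / 8} (F x y)
          = integral {t / 16..t / 8} (cross 0 (w x)) + integral {t / 16..t / 8} (cross 0 (w y))"
        unfolding F_def by (simp add: integral_add ci(1))
      also have "\<dots> \<le> w x + w y" using ci(2)[of 0 "w x"] ci(2)[of 0 "w y"] w(1)[of x] w(1)[of y] by simp
      finally show ?thesis using True by simp
    next
      case False
      then have "F x y = cross (w x) (w y)" by (auto simp: F_def)
      then show ?thesis using False ci(2)[of "w x" "w y"] w(2)[of x y] by simp
    qed
  qed
  obtain r where r: "r \<in> {t / 16..t / 8}" "(t / 8 - t / 16) * tcost p (\<lambda>x y. F x y r) l \<le> tcost p ?s l + \<epsilon>"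
    using tcost_average[OF t'(2) \<epsilon>, where F = F and s = ?s] F by blast
  have r0: "0 < r" using r(1) t by (auto intro: less_le_trans[of _ "t / 16"])
  define h where "h x = (if r \<le> w x then 0 else x)" for x
  have e: "cost_le p dtrunc (pt x - pt y - push h (pt x - pt y)) (?s x y + F x y r)" for x y
  proof -
    have F0: "0 \<le> F x y r" by (simp add: F_def)
    have s0: "0 \<le> ?s x y" using w(1)[of x] w(1)[of y] by simp
    consider "r \<le> w x" "r \<le> w y" | "r \<le> w x" "w y < r" | "w x < r" "r \<le> w y" | "w x < r" "w y < r"
      by linarith
    then show ?thesis
    proof cases
      case 1
      \<comment> \<open>Both ends move to the origin and the edge disappears, so its truncated
        length is due. It is covered by \<open>D x y\<close> or, for an edge through the zero set,
        by the two crossings.\<close>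
      have "dtrunc x y \<le> ?s x y + F x y r"
        using 1 r0 s0 F0 by (cases "w x + w y < D x y") (auto simp: F_def cross_def dtrunc_def)
      then show ?thesis using 1 cost_le_mono[OF cost_le_pt[of p dtrunc x y]] by (simp add: h_def push_linear)
    next
      case 2
      then have "1 \<le> F x y r" using r0 by (auto simp: F_def cross_def)
      then have "dtrunc x 0 \<le> ?s x y + F x y r" using s0 dtrunc_le_1[of x 0] by linarith
      then show ?thesis using 2 cost_le_mono[OF cost_le_pt[of p dtrunc x 0]] by (simp add: h_def push_linear)
    next
      case 3
      then have "1 \<le> F x y r" using r0 by (auto simp: F_def cross_def)
      then have "dtrunc 0 y \<le> ?s x y + F x y r" using s0 dtrunc_le_1[of 0 y] by linarith
      then show ?thesis using 3 cost_le_mono[OF cost_le_pt[of p dtrunc 0 y]] by (simp add: h_def push_linear)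
    next
      case 4
      then show ?thesis using F0 s0 by (simp add: h_def push_linear cost_le_0)
    qed
  qed
  have "cost_le p dtrunc (mval l - push h (mval l)) (tcost p (\<lambda>x y. ?s x y + F x y r) l)"
    by (rule cost_le_linear[OF linear_minus_push]) (rule e)
  moreover have "tcost p (\<lambda>x y. ?s x y + F x y r) l \<le> k + 16 / t * (k + \<epsilon>)"
  proof -
    have "tcost p (\<lambda>x y. F x y r) l \<le> 16 / t * (k + \<epsilon>)" using r(2) l(2) t by (simp add: field_simps)
    then show ?thesis using l(2) by (simp add: tcost_add)
  qed
  ultimately show ?thesis using r(1) l(1) cost_le_mono unfolding h_def by blast
qed

text \<open>Moving every endpoint near \<open>A\<close> to a nearest point of \<open>A\<close> would be too expensive for short edges. The
  edges inside the neighbourhood are therefore absorbed in \<open>\<pi>\<close>, and only those crossing its boundary are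
  paid for; the random level makes them rare.\<close>

lemma cut_to_finite:
  assumes A: "finite A" "A \<noteq> {}" and t: "0 < t" "t \<le> 1" and \<epsilon>: "0 < \<epsilon>"
    and T: "tcost p (\<lambda>_ _. 1) l \<le> T" and \<zeta>: "\<And>x. x \<in> Poly_Mapping.keys \<zeta> \<Longrightarrow> dst A x < t"
    and \<eta>: "cost_le p dtrunc (mval l - \<zeta>) \<eta>"
  shows "\<exists>\<pi>. Poly_Mapping.keys \<pi> \<subseteq> A \<and> (\<forall>a\<in>A. \<bar>Poly_Mapping.lookup \<pi> a\<bar> powr p \<le> T + (\<eta> + \<epsilon>) / t)
     \<and> cost_le p dtrunc (mval l - \<pi>) (4 * t * T + 3 * \<eta> + 2 * \<epsilon>)"
proof -
  obtain l' where l': "mval l' = mval l - \<zeta>" "tcost p dtrunc l' \<le> \<eta>" using \<eta> unfolding cost_le_def by blast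
  define F where "F x y = cross (dst A x) (dst A y)" for x y
  have tt: "t \<le> 2 * t" "t < 2 * t" using t by auto
  have F: "F x y integrable_on {t..2 * t}" "integral {t..2 * t} (F x y) \<le> dtrunc x y" for x y
    using cross_integral[OF tt(1), of "dst A x" "dst A y"] dst_lipschitz[OF A, of x y] t
    by (auto simp: F_def dtrunc_def)
  obtain r where r: "r \<in> {t..2 * t}" "(2 * t - t) * tcost p (\<lambda>x y. F x y r) l' \<le> tcost p dtrunc l' + \<epsilon>"
    using tcost_average[OF tt(2) \<epsilon>, where F = F and s = dtrunc] F by blast
  have cF: "tcost p (\<lambda>x y. F x y r) l' \<le> (\<eta> + \<epsilon>) / t" using r(2) l'(2) t by (simp add: field_simps)
  obtain n where n: "\<And>x. n x \<in> A" "\<And>x. D x (n x) = dst A x" using dst_attained[OF A] by metis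
  define g where "g x = (if r \<le> dst A x then x else n x)" for x
  have gd: "dtrunc x (g x) \<le> 2 * t" for x using n(2)[of x] r(1) t by (auto simp: g_def dtrunc_def)
  have gA: "g x \<in> A" if "dst A x < r" for x using that n(1) by (simp add: g_def)
  define P where "P = (\<lambda>e :: real \<times> 'a \<times> 'a. case e of (a, x, y) \<Rightarrow> dst A x < r \<and> dst A y < r)"
  define lin where "lin = filter P l'"
  define lout where "lout = filter (\<lambda>e. \<not> P e) l'"
  \<comment> \<open>As defined, \<open>\<pi>\<close> lives on \<open>A\<close>. Rewritten through
    \<open>l\<close> and \<open>lout\<close> it is close to \<open>mval l\<close> and has bounded
    coefficients: \<open>l\<close> has bounded weight, and of \<open>lout\<close> only the crossing
    edges matter.\<close>
  define \<pi> where "\<pi> = push g \<zeta> + push g (mval lin)"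
  have "push g (mval lin) + push g (mval lout) = push g (mval l')"
    by (simp add: lin_def lout_def mval_filter flip: push_linear(1))
  then have \<pi>: "\<pi> = push g (mval l) - push g (mval lout)"
    unfolding \<pi>_def l'(1) push_linear(2) by (simp add: algebra_simps)
  have "Poly_Mapping.keys \<pi> \<subseteq> A"
  proof -
    have "Poly_Mapping.keys (push g \<zeta>) \<subseteq> A" using \<zeta> gA r(1) by (intro keys_push) force
    moreover have "Poly_Mapping.keys (push g (mval lin)) \<subseteq> A"
      unfolding push_mval by (rule keys_mval) (use gA in \<open>auto simp: lin_def P_def\<close>)
    ultimately show ?thesis unfolding \<pi>_def using subspace_add[OF keys_subset_subspace[of A]] by blast
  qed
  moreover have "\<bar>Poly_Mapping.lookup \<pi> a\<bar> powr p \<le> T + (\<eta> + \<epsilon>) / t" if a: "a \<in> A" for a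
  proof -
    let ?i = "indicator {a} :: 'a \<Rightarrow> real"
    have "\<bar>Poly_Mapping.lookup \<pi> a\<bar> powr p
        \<le> \<bar>lin_ext ?i (push g (mval l))\<bar> powr p + \<bar>lin_ext ?i (push g (mval lout))\<bar> powr p"
      using powr_abs_add[OF p0 p1, of "lin_ext ?i (push g (mval l))" "- lin_ext ?i (push g (mval lout))"]
      unfolding lookup_eq_lin_ext \<pi> by (simp add: lin_ext_linear)
    also have "\<bar>lin_ext ?i (push g (mval l))\<bar> powr p \<le> tcost p (\<lambda>x y. \<bar>?i (g x) - ?i (g y)\<bar> powr p) l"
      by (rule lin_ext_push_powr_le[OF p0 p1])
    also have "\<dots> \<le> tcost p (\<lambda>_ _. 1) l" by (rule tcost_mono) (auto simp: indicator_def)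
    also have "\<dots> \<le> T" by (rule T)
    also have "\<bar>lin_ext ?i (push g (mval lout))\<bar> powr p \<le> tcost p (\<lambda>x y. \<bar>?i (g x) - ?i (g y)\<bar> powr p) lout"
      by (rule lin_ext_push_powr_le[OF p0 p1])
    also have "\<dots> \<le> tcost p (\<lambda>x y. F x y r) lout"
    proof (rule tcost_mono)
      fix b x y assume "(b, x, y) \<in> set lout"
      then have "r \<le> dst A x \<or> r \<le> dst A y" by (auto simp: lout_def P_def)
      \<comment> \<open>Points above the level stay put and \<open>a\<close> lies below it, so an
        edge of \<open>lout\<close> can change the indicator only by crossing the level.\<close>
      moreover have g: "g z \<noteq> a" if "r \<le> dst A z" for z
        using that dst_mem[OF A(1) a] r(1) t by (auto simp: g_def)
      ultimately show "\<bar>?i (g x) - ?i (g y)\<bar> powr p \<le> F x y r"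
      proof (cases "r \<le> dst A x \<and> r \<le> dst A y")
        case True
        then show ?thesis using g[of x] g[of y] by (simp add: F_def)
      next
        case False
        moreover assume "r \<le> dst A x \<or> r \<le> dst A y"
        ultimately have "F x y r = 1" by (auto simp: F_def cross_def)
        then show ?thesis by (auto simp: indicator_def)
      qed
    qed
    also have "\<dots> \<le> tcost p (\<lambda>x y. F x y r) l'"
      unfolding lout_def by (rule tcost_filter_le) (simp add: F_def)
    also note cF
    finally show ?thesis by simp
  qed
  moreover have "cost_le p dtrunc (mval l - \<pi>) (4 * t * T + 3 * \<eta> + 2 * \<epsilon>)"
  proof -
    have "cost_le p dtrunc (mval l - push g (mval l)) (tcost p (\<lambda>_ _. 4 * t) l)"
    proof (rule cost_le_linear[OF linear_minus_push])
      fix x y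
      have "cost_le p dtrunc ((pt x - pt (g x)) - (pt y - pt (g y))) (dtrunc x (g x) + dtrunc y (g y))"
        by (intro cost_le_diff cost_le_pt)
      moreover have "dtrunc x (g x) + dtrunc y (g y) \<le> 4 * t" using gd[of x] gd[of y] by simp
      ultimately show "cost_le p dtrunc (pt x - pt y - push g (pt x - pt y)) (4 * t)"
        using cost_le_mono by (fastforce simp: push_linear algebra_simps)
    qed
    moreover have "tcost p (\<lambda>_ _. 4 * t) l \<le> 4 * t * T"
      using tcost_mult[of p "4 * t" "\<lambda>_ _. 1" l] T t by simp
    ultimately have 1: "cost_le p dtrunc (mval l - push g (mval l)) (4 * t * T)" by (rule cost_le_mono)
    \<comment> \<open>Only an edge crossing the level is altered, at one end and by at most
      \<open>2 * t\<close>.\<close>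
    have "tcost p (\<lambda>x y. dtrunc (g x) (g y)) lout \<le> tcost p (\<lambda>x y. dtrunc x y + 2 * t * F x y r) lout"
    proof (rule tcost_mono)
      fix b x y assume "(b, x, y) \<in> set lout"
      then consider "r \<le> dst A x" "r \<le> dst A y" | "r \<le> dst A x" "dst A y < r" | "dst A x < r" "r \<le> dst A y"
        unfolding lout_def P_def by force
      then show "dtrunc (g x) (g y) \<le> dtrunc x y + 2 * t * F x y r"
      proof cases
        case 1
        then show ?thesis using t by (simp add: g_def F_def)
      next
        case 2
        then have "F x y r = 1" "g x = x" by (auto simp: F_def cross_def g_def)
        then show ?thesis using dtrunc_tri[of x "g y" y] gd[of y] by simp
      next
        case 3
        then have "F x y r = 1" "g y = y" by (auto simp: F_def cross_def g_def)
        then show ?thesis using dtrunc_tri[of "g x" y x] gd[of x] dtrunc_commute[of x "g x"] by simp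
      qed
    qed
    also have "\<dots> \<le> tcost p (\<lambda>x y. dtrunc x y + 2 * t * F x y r) l'"
      unfolding lout_def using t by (intro tcost_filter_le) (simp add: F_def)
    also have "\<dots> = tcost p dtrunc l' + 2 * t * tcost p (\<lambda>x y. F x y r) l'" by (simp add: tcost_add tcost_mult)
    also have "\<dots> \<le> \<eta> + 2 * t * ((\<eta> + \<epsilon>) / t)" using l'(2) cF t by (intro add_mono mult_left_mono) auto
    also have "\<dots> = 3 * \<eta> + 2 * \<epsilon>" using t by (simp add: field_simps)
    finally have "cost_le p dtrunc (push g (mval lout)) (3 * \<eta> + 2 * \<epsilon>)"
      unfolding push_mval by (intro cost_leI) (simp add: tcost_push)
    from cost_le_add[OF 1 this] show ?thesis unfolding \<pi> by (simp add: algebra_simps)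
  qed
  ultimately show ?thesis by blast
qed

text \<open>The bump lives close to \<open>A'\<close> and away from \<open>A\<close>, so that the bumps between the successive terms of an
  increasing sequence of finite sets have disjoint supports.\<close>

definition bump :: "real \<Rightarrow> 'a set \<Rightarrow> 'a set \<Rightarrow> 'a \<Rightarrow> real" where
  "bump t A A' x = max 0 (min (dst A x - t / 2) (t / 4 - dst A' x))"

text \<open>The collapsed distance of \<open>cut_collapse\<close> for the bump: transport off its
  support is free.\<close>

definition local_cost :: "real \<Rightarrow> 'a set \<Rightarrow> 'a set \<Rightarrow> 'a \<Rightarrow> 'a \<Rightarrow> real" where
  "local_cost t A A' x y = min (D x y) (bump t A A' x + bump t A A' y)"

lemma bump_nonneg [simp]: "0 \<le> bump t A A' x" by (simp add: bump_def)

lemma bump_lipschitz: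
  assumes "finite A" "A \<noteq> {}" "finite A'" "A' \<noteq> {}"
  shows "\<bar>bump t A A' x - bump t A A' y\<bar> \<le> D x y"
  using dst_lipschitz[OF assms(1,2), of x y] dst_lipschitz[OF assms(3,4), of x y]
  unfolding bump_def by linarith

text \<open>As \<open>A'\<close> contains the support of \<open>m\<close>, the bump is small there
  only near \<open>A\<close>; the first cut leaves a \<open>\<zeta>\<close> within \<open>t\<close>
  of \<open>A\<close>, which contains the origin. The second cut needs a representation of bounded
  total weight, which the snowflake cost does not control. Edges shorter than \<open>s\<close> are
  dropped at the price \<open>s powr (1 - p / q) * L\<close>, and the others weigh at most
  \<open>T\<close>.\<close>

lemma local_cost_small_imp_near_finite:
  assumes A: "finite A" "0 \<in> A" and A': "finite A'" "A \<union> Poly_Mapping.keys m \<subseteq> A'"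
    and t: "0 < t" "t \<le> 1" and s: "0 < s" and \<epsilon>: "0 < \<epsilon>"
    and L: "cost_le p snow m L" and c: "cost_le p (local_cost t A A') m c"
  defines "T \<equiv> s powr - (p / q) * L"
  defines "\<eta> \<equiv> c + 16 / t * (c + \<epsilon>) + s powr (1 - p / q) * L"
  shows "\<exists>\<pi>. Poly_Mapping.keys \<pi> \<subseteq> A \<and> (\<forall>a\<in>A. \<bar>Poly_Mapping.lookup \<pi> a\<bar> powr p \<le> T + (\<eta> + \<epsilon>) / t)
     \<and> cost_le p dtrunc (m - \<pi>) (4 * t * T + 3 * \<eta> + 2 * \<epsilon> + s powr (1 - p / q) * L)"
proof -
  let ?w = "bump t A A'"
  have ne: "A \<noteq> {}" "A' \<noteq> {}" using A A' by auto
  have "cost_le p (\<lambda>x y. min (D x y) (?w x + ?w y)) m c" using c by (simp add: local_cost_def[abs_def])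
  from cut_collapse[OF _ bump_lipschitz[OF A(1) ne(1) A'(1) ne(2)] t(1) \<epsilon> this]
  obtain r where r: "r \<in> {t / 16..t / 8}"
    and r2: "cost_le p dtrunc (m - push (\<lambda>x. if r \<le> ?w x then 0 else x) m) (c + 16 / t * (c + \<epsilon>))"
    by auto
  define \<zeta> where "\<zeta> = push (\<lambda>x. if r \<le> ?w x then 0 else x) m"
  have \<zeta>: "dst A x < t" if "x \<in> Poly_Mapping.keys \<zeta>" for x
  proof -
    have "Poly_Mapping.keys \<zeta> \<subseteq> {x. dst A x < t}"
      unfolding \<zeta>_def
    proof (rule keys_push, rule image_subsetI)
      fix y assume "y \<in> Poly_Mapping.keys m"
      then have "dst A' y = 0" using A' by (intro dst_mem) auto
      \<comment> \<open>On the support of \<open>m\<close> the term \<open>t / 4 - dst A' y\<close>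
        is \<open>t / 4 > r\<close>, so a bump below \<open>r\<close> forces
        \<open>dst A y < t / 2 + r < t\<close>.\<close>
      then have "dst A y < t" if "?w y < r" using that r t by (auto simp: bump_def min_def max_def split: if_splits)
      then show "(if r \<le> ?w y then 0 else y) \<in> {x. dst A x < t}" using dst_mem[OF A] t by simp
    qed
    then show ?thesis using that by blast
  qed
  obtain l where l: "mval l = m" "tcost p snow l \<le> L" using L unfolding cost_le_def by blast
  define P where "P = (\<lambda>e :: real \<times> 'a \<times> 'a. case e of (a, x, y) \<Rightarrow> s \<le> D x y)"
  define long where "long = filter P l"
  define short where "short = filter (\<lambda>e. \<not> P e) l"
  have ls: "mval long + mval short = m" using mval_filter[of P l] l(1) by (simp add: long_def short_def)
  have "tcost p (\<lambda>_ _. 1) long \<le> tcost p (\<lambda>x y. s powr - (p / q) * snow x y) long"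
  proof (rule tcost_mono)
    fix a x y assume "(a, x, y) \<in> set long"
    then have "s \<le> D x y" by (auto simp: long_def P_def)
    then have "s powr (p / q) \<le> snow x y" unfolding snow_def using s exponent by (intro powr_mono2) auto
    then have "s powr - (p / q) * s powr (p / q) \<le> s powr - (p / q) * snow x y" by (intro mult_left_mono) auto
    then show "1 \<le> s powr - (p / q) * snow x y" using s by (simp flip: powr_add)
  qed
  also have "\<dots> \<le> s powr - (p / q) * tcost p snow l"
    unfolding tcost_mult long_def by (intro mult_left_mono tcost_filter_le) auto
  also have "\<dots> \<le> T" unfolding T_def using l(2) by (intro mult_left_mono) auto
  finally have long: "tcost p (\<lambda>_ _. 1) long \<le> T" .
  have "tcost p dtrunc short \<le> tcost p (\<lambda>x y. s powr (1 - p / q) * snow x y) short"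
  proof (rule tcost_mono)
    fix a x y assume "(a, x, y) \<in> set short"
    then have xy: "D x y \<le> s" by (auto simp: short_def P_def)
    have "dtrunc x y \<le> D x y" by (simp add: dtrunc_def)
    also have "D x y = D x y powr (1 - p / q) * D x y powr (p / q)" by (simp flip: powr_add)
    also have "\<dots> \<le> s powr (1 - p / q) * snow x y"
      unfolding snow_def using xy exponent by (intro mult_right_mono powr_mono2) auto
    finally show "dtrunc x y \<le> s powr (1 - p / q) * snow x y" .
  qed
  also have "\<dots> \<le> s powr (1 - p / q) * tcost p snow l"
    unfolding tcost_mult short_def by (intro mult_left_mono tcost_filter_le) auto
  also have "\<dots> \<le> s powr (1 - p / q) * L" using l(2) by (intro mult_left_mono) auto
  finally have short: "cost_le p dtrunc (mval short) (s powr (1 - p / q) * L)" by (rule cost_leI)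
  have e: "mval long - \<zeta> = (m - \<zeta>) - mval short" using ls by (simp add: algebra_simps)
  have "cost_le p dtrunc (mval long - \<zeta>) \<eta>"
    unfolding e unfolding \<zeta>_def \<eta>_def by (rule cost_le_diff[OF r2 short])
  from cut_to_finite[OF A(1) ne(1) t \<epsilon> long \<zeta> this]
  obtain \<pi> where \<pi>: "Poly_Mapping.keys \<pi> \<subseteq> A" "\<forall>a\<in>A. \<bar>Poly_Mapping.lookup \<pi> a\<bar> powr p \<le> T + (\<eta> + \<epsilon>) / t"
    "cost_le p dtrunc (mval long - \<pi>) (4 * t * T + 3 * \<eta> + 2 * \<epsilon>)" by blast
  have e2: "m - \<pi> = (mval long - \<pi>) + mval short" using ls by (simp add: algebra_simps)
  have "cost_le p dtrunc (m - \<pi>) (4 * t * T + 3 * \<eta> + 2 * \<epsilon> + s powr (1 - p / q) * L)"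
    unfolding e2 by (rule cost_le_add[OF \<pi>(3) short])
  then show ?thesis using \<pi>(1,2) by blast
qed

end

subsection \<open>The two alternatives\<close>

context approximate_lifting
begin

lemma G_diff: "G x e m \<Longrightarrow> G y e' m' \<Longrightarrow> G (x - y) (e + e') (m - m')"
  using G_add[OF _ G_scale[of y e' m' "-1"], of x e m] by simp

text \<open>If every scale saw at most \<open>\<kappa>\<close>, \<open>detection\<close> would make
  the barycenter too small to approximate a unit vector. In \<open>q\<close>-th powers,
  \<open>\<kappa>\<close> bounds the barycenter by 1/4 and \<open>e\<close> bounds its error by
  1/2.\<close>

lemma unit_detection:
  "\<exists>\<kappa>>0. \<exists>e>0. \<forall>x m. N x = 1 \<longrightarrow> G x e m \<longrightarrow> (\<exists>k. \<not> cost_le p (psi k) m \<kappa>)"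
proof -
  define L where "L = K + 2"
  define \<gamma> where "\<gamma> = q / p - 1"
  have \<gamma>: "0 < \<gamma>" using p0 pq by (simp add: \<gamma>_def)
  have L: "0 < L" using K0 by (simp add: L_def)
  define \<kappa> where "\<kappa> = (1 / (16 * psi_const * L)) powr (1 / \<gamma>) / 2"
  have \<kappa>: "0 < \<kappa>" using psi_const_pos L by (simp add: \<kappa>_def)
  have \<kappa>2: "4 * (2 * \<kappa>) powr \<gamma> * psi_const * L < 1 / 2"
    using \<gamma> psi_const_pos L by (simp add: \<kappa>_def powr_powr field_simps)
  define e where "e = min 1 ((1 / 2) powr (p / q) / B)"
  have e: "0 < e" "e \<le> 1" "B * e \<le> (1 / 2) powr (p / q)"
    using B0 by (auto simp: e_def min_def field_simps)
  have "\<exists>k. \<not> cost_le p (psi k) m \<kappa>" if x: "N x = 1" and m: "G x e m" for x m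
  proof (rule ccontr)
    assume "\<nexists>k. \<not> cost_le p (psi k) m \<kappa>"
    then have small: "cost_le p (psi k) m \<kappa>" for k by blast
    obtain l where l: "mval l = m" "tcost p snow l \<le> K * N x powr p + 2 * e"
      using G_cost[OF m e(1)] unfolding cost_le_def by blast
    have "tcost p snow l \<le> L" using l(2) x e by (simp add: L_def)
    then have "N (bary m) powr q \<le> 4 * (2 * \<kappa>) powr \<gamma> * psi_const * L"
      using detection[of l L \<kappa>] small \<kappa> l(1) by (simp add: \<gamma>_def)
    then have 1: "N (bary m) powr q < 1 / 2" using \<kappa>2 by linarith
    have "N (bary m - x) powr p \<le> (1 / 2) powr (p / q)" using G_bary[OF m] e(3) by linarith
    then have "(N (bary m - x) powr p) powr (q / p) \<le> ((1 / 2) powr (p / q)) powr (q / p)"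
      using p0 q0 by (intro powr_mono2) auto
    then have 2: "N (bary m - x) powr q \<le> 1 / 2" using p0 q0 by (simp add: powr_powr)
    have "N x powr q \<le> N (bary m) powr q + N (x - bary m) powr q"
      using tri[of "bary m" "x - bary m"] by simp
    then show False using 1 2 x N_commute[of x "bary m"] by simp
  qed
  then show ?thesis using \<kappa> e(1) by blast
qed

text \<open>Scales chosen one after the other outside the finite set \<open>J i\<close> of earlier
  ones are distinct, so \<open>sum_psi_le\<close> dominates the sum of their costs.\<close>

lemma detection_not_unbounded:
  assumes \<kappa>: "0 < \<kappa>"
    and unb: "\<And>I e. finite I \<Longrightarrow> 0 < e \<Longrightarrow> \<exists>x m k. N x = 1 \<and> G x e m \<and> k \<notin> I \<and> \<not> cost_le p (psi k) m \<kappa>"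
  shows False
proof (rule no_disjoint_tests[OF \<kappa> psi_const_pos])
  fix M :: nat and e :: real
  assume e: "0 < e"
  have "\<exists>x m k. \<forall>I. finite I \<longrightarrow> N (x I) = 1 \<and> G (x I) e (m I) \<and> k I \<notin> I \<and> \<not> cost_le p (psi (k I)) (m I) \<kappa>"
    using unb[OF _ e] by metis
  then obtain x m k where *: "\<And>I. finite I \<Longrightarrow> N (x I) = 1 \<and> G (x I) e (m I) \<and> k I \<notin> I \<and> \<not> cost_le p (psi (k I)) (m I) \<kappa>"
    by blast
  define J where "J i = ((\<lambda>I. insert (k I) I) ^^ i) {}" for i
  have J: "finite (J i)" "J (Suc i) = insert (k (J i)) (J i)" for i
    by (induction i) (auto simp: J_def)
  have mono: "J i \<subseteq> J i'" if "i \<le> i'" for i i' using lift_Suc_mono_le[OF _ that, of J] J(2) by blast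
  have inj: "inj (\<lambda>i. k (J i))"
  proof (rule linorder_injI)
    fix i i' :: nat assume "i < i'"
    then have "k (J i) \<in> J i'" using mono[of "Suc i" i'] J(2)[of i] by auto
    then show "k (J i) \<noteq> k (J i')" using *[OF J(1)] by metis
  qed
  have "(\<Sum>i<M. psi (k (J i)) u v) \<le> psi_const * snow u v" for u v
  proof -
    have "(\<Sum>i<M. psi (k (J i)) u v) = (\<Sum>k\<in>(\<lambda>i. k (J i)) ` {..<M}. psi k u v)"
      using inj by (subst sum.reindex) (auto intro: inj_on_subset)
    also have "\<dots> \<le> psi_const * snow u v" by (rule sum_psi_le) simp
    finally show ?thesis .
  qed
  then show "\<exists>x m s. (\<forall>i<M. N (x i) = 1 \<and> G (x i) e (m i) \<and> \<not> cost_le p (s i) (m i) \<kappa>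
      \<and> (\<forall>u v. 0 \<le> s i u v)) \<and> (\<forall>u v. (\<Sum>i<M. s i u v) \<le> psi_const * snow u v)"
    using *[OF J(1)]
    by (intro exI[of _ "\<lambda>i. x (J i)"] exI[of _ "\<lambda>i. m (J i)"] exI[of _ "\<lambda>i. psi (k (J i))"]) auto
qed

text \<open>Total mass zero allows every coefficient to be sent to the origin, at unit price at most
  1.\<close>

lemma cost_le_dtrunc_finite:
  assumes A: "finite A" "0 \<in> A" and m: "Poly_Mapping.keys m \<subseteq> A" "lin_ext (\<lambda>_. 1 :: real) m = 0"
    and \<delta>: "\<And>a. a \<in> A \<Longrightarrow> \<bar>Poly_Mapping.lookup m a\<bar> \<le> \<delta>"
  shows "cost_le p dtrunc m (real (card A) * \<delta> powr p)"
proof -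
  have mass: "(\<Sum>a\<in>A. Poly_Mapping.lookup m a) = 0"
    using m lin_ext_superset[OF A(1) m(1), of "\<lambda>_. 1 :: real"] by simp
  have "m = (\<Sum>a\<in>A. Poly_Mapping.lookup m a *\<^sub>R pt a) - (\<Sum>a\<in>A. Poly_Mapping.lookup m a) *\<^sub>R pt 0"
    using poly_mapping_eq_sum[OF A(1) m(1)] mass by simp
  also have "\<dots> = (\<Sum>a\<in>A. Poly_Mapping.lookup m a *\<^sub>R (pt a - pt 0))"
    by (simp add: scaleR_diff_right sum_subtractf scaleR_sum_left)
  finally have e: "m = (\<Sum>a\<in>A. Poly_Mapping.lookup m a *\<^sub>R (pt a - pt 0))" .
  have "cost_le p dtrunc (Poly_Mapping.lookup m a *\<^sub>R (pt a - pt 0)) (\<delta> powr p)" if a: "a \<in> A" for a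
  proof (rule cost_le_mono[OF cost_le_single])
    have "\<bar>Poly_Mapping.lookup m a\<bar> powr p * dtrunc a 0 \<le> \<delta> powr p * 1"
      using \<delta>[OF a] p0 by (intro mult_mono powr_mono2) (auto simp: dtrunc_le_1)
    then show "\<bar>Poly_Mapping.lookup m a\<bar> powr p * dtrunc a 0 \<le> \<delta> powr p" by simp
  qed
  then have "cost_le p dtrunc (\<Sum>a\<in>A. Poly_Mapping.lookup m a *\<^sub>R (pt a - pt 0)) (\<Sum>a\<in>A. \<delta> powr p)"
    by (rule cost_le_sum)
  then show ?thesis using e by simp
qed

lemma cost_le_mass: "cost_le p s m k \<Longrightarrow> lin_ext (\<lambda>_. 1 :: real) m = 0"
  unfolding cost_le_def using mass_mval by blast

text \<open>A bounded set of coefficient vectors is totally bounded: rounding to multiples of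
  \<open>\<delta>\<close> leaves finitely many patterns.\<close>

lemma infinite_pigeonhole_coefficients:
  fixes f :: "nat \<Rightarrow> 'b \<Rightarrow> real"
  assumes A: "finite A" and \<delta>: "0 < \<delta>" and Z: "\<And>n a. a \<in> A \<Longrightarrow> \<bar>f n a\<bar> \<le> Z"
  shows "\<exists>n m. n \<noteq> m \<and> (\<forall>a\<in>A. \<bar>f n a - f m a\<bar> \<le> \<delta>)"
proof -
  define g where "g n = restrict (\<lambda>a. \<lfloor>f n a / \<delta>\<rfloor>) A" for n
  define z where "z = \<lceil>Z / \<delta>\<rceil> + 1"
  have "g n \<in> (\<Pi>\<^sub>E a\<in>A. {- z..z})" for n
  proof -
    have "- z \<le> \<lfloor>f n a / \<delta>\<rfloor> \<and> \<lfloor>f n a / \<delta>\<rfloor> \<le> z" if "a \<in> A" for a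
    proof -
      have "f n a / \<delta> \<le> Z / \<delta>" "- (Z / \<delta>) \<le> f n a / \<delta>"
        using Z[OF that, of n] \<delta> by (auto simp: field_simps abs_le_iff)
      then show ?thesis unfolding z_def by linarith
    qed
    then show ?thesis unfolding g_def by auto
  qed
  then have "range g \<subseteq> (\<Pi>\<^sub>E a\<in>A. {- z..z})" by blast
  moreover have "finite (\<Pi>\<^sub>E a\<in>A. {- z..z})" using A by (intro finite_PiE) auto
  ultimately have "finite (range g)" by (rule finite_subset)
  then have "\<not> inj g" using finite_imageD[of g UNIV] by auto
  then obtain n m where nm: "n \<noteq> m" "g n = g m" by (auto simp: inj_def)
  have "\<bar>f n a - f m a\<bar> \<le> \<delta>" if a: "a \<in> A" for a
  proof -
    have "\<lfloor>f n a / \<delta>\<rfloor> = \<lfloor>f m a / \<delta>\<rfloor>" using fun_cong[OF nm(2), of a] a by (simp add: g_def)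
    then have "\<bar>f n a / \<delta> - f m a / \<delta>\<bar> \<le> 1" by linarith
    then have "\<bar>f n a - f m a\<bar> / \<delta> \<le> 1" using \<delta> by (simp add: abs_divide flip: diff_divide_distrib)
    then show ?thesis using \<delta> by simp
  qed
  then show ?thesis using nm(1) by blast
qed

text \<open>Otherwise all liftings of unit vectors would be close to measures on a neighbourhood of \<open>A\<close>, which
  \<open>dtrunc\<close> sees as elements of a bounded set in a finite-dimensional space. So the liftings of two terms of
  the separated sequence would be indistinguishable for \<open>dtrunc\<close>.\<close>

lemma escape_from_finite:
  fixes z :: "nat \<Rightarrow> 'a"
  assumes \<eta>: "0 < \<eta>" and e1: "0 < e1" and det: "\<And>x m. N x = 1 \<Longrightarrow> G x e1 m \<Longrightarrow> \<not> cost_le p dtrunc m \<eta>"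
    and z: "\<And>n. N (z n) = 1" "\<And>n m. n \<noteq> m \<Longrightarrow> 1 / 2 \<le> N (z n - z m)"
  shows "\<exists>t c e. 0 < t \<and> t \<le> 1 \<and> 0 < c \<and> 0 < e \<and> (\<forall>A. finite A \<longrightarrow> 0 \<in> A \<longrightarrow>
     (\<exists>x. N x = 1 \<and> (\<forall>m A'. G x e m \<longrightarrow> finite A' \<longrightarrow> A \<union> Poly_Mapping.keys m \<subseteq> A'
        \<longrightarrow> \<not> cost_le p (local_cost t A A') m c)))"
proof -
  define L where "L = K + 2"
  have L: "0 < L" using K0 by (simp add: L_def)
  \<comment> \<open>The order of choice matters: \<open>s\<close> makes the dropped short edges cost
    \<open>\<eta> / 256\<close> and fixes \<open>T\<close>; \<open>t\<close> makes the displacement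
    \<open>4 * t * T\<close> small; \<open>c\<close> makes up for the factor \<open>16 / t\<close>
    of the first cut. None depends on \<open>A\<close>, so one choice serves a growing sequence of
    sets.\<close>
  define s where "s = (\<eta> / (256 * L)) powr (1 / (1 - p / q))"
  have s: "0 < s" using \<eta> L by (simp add: s_def)
  have s2: "s powr (1 - p / q) * L = \<eta> / 256" using exponent \<eta> L pq by (auto simp: s_def powr_powr)
  define T where "T = s powr - (p / q) * L"
  have T: "0 < T" using s L by (simp add: T_def)
  define t where "t = min 1 (\<eta> / (256 * T))"
  have t: "0 < t" "t \<le> 1" using \<eta> T by (auto simp: t_def)
  have "t * T \<le> \<eta> / (256 * T) * T" using T by (intro mult_right_mono) (auto simp: t_def)
  then have tT: "4 * t * T \<le> \<eta> / 64" using T by simp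
  define c where "c = \<eta> * t / 4096"
  have c: "0 < c" using \<eta> t by (simp add: c_def)
  have ct: "c \<le> \<eta> / 4096" using \<eta> t by (simp add: c_def)
  define \<eta>' where "\<eta>' = c + 16 / t * (c + c) + s powr (1 - p / q) * L"
  have tc: "16 / t * (c + c) = \<eta> / 128" using t by (simp add: c_def)
  have "4 * t * T + 3 * \<eta>' + 2 * c + s powr (1 - p / q) * L \<le> \<eta> / 64 + 3 * (\<eta> / 4096 + \<eta> / 128 + \<eta> / 256) + 2 * (\<eta> / 4096) + \<eta> / 256"
    unfolding \<eta>'_def s2 tc using tT ct by (intro add_mono mult_left_mono order_refl) simp_all
  also have "\<dots> \<le> \<eta> / 16" using \<eta> by simp
  finally have total: "4 * t * T + 3 * \<eta>' + 2 * c + s powr (1 - p / q) * L \<le> \<eta> / 16" .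
  \<comment> \<open>Two errors in a difference, times at most 2 for normalising it, give at most
    \<open>e1\<close>; and \<open>e \<le> 1\<close> keeps the cost of the molecules at most
    \<open>L\<close>.\<close>
  define e where "e = min 1 (e1 / 4)"
  have e: "0 < e" "e \<le> 1" "4 * e \<le> e1" using e1 by (auto simp: e_def)
  define Q where "Q = T + (\<eta>' + c) / t"
  have "\<exists>x. N x = 1 \<and> (\<forall>m A'. G x e m \<longrightarrow> finite A' \<longrightarrow> A \<union> Poly_Mapping.keys m \<subseteq> A'
        \<longrightarrow> \<not> cost_le p (local_cost t A A') m c)" if A: "finite A" "0 \<in> A" for A
  proof (rule ccontr)
    assume neg: "\<not> ?thesis"
    have "\<exists>m \<pi>. G (z n) e m \<and> Poly_Mapping.keys \<pi> \<subseteq> A \<and> (\<forall>a\<in>A. \<bar>Poly_Mapping.lookup \<pi> a\<bar> powr p \<le> Q)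
        \<and> cost_le p dtrunc (m - \<pi>) (\<eta> / 16) \<and> lin_ext (\<lambda>_. 1 :: real) \<pi> = 0" for n
    proof -
      obtain m A' where m: "G (z n) e m" "finite A'" "A \<union> Poly_Mapping.keys m \<subseteq> A'"
          "cost_le p (local_cost t A A') m c"
        using neg z(1)[of n] by blast
      have snow: "cost_le p snow m L"
        using cost_le_mono[OF G_cost[OF m(1) e(1)]] z(1)[of n] e(2) by (simp add: L_def)
      from local_cost_small_imp_near_finite[OF A m(2,3) t s c snow m(4)]
      obtain \<pi> where \<pi>: "Poly_Mapping.keys \<pi> \<subseteq> A" "\<forall>a\<in>A. \<bar>Poly_Mapping.lookup \<pi> a\<bar> powr p \<le> Q"
        "cost_le p dtrunc (m - \<pi>) (4 * t * T + 3 * \<eta>' + 2 * c + s powr (1 - p / q) * L)"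
        unfolding T_def \<eta>'_def Q_def by blast
      have "lin_ext (\<lambda>_. 1 :: real) \<pi> = 0"
        using cost_le_mass[OF \<pi>(3)] cost_le_mass[OF snow] by (simp add: lin_ext_linear)
      then show ?thesis using m(1) \<pi>(1,2) cost_le_mono[OF \<pi>(3) total] by blast
    qed
    then obtain m \<pi> where m: "\<And>n. G (z n) e (m n)" and \<pi>: "\<And>n. Poly_Mapping.keys (\<pi> n) \<subseteq> A"
      "\<And>n a. a \<in> A \<Longrightarrow> \<bar>Poly_Mapping.lookup (\<pi> n) a\<bar> powr p \<le> Q"
      "\<And>n. cost_le p dtrunc (m n - \<pi> n) (\<eta> / 16)" "\<And>n. lin_ext (\<lambda>_. 1 :: real) (\<pi> n) = 0"
      by metis
    define \<delta> where "\<delta> = (\<eta> / (16 * real (card A))) powr (1 / p)"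
    have cA: "0 < card A" using A by (auto simp: card_gt_0_iff)
    have \<delta>: "0 < \<delta>" using \<eta> cA by (simp add: \<delta>_def)
    have bd: "\<bar>Poly_Mapping.lookup (\<pi> n) a\<bar> \<le> Q powr (1 / p)" if "a \<in> A" for n a
    proof -
      have "(\<bar>Poly_Mapping.lookup (\<pi> n) a\<bar> powr p) powr (1 / p) \<le> Q powr (1 / p)"
        using \<pi>(2)[OF that] p0 by (intro powr_mono2) auto
      then show ?thesis using p0 by (simp add: powr_powr)
    qed
    have "\<exists>i j. i \<noteq> j \<and> (\<forall>a\<in>A. \<bar>Poly_Mapping.lookup (\<pi> i) a - Poly_Mapping.lookup (\<pi> j) a\<bar> \<le> \<delta>)"
      by (rule infinite_pigeonhole_coefficients[OF A(1) \<delta>]) (rule bd)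
    then obtain i j where ij: "i \<noteq> j"
        "\<forall>a\<in>A. \<bar>Poly_Mapping.lookup (\<pi> i) a - Poly_Mapping.lookup (\<pi> j) a\<bar> \<le> \<delta>"
      by blast
    have "cost_le p dtrunc (\<pi> i - \<pi> j) (real (card A) * \<delta> powr p)"
      by (rule cost_le_dtrunc_finite[OF A])
        (use \<pi>(1)[of i] \<pi>(1)[of j] subspace_diff[OF keys_subset_subspace[of A]] \<pi>(4) ij(2)
         in \<open>auto simp: lin_ext_linear lookup_minus\<close>)
    moreover have "real (card A) * \<delta> powr p = \<eta> / 16" using p0 \<eta> cA by (simp add: \<delta>_def powr_powr)
    ultimately have "cost_le p dtrunc ((m i - \<pi> i) - (m j - \<pi> j) + (\<pi> i - \<pi> j)) (\<eta> / 16 + \<eta> / 16 + \<eta> / 16)"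
      by (intro cost_le_add cost_le_diff \<pi>(3)) simp
    then have small: "cost_le p dtrunc (m i - m j) (3 * \<eta> / 16)" by (simp add: algebra_simps)
    define x where "x = z i - z j"
    \<comment> \<open>The gauge of \<open>x\<close> is at least 1/2, so normalising at most doubles
      the cost \<open>3 * \<eta> / 16\<close>, which stays below \<open>\<eta>\<close> and
      contradicts \<open>det\<close>.\<close>
    define a where "a = 1 / N x"
    have x: "1 / 2 \<le> N x" using z(2)[OF ij(1)] by (simp add: x_def)
    then have a: "0 < a" "a \<le> 2" by (auto simp: a_def field_simps)
    have "a powr p \<le> 2 powr p" using a p0 by (intro powr_mono2) auto
    also have "\<dots> \<le> 2 powr 1" using p1 by (intro powr_mono) auto
    finally have ap: "a powr p \<le> 2" by simp
    have "G (a *\<^sub>R x) (\<bar>a\<bar> powr p * (e + e)) (a *\<^sub>R (m i - m j))"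
      unfolding x_def by (intro G_scale G_diff m)
    moreover have "\<bar>a\<bar> powr p * (e + e) \<le> e1"
    proof -
      have "a powr p * (e + e) \<le> 2 * (e + e)" using ap e by (intro mult_right_mono) auto
      also have "\<dots> \<le> e1" using e(3) by simp
      finally show ?thesis using a by simp
    qed
    ultimately have "G (a *\<^sub>R x) e1 (a *\<^sub>R (m i - m j))" by (rule G_mono)
    moreover have "N (a *\<^sub>R x) = 1" using x by (simp add: scale a_def)
    ultimately have "\<not> cost_le p dtrunc (a *\<^sub>R (m i - m j)) \<eta>" by (intro det)
    moreover have "cost_le p dtrunc (a *\<^sub>R (m i - m j)) (\<bar>a\<bar> powr p * (3 * \<eta> / 16))"
      by (rule cost_le_scale[OF small])
    moreover have "\<bar>a\<bar> powr p * (3 * \<eta> / 16) \<le> \<eta>"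
      using mult_right_mono[OF ap, of "3 * \<eta> / 16"] a \<eta> by simp
    ultimately show False using cost_le_mono by blast
  qed
  then show ?thesis using t c e(1) by blast
qed

text \<open>Each finite set collects the supports of the molecules chosen before. At every point at
  most one bump is positive, so an edge is charged by at most two tests, each bounded by
  \<open>dtrunc\<close>: hence the constant 2.\<close>

lemma detection_not_bounded:
  fixes z :: "nat \<Rightarrow> 'a"
  assumes \<eta>: "0 < \<eta>" and e1: "0 < e1" and det: "\<And>x m. N x = 1 \<Longrightarrow> G x e1 m \<Longrightarrow> \<not> cost_le p dtrunc m \<eta>"
    and z: "\<And>n. N (z n) = 1" "\<And>n m. n \<noteq> m \<Longrightarrow> 1 / 2 \<le> N (z n - z m)"
  shows False
proof -
  obtain t c e2 where t: "0 < t" "t \<le> 1" and c: "0 < c" and e2: "0 < e2"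
    and esc: "\<forall>A. finite A \<longrightarrow> 0 \<in> A \<longrightarrow> (\<exists>x. N x = 1 \<and> (\<forall>m A'. G x e2 m \<longrightarrow> finite A'
        \<longrightarrow> A \<union> Poly_Mapping.keys m \<subseteq> A' \<longrightarrow> \<not> cost_le p (local_cost t A A') m c))"
  proof -
    note * = that
    have "\<exists>t c e. 0 < t \<and> t \<le> 1 \<and> 0 < c \<and> 0 < e \<and> (\<forall>A. finite A \<longrightarrow> 0 \<in> A \<longrightarrow>
       (\<exists>x. N x = 1 \<and> (\<forall>m A'. G x e m \<longrightarrow> finite A' \<longrightarrow> A \<union> Poly_Mapping.keys m \<subseteq> A'
          \<longrightarrow> \<not> cost_le p (local_cost t A A') m c)))"
      by (rule escape_from_finite[OF \<eta> e1, of z]) (fact det z)+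
    then show ?thesis using * by blast
  qed
  show False
  proof (rule no_disjoint_tests[OF c, of 2])
    fix M :: nat and e :: real
    assume e: "0 < e"
    define e' where "e' = min e e2"
    have e': "0 < e'" "e' \<le> e" "e' \<le> e2" using e e2 by (auto simp: e'_def)
    have "\<exists>x m. \<forall>A. finite A \<longrightarrow> 0 \<in> A \<longrightarrow> N (x A) = 1 \<and> G (x A) e' (m A)
        \<and> (\<forall>A'. finite A' \<longrightarrow> A \<union> Poly_Mapping.keys (m A) \<subseteq> A' \<longrightarrow> \<not> cost_le p (local_cost t A A') (m A) c)"
    proof -
      have "\<exists>x m. finite A \<longrightarrow> 0 \<in> A \<longrightarrow> N x = 1 \<and> G x e' m
        \<and> (\<forall>A'. finite A' \<longrightarrow> A \<union> Poly_Mapping.keys m \<subseteq> A' \<longrightarrow> \<not> cost_le p (local_cost t A A') m c)" for A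
        using esc G_ex[OF e'(1)] G_mono[OF _ e'(3)] by meson
      then show ?thesis by metis
    qed
    then obtain x m where xm: "\<And>A. finite A \<Longrightarrow> 0 \<in> A \<Longrightarrow> N (x A) = 1 \<and> G (x A) e' (m A)
        \<and> (\<forall>A'. finite A' \<longrightarrow> A \<union> Poly_Mapping.keys (m A) \<subseteq> A' \<longrightarrow> \<not> cost_le p (local_cost t A A') (m A) c)"
      by blast
    define S where "S i = ((\<lambda>A. A \<union> Poly_Mapping.keys (m A)) ^^ i) {0}" for i
    have S_Suc: "S (Suc i) = S i \<union> Poly_Mapping.keys (m (S i))" for i by (simp add: S_def)
    have S: "finite (S i)" "0 \<in> S i" for i by (induction i) (auto simp: S_def)
    have mono: "S i \<subseteq> S i'" if "i \<le> i'" for i i' using lift_Suc_mono_le[OF _ that, of S] S_Suc by blast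
    let ?w = "\<lambda>i. bump t (S i) (S (Suc i))"
    have disj: "i = i'" if "0 < ?w i u" "0 < ?w i' u" for i i' u
    proof -
      have False if "i < i'" "0 < ?w i u" "0 < ?w i' u" for i i'
      proof -
        \<comment> \<open>A positive bump \<open>i\<close> puts \<open>u\<close> within
          \<open>t / 4\<close> of \<open>S (Suc i)\<close>, while a positive bump \<open>i'\<close>
          keeps it at least \<open>t / 2\<close> away from the larger set
          \<open>S i'\<close>.\<close>
        have "dst (S i') u \<le> dst (S (Suc i)) u"
          using mono[of "Suc i" i'] that(1) S by (intro dst_mono) auto
        then show False using that(2,3) t unfolding bump_def by linarith
      qed
      then show ?thesis using that by (metis linorder_neqE_nat)
    qed
    have "(\<Sum>i<M. local_cost t (S i) (S (Suc i)) u v) \<le> 2 * snow u v" for u v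
    proof -
      define I where "I u = {i. i < M \<and> 0 < ?w i u}" for u
      have I: "finite (I u)" "card (I u) \<le> 1" for u
        using disj by (auto simp: I_def card_le_Suc0_iff_eq)
      have z: "local_cost t (S i) (S (Suc i)) u v = 0" if "i \<in> {..<M} - (I u \<union> I v)" for i
      proof -
        have "?w i u = 0" "?w i v = 0" using that bump_nonneg[of t "S i" "S (Suc i)"] by (auto simp: I_def less_le)
        then show ?thesis by (simp add: local_cost_def)
      qed
      have le: "local_cost t (S i) (S (Suc i)) u v \<le> dtrunc u v" for i
      proof -
        have "?w i y \<le> 1 / 4" for y
        proof -
          have "0 \<le> dst (S (Suc i)) y" using S[of "Suc i"] by (intro dst_nonneg) auto
          then show ?thesis unfolding bump_def using t by linarith
        qed
        from this[of u] this[of v] show ?thesis unfolding local_cost_def dtrunc_def by linarith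
      qed
      have "(\<Sum>i<M. local_cost t (S i) (S (Suc i)) u v) = (\<Sum>i\<in>I u \<union> I v. local_cost t (S i) (S (Suc i)) u v)"
        using z by (intro sum.mono_neutral_right) (auto simp: I_def)
      also have "\<dots> \<le> (\<Sum>i\<in>I u \<union> I v. dtrunc u v)" by (intro sum_mono le)
      also have "\<dots> = real (card (I u \<union> I v)) * dtrunc u v" by simp
      also have "\<dots> \<le> 2 * snow u v"
      proof (intro mult_mono dtrunc_le_snow)
        have "card (I u \<union> I v) \<le> 2" using card_Un_le[of "I u" "I v"] I(2)[of u] I(2)[of v] by linarith
        then show "real (card (I u \<union> I v)) \<le> 2" by simp
      qed auto
      finally show ?thesis .
    qed
    moreover have "N (x (S i)) = 1 \<and> G (x (S i)) e (m (S i)) \<and> \<not> cost_le p (local_cost t (S i) (S (Suc i))) (m (S i)) c"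
      for i
      using xm[OF S, of i] S(1)[of "Suc i"] S_Suc[of i] G_mono[OF _ e'(2)] by auto
    moreover have "0 \<le> local_cost t (S i) (S (Suc i)) u v" for i u v by (simp add: local_cost_def)
    ultimately show "\<exists>x m s. (\<forall>i<M. N (x i) = 1 \<and> G (x i) e (m i) \<and> \<not> cost_le p (s i) (m i) c
        \<and> (\<forall>u v. 0 \<le> s i u v)) \<and> (\<forall>u v. (\<Sum>i<M. s i u v) \<le> 2 * snow u v)"
      by (intro exI[of _ "\<lambda>i. x (S i)"] exI[of _ "\<lambda>i. m (S i)"] exI[of _ "\<lambda>i. local_cost t (S i) (S (Suc i))"]) auto
  qed simp
qed

theorem no_separated_unit_sequence:
  fixes z :: "nat \<Rightarrow> 'a"
  assumes z: "\<And>n. N (z n) = 1" "\<And>n m. n \<noteq> m \<Longrightarrow> 1 / 2 \<le> N (z n - z m)"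
  shows False
proof -
  obtain \<kappa> e0 where \<kappa>: "0 < \<kappa>" and e0: "0 < e0"
    and det: "\<And>x m. N x = 1 \<Longrightarrow> G x e0 m \<Longrightarrow> \<exists>k. \<not> cost_le p (psi k) m \<kappa>"
    using unit_detection by blast
  \<comment> \<open>Since the detecting scales cannot leave every finite set, only those in some
    \<open>I\<close> matter. Each \<open>psi k\<close> with \<open>k\<close> in \<open>I\<close> is
    at most a multiple of \<open>dtrunc\<close>, which therefore sees all unit vectors.\<close>
  obtain I e where I: "finite I" "0 < e"
    and bnd: "\<And>x m k. N x = 1 \<Longrightarrow> G x e m \<Longrightarrow> k \<notin> I \<Longrightarrow> cost_le p (psi k) m \<kappa>"
    using detection_not_unbounded[OF \<kappa>] by meson
  define b where "b k = 2 powr (real_of_int k * (p / q - 1)) * (1 + 2 powr real_of_int k)" for k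
  define C where "C = 1 + (\<Sum>k\<in>I. b k)"
  have b0: "0 \<le> b k" for k by (simp add: b_def)
  have C: "0 < C" unfolding C_def using sum_nonneg[of I b] b0 by (simp add: add_pos_nonneg)
  have le: "psi k x y \<le> C * dtrunc x y" if k: "k \<in> I" for k x y
  proof -
    have "min (D x y) (2 powr real_of_int k) \<le> (1 + 2 powr real_of_int k) * dtrunc x y"
    proof (cases "D x y \<le> 1")
      case True
      have "D x y \<le> (1 + 2 powr real_of_int k) * D x y" by (simp add: algebra_simps)
      then show ?thesis using True by (simp add: dtrunc_def)
    next
      case False
      then show ?thesis by (simp add: dtrunc_def)
    qed
    then have "psi k x y \<le> b k * dtrunc x y"
      unfolding psi_def b_def mult.assoc by (intro mult_left_mono) auto
    also have "\<dots> \<le> C * dtrunc x y"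
      using member_le_sum[OF k, of b] b0 I(1) by (intro mult_right_mono) (auto simp: C_def)
    finally show ?thesis .
  qed
  show False
  proof (rule detection_not_bounded[of "\<kappa> / C" "min e e0", OF _ _ _ z])
    fix x m assume x: "N x = 1" and m: "G x (min e e0) m"
    have me: "G x e m" "G x e0 m" using G_mono[OF m] by auto
    obtain k where k: "\<not> cost_le p (psi k) m \<kappa>" using det[OF x me(2)] by blast
    then have kI: "k \<in> I" using bnd[OF x me(1)] by blast
    show "\<not> cost_le p dtrunc m (\<kappa> / C)"
    proof
      assume "cost_le p dtrunc m (\<kappa> / C)"
      then have "cost_le p (\<lambda>x y. C * dtrunc x y) m (C * (\<kappa> / C))" using cost_le_mult_fun[OF C] by blast
      then have "cost_le p (psi k) m (C * (\<kappa> / C))" by (rule cost_le_mono_fun) (rule le[OF kI])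
      then show False using k C by simp
    qed
  qed (use \<kappa> C I e0 in auto)
qed

end

subsection \<open>Separated sequences in infinite-dimensional spaces\<close>

context snowflake
begin

text \<open>Finite-dimensional subspaces are closed. In the induction, \<open>b\<close> has positive
  distance \<open>d\<close> from \<open>span B\<close>, so the \<open>b\<close>-coordinates of an
  approximating sequence are Cauchy; subtracting their limit reduces the claim to
  \<open>span B\<close>.\<close>

lemma span_finite_closed:
  assumes X: "subspace X" and def: "\<And>x. x \<in> X \<Longrightarrow> N x = 0 \<Longrightarrow> x = 0"
    and B: "finite B" "B \<subseteq> X" and x: "x \<in> X" and lim: "\<And>e. 0 < e \<Longrightarrow> \<exists>v\<in>span B. D x v < e"
  shows "x \<in> span B"
  using B x lim
proof (induction B arbitrary: x rule: finite_induct)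
  case empty
  have "D x 0 \<le> 0"
  proof (rule field_le_epsilon)
    fix e :: real assume "0 < e"
    then show "D x 0 \<le> 0 + e" using empty(3)[of e] by auto
  qed
  then have "N x = 0" using nonneg[of x] by (simp add: D_def)
  then show ?case using def empty(2) by simp
next
  case (insert b B)
  have bX: "b \<in> X" "B \<subseteq> X" using insert.prems(1) by auto
  have spX: "span B \<subseteq> X" using bX(2) X by (rule span_minimal)
  show ?case
  proof (cases "b \<in> span B")
    case True
    then show ?thesis using insert.IH[OF bX(2) insert.prems(2)] insert.prems(3) by (simp add: span_redundant)
  next
    case False
    then obtain d where d: "0 < d" "\<And>v. v \<in> span B \<Longrightarrow> d \<le> D b v"
      using insert.IH[OF bX(2) bX(1)] by (meson not_le)
    have "\<exists>v\<in>span (insert b B). D x v < inverse (real (Suc n))" for n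
      by (rule insert.prems(3)) simp
    then obtain v where v: "\<And>n. v n \<in> span (insert b B)" "\<And>n. D x (v n) < inverse (real (Suc n))" by metis
    then have "\<exists>k. v n - k *\<^sub>R b \<in> span B" for n using span_breakdown_eq by blast
    then obtain t where t: "\<And>n. v n - t n *\<^sub>R b \<in> span B" by metis
    have tb: "\<bar>t n - t m\<bar> powr q * d \<le> inverse (real (Suc n)) + inverse (real (Suc m))" for n m
    proof (cases "t n = t m")
      case False
      define w where "w = (1 / (t m - t n)) *\<^sub>R ((v n - t n *\<^sub>R b) - (v m - t m *\<^sub>R b))"
      have w: "w \<in> span B" unfolding w_def by (intro span_scale span_diff t)
      have "v n - v m = (t n - t m) *\<^sub>R (b - w)"
      proof -
        have "(t n - t m) * (1 / (t m - t n)) = - 1" using False by (simp add: field_simps)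
        then have "(t n - t m) *\<^sub>R w = - ((v n - t n *\<^sub>R b) - (v m - t m *\<^sub>R b))"
          by (simp add: w_def)
        then show ?thesis by (simp add: scaleR_diff_right scaleR_diff_left)
      qed
      then have "D (v n) (v m) = \<bar>t n - t m\<bar> powr q * D b w"
        using nonneg by (simp add: D_def scale powr_mult)
      moreover have "\<bar>t n - t m\<bar> powr q * d \<le> \<bar>t n - t m\<bar> powr q * D b w"
        using d(2)[OF w] by (intro mult_left_mono) auto
      ultimately show ?thesis using D_tri[of "v n" "v m" x] v(2)[of n] v(2)[of m] D_commute[of x "v n"] by linarith
    qed simp
    have "Cauchy t"
      unfolding Cauchy_def dist_real_def
    proof (intro allI impI)
      fix \<epsilon> :: real assume \<epsilon>: "0 < \<epsilon>"
      then have "0 < \<epsilon> powr q * d / 2" using d by simp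
      then obtain M where M: "inverse (real (Suc M)) < \<epsilon> powr q * d / 2" using reals_Archimedean by blast
      have "\<bar>t n - t m\<bar> < \<epsilon>" if nm: "M \<le> n" "M \<le> m" for n m
      proof -
        have "inverse (real (Suc n)) \<le> inverse (real (Suc M))" "inverse (real (Suc m)) \<le> inverse (real (Suc M))"
          using nm by (auto intro!: le_imp_inverse_le)
        then have "\<bar>t n - t m\<bar> powr q * d < \<epsilon> powr q * d" using tb[of n m] M by linarith
        then have "\<bar>t n - t m\<bar> powr q < \<epsilon> powr q" using d(1) by simp
        then show ?thesis using powr_less_iff[OF q0 _ \<epsilon>] by simp
      qed
      then show "\<exists>M. \<forall>m\<ge>M. \<forall>n\<ge>M. \<bar>t m - t n\<bar> < \<epsilon>" by blast
    qed
    then obtain T where T: "t \<longlonglongrightarrow> T" by (auto simp: Cauchy_convergent_iff convergent_def)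
    have lim0: "(\<lambda>n. inverse (real (Suc n)) + \<bar>t n - T\<bar> powr q * N b powr q) \<longlonglongrightarrow> 0"
    proof -
      have "(\<lambda>n. \<bar>t n - T\<bar>) \<longlonglongrightarrow> 0" using T by (simp add: tendsto_rabs_zero_iff LIM_zero_iff)
      then have "(\<lambda>n. \<bar>t n - T\<bar> powr q) \<longlonglongrightarrow> 0 powr q"
        using q0 by (intro tendsto_powr') auto
      then have "(\<lambda>n. \<bar>t n - T\<bar> powr q * N b powr q) \<longlonglongrightarrow> 0" using q0 by (simp add: tendsto_mult_left_zero)
      from tendsto_add[OF LIMSEQ_inverse_real_of_nat this] show ?thesis by simp
    qed
    have "x - T *\<^sub>R b \<in> span B"
    proof (rule insert.IH[OF bX(2)])
      show "x - T *\<^sub>R b \<in> X" using X bX(1) insert.prems(2) by (intro subspace_diff subspace_scale)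
      fix e :: real assume "0 < e"
      then have "\<forall>\<^sub>F n in sequentially. inverse (real (Suc n)) + \<bar>t n - T\<bar> powr q * N b powr q < e"
        using lim0 by (intro order_tendstoD(2))
      then obtain n where n: "inverse (real (Suc n)) + \<bar>t n - T\<bar> powr q * N b powr q < e"
        using eventually_happens' sequentially_bot by blast
      have eq: "(x - T *\<^sub>R b) - (v n - t n *\<^sub>R b) = (x - v n) + (t n - T) *\<^sub>R b" by (simp add: algebra_simps)
      have "D (x - T *\<^sub>R b) (v n - t n *\<^sub>R b) \<le> D x (v n) + \<bar>t n - T\<bar> powr q * N b powr q"
        unfolding D_def eq using tri[of "x - v n" "(t n - T) *\<^sub>R b"] nonneg by (simp add: scale powr_mult)
      then show "\<exists>v\<in>span B. D (x - T *\<^sub>R b) v < e" using n v(2)[of n] t[of n] by (intro bexI[of _ "v n - t n *\<^sub>R b"]) linarith+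
    qed
    then show ?thesis using span_breakdown_eq by blast
  qed
qed

text \<open>Riesz's lemma: normalising \<open>y - v0\<close>, where \<open>v0\<close> approximates
  \<open>y\<close> within twice the distance to \<open>span B\<close>, gives a unit vector at
  distance at least 1/2. This uses homogeneity, so the constant does not depend on
  \<open>q\<close>.\<close>

lemma separated_unit_sequence:
  assumes X: "subspace X" and def: "\<And>x. x \<in> X \<Longrightarrow> N x = 0 \<Longrightarrow> x = 0"
    and inf: "\<not> (\<exists>B. finite B \<and> span B = X)"
  shows "\<exists>z :: nat \<Rightarrow> 'a. (\<forall>n. N (z n) = 1) \<and> (\<forall>n m. n \<noteq> m \<longrightarrow> 1 / 2 \<le> N (z n - z m))"
proof -
  have "\<exists>z. z \<in> X \<and> N z = 1 \<and> (\<forall>v\<in>span B. 1 / 2 \<le> N (z - v))" if B: "finite B" "B \<subseteq> X" for B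
  proof -
    have spX: "span B \<subseteq> X" using B(2) X by (rule span_minimal)
    then obtain y where y: "y \<in> X" "y \<notin> span B" using inf B(1) by blast
    obtain e where e: "0 < e" "\<And>v. v \<in> span B \<Longrightarrow> e \<le> D y v"
      using span_finite_closed[OF X def B y(1)] y(2) by (meson not_le)
    define I where "I = (\<lambda>v. N (y - v)) ` span B"
    have ge: "e powr (1 / q) \<le> N (y - v)" if "v \<in> span B" for v
    proof -
      have "e powr (1 / q) \<le> D y v powr (1 / q)" using e(2)[OF that] e(1) q0 by (intro powr_mono2) auto
      then show ?thesis using q0 nonneg by (simp add: D_def powr_powr)
    qed
    have I: "I \<noteq> {}" "bdd_below I" unfolding I_def using span_zero by (auto intro: bdd_belowI2[OF nonneg])
    have "e powr (1 / q) \<le> Inf I" using I(1) ge by (intro cInf_greatest) (auto simp: I_def)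
    then have d: "0 < Inf I" using e(1) by (smt (verit) powr_gt_zero)
    then obtain v0 where v0: "v0 \<in> span B" "N (y - v0) < 2 * Inf I"
      using cInf_lessD[OF I(1), of "2 * Inf I"] by (auto simp: I_def)
    have le: "Inf I \<le> N (y - v)" if "v \<in> span B" for v using that I(2) by (intro cInf_lower) (auto simp: I_def)
    define c where "c = N (y - v0)"
    have c: "0 < c" "c < 2 * Inf I" using le[OF v0(1)] d v0(2) by (auto simp: c_def)
    have "1 / 2 \<le> N ((1 / c) *\<^sub>R (y - v0) - v)" if v: "v \<in> span B" for v
    proof -
      have "(1 / c) *\<^sub>R (y - v0) - v = (1 / c) *\<^sub>R (y - (v0 + c *\<^sub>R v))"
        using c by (simp add: algebra_simps)
      then have "N ((1 / c) *\<^sub>R (y - v0) - v) = N (y - (v0 + c *\<^sub>R v)) / c" using c by (simp add: scale)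
      moreover have "Inf I \<le> N (y - (v0 + c *\<^sub>R v))" using v v0(1) by (intro le span_add span_scale)
      ultimately show ?thesis using c by (simp add: pos_le_divide_eq)
    qed
    moreover have "(1 / c) *\<^sub>R (y - v0) \<in> X" using y(1) v0(1) spX X by (intro subspace_scale subspace_diff) auto
    moreover have "N ((1 / c) *\<^sub>R (y - v0)) = 1" using c by (simp add: scale c_def)
    ultimately show ?thesis by blast
  qed
  then obtain f where f: "\<And>B. finite B \<Longrightarrow> B \<subseteq> X \<Longrightarrow> f B \<in> X \<and> N (f B) = 1 \<and> (\<forall>v\<in>span B. 1 / 2 \<le> N (f B - v))"
    by metis
  define S where "S n = ((\<lambda>B. insert (f B) B) ^^ n) {}" for n
  have S_Suc: "S (Suc n) = insert (f (S n)) (S n)" for n by (simp add: S_def)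
  have S: "finite (S n) \<and> S n \<subseteq> X" for n by (induction n) (use f in \<open>auto simp: S_def\<close>)
  have mono: "S n \<subseteq> S m" if "n \<le> m" for n m using lift_Suc_mono_le[OF _ that, of S] S_Suc by blast
  have lt: "1 / 2 \<le> N (f (S m) - f (S n))" if "n < m" for n m
  proof -
    have "f (S n) \<in> S m" using mono[of "Suc n" m] that S_Suc by auto
    then show ?thesis using f[of "S m"] S[of m] by (auto intro: span_base)
  qed
  have "1 / 2 \<le> N (f (S n) - f (S m))" if "n \<noteq> m" for n m
    using lt[of n m] lt[of m n] that N_commute[of "f (S n)"] by (metis linorder_neqE_nat)
  then show ?thesis using f S by (intro exI[of _ "\<lambda>n. f (S n)"]) blast
qed

end

subsection \<open>Molecules in the free space\<close>

text \<open>The completion of the molecules under \<open>mnorm\<close> is an admissible target of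
  the universal property. The map sending \<open>x\<close> to \<open>pt x - pt z\<close> is
  isometric into it, so its linearisation \<open>T\<close> is a contraction, and it carries
  \<open>lin_ext \<delta> m\<close> to the copy of \<open>m\<close>.\<close>

lemma mnorm_le_free_norm:
  fixes F :: "'a big set"
  assumes p: "0 < p" "p \<le> 1" and free: "lipschitz_free p M d z F N \<delta>" and m: "m \<in> mval ` mlists M"
  shows "mnorm p M d m \<le> N (lin_ext \<delta> m) powr p"
proof -
  let ?P = "mval ` mlists M :: ('a, real) poly_mapping set"
  note M = lipschitz_freeD(1,2)[OF free] and F = lipschitz_freeD(3)[OF free] and dF = lipschitz_freeD(4)[OF free]
  interpret P: psemi p ?P "mnorm p M d" by (rule psemi_mnorm[OF p])
  obtain Y :: "'a big set" and Q \<iota> where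
    *: "pnorm p Y Q \<and> complete_on Y Q
     \<and> (\<forall>u\<in>?P. \<iota> u \<in> Y \<and> Q (\<iota> u) = mnorm p M d u) \<and> (\<forall>u\<in>?P. \<forall>v\<in>?P. \<iota> (u + v) = \<iota> u + \<iota> v)
     \<and> (\<forall>a. \<forall>u\<in>?P. \<iota> (a *\<^sub>R u) = a *\<^sub>R \<iota> u)
     \<and> (\<forall>w\<in>Y. \<forall>e>0. \<exists>u\<in>?P. Q (w - \<iota> u) < e)"
    using P.completion by (elim exE) (rule that)
  have YQ: "pnorm p Y Q" "complete_on Y Q"
    using *[THEN conjunct1] *[THEN conjunct2, THEN conjunct1] .
  have i: "\<iota> u \<in> Y" "Q (\<iota> u) = mnorm p M d u" if "u \<in> ?P" for u
    using *[THEN conjunct2, THEN conjunct2, THEN conjunct1] that by blast+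
  have iadd: "\<iota> (u + v) = \<iota> u + \<iota> v" if "u \<in> ?P" "v \<in> ?P" for u v
    using *[THEN conjunct2, THEN conjunct2, THEN conjunct2, THEN conjunct1] that by blast
  have isc: "\<iota> (a *\<^sub>R u) = a *\<^sub>R \<iota> u" if "u \<in> ?P" for a u
    using *[THEN conjunct2, THEN conjunct2, THEN conjunct2, THEN conjunct2, THEN conjunct1] that by blast
  interpret Y: pnorm p Y Q by fact
  define NY where "NY w = Q w powr (1/p)" for w
  have NY: "s_banach p Y NY" unfolding NY_def by (rule s_banach_of_pnorm[OF YQ])
  define f where "f x = \<iota> (pt x - pt z)" for x
  have ptP: "pt x - pt y \<in> ?P" if "x \<in> M" "y \<in> M" for x y
    using that by (intro image_eqI[of _ _ "[(1, x, y)]"]) auto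
  have i0: "\<iota> 0 = 0" using isc[OF P.mem(4), of 0] by simp
  have idiff: "\<iota> (u - v) = \<iota> u - \<iota> v" if "u \<in> ?P" "v \<in> ?P" for u v
    using iadd[OF P.mem(2)[OF that] that(2)] by (simp add: algebra_simps)
  have fdiff: "f x - f y = \<iota> (pt x - pt y)" if "x \<in> M" "y \<in> M" for x y
    using idiff[OF ptP[OF that(1) M(2)] ptP[OF that(2) M(2)]] by (simp add: f_def)
  have dnn: "0 \<le> d x y" if "x \<in> M" "y \<in> M" for x y
    using M that unfolding p_metric_on_def by blast
  have f1: "NY (f x - f y) = d x y" if "x \<in> M" "y \<in> M" for x y
    using i(2)[OF ptP[OF that]] mnorm_pt[OF p M(1) that] dnn[OF that] p
    by (simp add: NY_def fdiff[OF that] powr_powr)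
  have "pointed_lipschitz M d z Y NY f"
    unfolding pointed_lipschitz_def using i(1) ptP M(2) f1 i0 by (auto simp: f_def intro!: exI[of _ 1])
  then obtain T where T: "bounded_linear_on F N Y NY T" "\<forall>x\<in>M. T (\<delta> x) = f x"
    "op_norm F N NY T = lip_const M d NY f"
    using lipschitz_freeD(8)[OF free NY] unfolding extends_lipschitz_def by blast
  have lc: "lip_const M d NY f \<le> 1"
    unfolding lip_const_def by (rule cInf_lower) (auto simp: f1 intro!: bdd_belowI[of _ 0])
  interpret F: pnorm p F "\<lambda>x. N x powr p" using F s_banach_iff p by blast
  have nF: "0 \<le> N u" if "u \<in> F" for u using F s_banach_iff[OF p] that by blast
  have Tadd: "T (u + v) = T u + T v" and Tsc: "T (a *\<^sub>R u) = a *\<^sub>R T u" if "u \<in> F" "v \<in> F" for u v a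
    using T(1) that unfolding bounded_linear_on_def by auto
  have T0: "T 0 = 0" using Tsc[OF F.mem(4) F.mem(4), of 0] by simp
  have Tdiff: "T (u - v) = T u - T v" if "u \<in> F" "v \<in> F" for u v
    using Tadd[OF F.mem(2)[OF that] that(2)] by (simp add: algebra_simps)
  have L: "lin_ext \<delta> (mval l) \<in> F \<and> T (lin_ext \<delta> (mval l)) = \<iota> (mval l)" if "l \<in> mlists M" for l
    using that
  proof (induction l)
    case Nil
    then show ?case using F.mem(4) T0 i0 by (simp add: lin_ext_linear)
  next
    case (Cons e l)
    obtain a x y where [simp]: "e = (a, x, y)" by (cases e)
    have xy: "x \<in> M" "y \<in> M" and l: "l \<in> mlists M" using Cons.prems by auto
    note IH = Cons.IH[OF l]
    have dd: "\<delta> x \<in> F" "\<delta> y \<in> F" using dF xy by auto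
    note dxy = F.mem(2)[OF dd]
    have e: "lin_ext \<delta> (mval (e # l)) = a *\<^sub>R (\<delta> x - \<delta> y) + lin_ext \<delta> (mval l)" by (simp add: lin_ext_linear)
    have "T (lin_ext \<delta> (mval (e # l))) = a *\<^sub>R (f x - f y) + \<iota> (mval l)"
      unfolding e using Tadd[OF F.mem(3)[OF dxy] conjunct1[OF IH]] Tsc[OF dxy dxy] Tdiff[OF dd] T(2) xy IH by simp
    also have "\<dots> = \<iota> (mval (e # l))"
      using fdiff[OF xy] isc[OF ptP[OF xy], of a] iadd[OF P.mem(3)[OF ptP[OF xy], of a] imageI[OF l]] by simp
    finally show ?case unfolding e using F.mem(1)[OF F.mem(3)[OF dxy] conjunct1[OF IH]] by blast
  qed
  then have mF: "lin_ext \<delta> m \<in> F" and Tm: "T (lin_ext \<delta> m) = \<iota> m" using m by auto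
  have "NY (\<iota> m) \<le> op_norm F N NY T * N (lin_ext \<delta> m)"
    using op_norm_bound[OF p F T(1) mF] Tm by simp
  also have "\<dots> \<le> 1 * N (lin_ext \<delta> m)" using T(3) lc nF[OF mF] by (intro mult_right_mono) auto
  finally have "NY (\<iota> m) powr p \<le> N (lin_ext \<delta> m) powr p" using p by (intro powr_mono2) (auto simp: NY_def)
  moreover have "NY (\<iota> m) powr p = mnorm p M d m"
    using i(2)[OF m] Y.nn[OF i(1)[OF m]] p by (simp add: NY_def powr_powr)
  ultimately show ?thesis by simp
qed

lemma lin_ext_mem_subspace:
  assumes "subspace V" "f ` M \<subseteq> V" "m \<in> mval ` mlists M"
  shows "lin_ext f m \<in> V"
proof -
  have "lin_ext f (mval l) \<in> V" if "l \<in> mlists M" for l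
    using that
  proof (induction l)
    case Nil
    then show ?case using assms(1) by (simp add: lin_ext_linear subspace_0)
  next
    case (Cons e l)
    obtain a x y where [simp]: "e = (a, x, y)" by (cases e)
    show ?case using Cons assms(2)
      by (auto simp: lin_ext_linear intro!: subspace_add[OF assms(1)] subspace_scale[OF assms(1)] subspace_diff[OF assms(1)])
  qed
  then show ?thesis using assms(3) by blast
qed

lemma barycenter_molecule:
  assumes p: "0 < p" "p \<le> 1" and free: "lipschitz_free p X d 0 F NF \<delta>"
    and \<beta>: "barycenter X N F NF \<delta> \<beta>" and m: "m \<in> mval ` mlists X"
  shows "\<beta> (lin_ext \<delta> m) = lin_ext (\<lambda>x. x) m"
proof -
  note F = lipschitz_freeD(3)[OF free] and dF = lipschitz_freeD(4)[OF free]
  interpret F: pnorm p F "\<lambda>x. NF x powr p" using F s_banach_iff p by blast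
  have add: "\<beta> (u + v) = \<beta> u + \<beta> v" and sc: "\<beta> (a *\<^sub>R u) = a *\<^sub>R \<beta> u" if "u \<in> F" "v \<in> F" for u v a
    using \<beta> that unfolding barycenter_def bounded_linear_on_def by auto
  have \<beta>\<delta>: "\<beta> (\<delta> x) = x" if "x \<in> X" for x using \<beta> that unfolding barycenter_def by blast
  have b0: "\<beta> 0 = 0" using sc[OF F.mem(4) F.mem(4), of 0] by simp
  have diff: "\<beta> (u - v) = \<beta> u - \<beta> v" if "u \<in> F" "v \<in> F" for u v
    using add[OF F.mem(2)[OF that] that(2)] by (simp add: algebra_simps)
  have "\<beta> (lin_ext \<delta> (mval l)) = lin_ext (\<lambda>x. x) (mval l)" if "l \<in> mlists X" for l
    using that
  proof (induction l)
    case Nil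
    then show ?case using b0 by (simp add: lin_ext_linear)
  next
    case (Cons e l)
    obtain a x y where [simp]: "e = (a, x, y)" by (cases e)
    have xy: "x \<in> X" "y \<in> X" and l: "l \<in> mlists X" using Cons.prems by auto
    have dd: "\<delta> x \<in> F" "\<delta> y \<in> F" using dF xy by auto
    note dxy = F.mem(2)[OF dd]
    have lF: "lin_ext \<delta> (mval l) \<in> F" by (rule lin_ext_mem_subspace[OF F.sub dF imageI[OF l]])
    have "lin_ext \<delta> (mval (e # l)) = a *\<^sub>R (\<delta> x - \<delta> y) + lin_ext \<delta> (mval l)" by (simp add: lin_ext_linear)
    then show ?case
      using add[OF F.mem(3)[OF dxy] lF] sc[OF dxy dxy] diff[OF dd] \<beta>\<delta> xy Cons.IH[OF l] by (simp add: lin_ext_linear)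
  qed
  then show ?thesis using m by blast
qed

text \<open>As \<open>\<delta> 0 = 0\<close>, each \<open>\<delta> x\<close> is the image of the
  molecule \<open>pt x - pt 0\<close>, so images of molecules already contain the span.\<close>

lemma molecules_dense:
  fixes X :: "'a::real_vector set"
  assumes p: "0 < p" "p \<le> 1" and free: "lipschitz_free p X d 0 F NF \<delta>" and u: "u \<in> F" and e: "0 < e"
    and nn: "\<And>v. v \<in> F \<Longrightarrow> 0 \<le> NF v" and sub: "subspace F"
  shows "\<exists>m\<in>mval ` mlists X. NF (u - lin_ext \<delta> m) powr p \<le> e"
proof -
  let ?P = "mval ` mlists X "
  note dF = lipschitz_freeD(4)[OF free] and z = lipschitz_freeD(2)[OF free] and d0 = lipschitz_freeD(5)[OF free]
  have e': "0 < e powr (1 / p)" using e by simp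
  obtain v where v: "v \<in> span (\<delta> ` X)" "NF (u - v) < e powr (1 / p)"
    using lipschitz_freeD(7)[OF free u e'] by blast
  have P: "subspace ?P" by (rule psemi.sub[OF psemi_mnorm[OF p]])
  have "span (\<delta> ` X) \<subseteq> lin_ext \<delta> ` ?P"
  proof (rule span_minimal)
    show "\<delta> ` X \<subseteq> lin_ext \<delta> ` ?P"
    proof (rule image_subsetI)
      fix x assume x: "x \<in> X"
      have "\<delta> x = lin_ext \<delta> (mval [(1, x, 0)])" unfolding lin_ext_mval using d0 by simp
      moreover have "mval [(1, x, 0)] \<in> ?P" using x z by (intro imageI) simp
      ultimately show "\<delta> x \<in> lin_ext \<delta> ` ?P" by blast
    qed
    show "subspace (lin_ext \<delta> ` ?P)" by (rule linear_subspace_image[OF linear_lin_ext P])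
  qed
  then obtain m where m: "m \<in> ?P" "v = lin_ext \<delta> m" using v(1) by blast
  have "v \<in> F" unfolding m(2) by (rule lin_ext_mem_subspace[OF sub dF m(1)])
  then have "NF (u - v) powr p \<le> (e powr (1 / p)) powr p"
    using v(2) p nn[OF subspace_diff[OF sub u]] by (intro powr_mono2) auto
  then show ?thesis using m p e by (auto simp: powr_powr)
qed

section \<open>Transfer from the free space to molecules on the whole type\<close>

theorem corollary7p8:
  fixes X :: "'a::real_vector set" and N :: "'a \<Rightarrow> real" and p q :: real
  assumes "0 < p" and "p < q" and "q \<le> 1"
    and "s_banach q X N"
    and "\<not> (\<exists>B. finite B \<and> span B = X)"
  shows "\<not> lipschitz_lifting_property p X N"
proof
  assume "lipschitz_lifting_property p X N"
  then obtain F NF \<delta> \<beta> S where free: "lipschitz_free p X (\<lambda>x y. N (x - y)) 0 F NF \<delta>"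
    and \<beta>: "barycenter X N F NF \<delta> \<beta>" and S: "bounded_linear_on X N F NF S" and sec: "\<forall>x\<in>X. \<beta> (S x) = x"
    unfolding lipschitz_lifting_property_def by blast
  have p: "0 < p" "p \<le> 1" using assms by auto
  have subX: "subspace X" and nnX: "\<And>x. x \<in> X \<Longrightarrow> 0 \<le> N x" and defX: "\<And>x. x \<in> X \<Longrightarrow> N x = 0 \<longleftrightarrow> x = 0"
    and scX: "\<And>a x. x \<in> X \<Longrightarrow> N (a *\<^sub>R x) = \<bar>a\<bar> * N x"
    and triX: "\<And>x y. x \<in> X \<Longrightarrow> y \<in> X \<Longrightarrow> N (x + y) powr q \<le> N x powr q + N y powr q"
    using assms(4) unfolding s_banach_def quasi_norm_on_def by auto
  \<comment> \<open>A linear projection of the type onto \<open>X\<close> extends the norm to a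
    gauge defined everywhere.\<close>
  obtain \<pi> where \<pi>: "range \<pi> \<subseteq> X" "linear \<pi>" "\<And>x. x \<in> X \<Longrightarrow> \<pi> x = x"
    using linear_exists_left_inverse_on[OF linear_id subX] by auto
  have \<pi>X: "\<pi> x \<in> X" for x using \<pi>(1) by blast
  note \<pi>l = linear_add[OF \<pi>(2)] linear_diff[OF \<pi>(2)] linear_scale[OF \<pi>(2)]
  interpret sf: snowflake p q "\<lambda>x. N (\<pi> x)"
    by unfold_locales (use assms nnX scX triX \<pi>X in \<open>auto simp: \<pi>l\<close>)
  note F = lipschitz_freeD(3)[OF free] and dF = lipschitz_freeD(4)[OF free]
  interpret F: pnorm p F "\<lambda>x. NF x powr p" using F s_banach_iff p by blast
  interpret P: psemi p "mval ` mlists X" "mnorm p X (\<lambda>x y. N (x - y))" by (rule psemi_mnorm[OF p])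
  have nF: "0 \<le> NF u" if "u \<in> F" for u using F s_banach_iff[OF p] that by blast
  have SF: "S x \<in> F" and Sadd: "S (x + y) = S x + S y" and Ssc: "S (a *\<^sub>R x) = a *\<^sub>R S x"
    if "x \<in> X" "y \<in> X" for x y a using S that unfolding bounded_linear_on_def by auto
  obtain C where C: "\<forall>x\<in>X. NF (S x) \<le> C * N x" using S unfolding bounded_linear_on_def by blast
  obtain C' where C': "\<forall>u\<in>F. N (\<beta> u) \<le> C' * NF u"
    using \<beta> unfolding barycenter_def bounded_linear_on_def by blast
  have \<beta>X: "\<beta> u \<in> X" and \<beta>diff: "\<beta> (u - v) = \<beta> u - \<beta> v" if "u \<in> F" "v \<in> F" for u v
  proof -
    have b: "\<beta> ` F \<subseteq> X" "\<forall>x\<in>F. \<forall>y\<in>F. \<beta> (x + y) = \<beta> x + \<beta> y"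
      using \<beta> unfolding barycenter_def bounded_linear_on_def by blast+
    show "\<beta> u \<in> X" using b(1) that by blast
    have "\<beta> ((u - v) + v) = \<beta> (u - v) + \<beta> v" using b(2) F.mem(2)[OF that] that(2) by blast
    then show "\<beta> (u - v) = \<beta> u - \<beta> v" by (simp add: algebra_simps)
  qed
  have \<Phi>F: "lin_ext \<delta> m \<in> F" if "m \<in> mval ` mlists X" for m
    by (rule lin_ext_mem_subspace[OF F.sub dF that])
  define G where "G x e m \<longleftrightarrow> m \<in> mval ` mlists X \<and> NF (S (\<pi> x) - lin_ext \<delta> m) powr p \<le> e" for x e m
  have err: "S (\<pi> x) - lin_ext \<delta> m \<in> F" if "m \<in> mval ` mlists X" for x m
    using F.mem(2)[OF SF[OF \<pi>X \<pi>X] \<Phi>F[OF that]] .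
  \<comment> \<open>The constants are the \<open>p\<close>-th powers of bounds for \<open>S\<close>
    and \<open>\<beta>\<close>; the added 1 keeps the second positive.\<close>
  interpret approximate_lifting p q "\<lambda>x. N (\<pi> x)" G "\<bar>C\<bar> powr p" "\<bar>C'\<bar> powr p + 1"
  proof
    show "0 \<le> \<bar>C\<bar> powr p" "0 < \<bar>C'\<bar> powr p + 1" by (auto intro: add_nonneg_pos)
    show "\<exists>m. G x e m" if "0 < e" for e x
      using molecules_dense[OF p free SF[OF \<pi>X \<pi>X] that nF F.sub] unfolding G_def by blast
    show "G x e' m" if "G x e m" "e \<le> e'" for x e m e' using that unfolding G_def by linarith
    show "G (x + y) (e + e') (m + m')" if g: "G x e m" "G y e' m'" for x e m y e' m'
    proof -
      have m: "m \<in> mval ` mlists X" "m' \<in> mval ` mlists X" using g by (auto simp: G_def)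
      have "S (\<pi> (x + y)) - lin_ext \<delta> (m + m') = (S (\<pi> x) - lin_ext \<delta> m) + (S (\<pi> y) - lin_ext \<delta> m')"
        by (simp add: \<pi>l lin_ext_linear Sadd[OF \<pi>X \<pi>X])
      then have "NF (S (\<pi> (x + y)) - lin_ext \<delta> (m + m')) powr p
          \<le> NF (S (\<pi> x) - lin_ext \<delta> m) powr p + NF (S (\<pi> y) - lin_ext \<delta> m') powr p"
        using F.add[OF err[OF m(1), of x] err[OF m(2), of y]] by simp
      then show ?thesis using g P.mem(1)[OF m] unfolding G_def by linarith
    qed
    show "G (a *\<^sub>R x) (\<bar>a\<bar> powr p * e) (a *\<^sub>R m)" if g: "G x e m" for a x e m
    proof -
      have m: "m \<in> mval ` mlists X" using g by (simp add: G_def)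
      have "S (\<pi> (a *\<^sub>R x)) - lin_ext \<delta> (a *\<^sub>R m) = a *\<^sub>R (S (\<pi> x) - lin_ext \<delta> m)"
        by (simp add: \<pi>l lin_ext_linear Ssc[OF \<pi>X \<pi>X] scaleR_diff_right)
      then have "NF (S (\<pi> (a *\<^sub>R x)) - lin_ext \<delta> (a *\<^sub>R m)) powr p = \<bar>a\<bar> powr p * NF (S (\<pi> x) - lin_ext \<delta> m) powr p"
        using F.sc[OF err[OF m, of x], of a] by simp
      then show ?thesis using g P.mem(3)[OF m, of a] unfolding G_def by (simp add: mult_left_mono)
    qed
    show "cost_le p sf.snow m (\<bar>C\<bar> powr p * N (\<pi> x) powr p + 2 * e)" if g: "G x e m" and e: "0 < e" for x e m
    proof -
      have m: "m \<in> mval ` mlists X" using g by (simp add: G_def)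
      have "mnorm p X (\<lambda>x y. N (x - y)) m \<le> NF (lin_ext \<delta> m) powr p"
        by (rule mnorm_le_free_norm[OF p free m])
      also have "\<dots> \<le> NF (S (\<pi> x)) powr p + e"
        using F.Rabs[OF SF[OF \<pi>X \<pi>X, of x] \<Phi>F[OF m]] g unfolding G_def by linarith
      also have "NF (S (\<pi> x)) powr p \<le> (\<bar>C\<bar> * N (\<pi> x)) powr p"
      proof (rule powr_mono2)
        have "C * N (\<pi> x) \<le> \<bar>C\<bar> * N (\<pi> x)" using nnX[OF \<pi>X] by (intro mult_right_mono) auto
        then show "NF (S (\<pi> x)) \<le> \<bar>C\<bar> * N (\<pi> x)" using C \<pi>X[of x] by force
      qed (use p nF SF[OF \<pi>X \<pi>X] in auto)
      also have "\<dots> = \<bar>C\<bar> powr p * N (\<pi> x) powr p" using nnX[OF \<pi>X] by (simp add: powr_mult)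
      \<comment> \<open>One \<open>e\<close> is the error of the approximation. The other makes the
        inequality strict, so that a representation below the bound exists.\<close>
      finally have "mnorm p X (\<lambda>x y. N (x - y)) m < \<bar>C\<bar> powr p * N (\<pi> x) powr p + 2 * e" using e by linarith
      then obtain l where l: "l \<in> mlists X" "mval l = m"
          "mcost p (\<lambda>x y. N (x - y)) l < \<bar>C\<bar> powr p * N (\<pi> x) powr p + 2 * e"
        unfolding mnorm_def using m by (subst (asm) cInf_less_iff) (auto intro: bdd_belowI[of _ 0] mcost_nonneg)
      have "tcost p sf.snow l = mcost p (\<lambda>x y. N (x - y)) l"
        using l(1)
      proof (induction l)
        case (Cons e l)
        obtain a x y where [simp]: "e = (a, x, y)" by (cases e)
        show ?case using Cons by (simp add: sf.snow_eq \<pi>l \<pi>(3))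
      qed simp
      then show ?thesis using l cost_leI[of p sf.snow l] by force
    qed
    show "N (\<pi> (sf.bary m - x)) powr p \<le> (\<bar>C'\<bar> powr p + 1) * e" if g: "G x e m" for x e m
    proof -
      have m: "m \<in> mval ` mlists X" using g by (simp add: G_def)
      note u = err[OF m, of x]
      have b: "\<beta> (lin_ext \<delta> m) = sf.bary m" by (rule barycenter_molecule[OF p free \<beta> m])
      have "\<beta> (S (\<pi> x) - lin_ext \<delta> m) = \<pi> x - sf.bary m"
        using \<beta>diff[OF SF[OF \<pi>X \<pi>X] \<Phi>F[OF m]] sec \<pi>X b by simp
      also have "\<dots> = \<pi> (x - sf.bary m)"
        using \<pi>(3)[of "sf.bary m"] \<beta>X[OF \<Phi>F[OF m] \<Phi>F[OF m]] b by (simp add: \<pi>l)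
      finally have e: "N (\<pi> (sf.bary m - x)) = N (\<beta> (S (\<pi> x) - lin_ext \<delta> m))"
        using sf.N_commute[of "sf.bary m" x] by simp
      have "N (\<beta> (S (\<pi> x) - lin_ext \<delta> m)) \<le> C' * NF (S (\<pi> x) - lin_ext \<delta> m)" using C' u by blast
      also have "\<dots> \<le> \<bar>C'\<bar> * NF (S (\<pi> x) - lin_ext \<delta> m)" using nF[OF u] by (intro mult_right_mono) auto
      finally have "N (\<pi> (sf.bary m - x)) powr p \<le> (\<bar>C'\<bar> * NF (S (\<pi> x) - lin_ext \<delta> m)) powr p"
        unfolding e using p nnX[OF \<beta>X[OF u u]] by (intro powr_mono2) auto
      also have "\<dots> = \<bar>C'\<bar> powr p * NF (S (\<pi> x) - lin_ext \<delta> m) powr p" using nF[OF u] by (simp add: powr_mult)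
      also have "\<dots> \<le> (\<bar>C'\<bar> powr p + 1) * e" using g unfolding G_def by (intro mult_mono) auto
      finally show ?thesis .
    qed
  qed
  have "x = 0" if "x \<in> X" "N (\<pi> x) = 0" for x using that defX \<pi>(3) by simp
  from sf.separated_unit_sequence[OF subX this assms(5)]
  obtain z :: "nat \<Rightarrow> 'a" where "\<forall>n. N (\<pi> (z n)) = 1" "\<forall>n m. n \<noteq> m \<longrightarrow> 1 / 2 \<le> N (\<pi> (z n - z m))" by blast
  then show False using no_separated_unit_sequence[of z] by blast
qed

end
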